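(* Let $(B_t)_{t\ge 0}$ be a standard Brownian motion and $(L_t)_{t\ge0}$ a Levy subordinator independent of $(B_t)_{t\ge 0}$. Let $f:[0,+\infty)\to[0,+\infty)$ be locally Lipschitz with $f(0)=0$, and suppose there are constants $A,B>0$ such that $|f(v)|\le Av+B$ for all $v>0$. Assume that the system $$dX_t=\sigma_t\,dB_t,\qquad dV_t=-f(V_t)\,dt+dL_t,\qquad V_t=\sigma_t^2,\ \sigma_t\ge 0,$$ with $V_0$ independent of the pair $\left((B_t)_{t\ge0},(L_t)_{t\ge0}\right)$, has a solution for which $(V_t)_{t\ge0}$ is stationary, nonnegative and integrable, and such that the following two assumptions hold: (Assumption A) as $h\downarrow0$, $\frac1h\int_0^h(\sigma_s-\sigma_0)^2\,ds\to0$ in probability; (Assumption B) $\mathbb{E}(\sigma_0^2)<+\infty$. Then multi-scaling does not occur for $X$.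
   Context: A Levy subordinator $(L_t)_{t\ge 0}$ is a real-valued Levy process with increasing paths, $L_0=0$, and $\mathbb{E}[\exp(-\lambda L_t)]=\exp[-t\Psi(\lambda)]$ with $\Psi(\lambda)=m\lambda+\int_{(0,+\infty)}(1-e^{-\lambda x})\,\nu(dx)$, where $m\ge0$ is the drift and $\nu$ (the characteristic measure) is a positive measure on $(0,+\infty)$ with $\int_{(0,+\infty)}(1\wedge x)\,\nu(dx)<+\infty$. The scaling function of $X$ is $A(q):=\limsup_{h\downarrow 0}\frac{\log \mathbb{E}\left(|X_{t+h}-X_t|^q\right)}{\log h}$, $q\ge1$, with values in $[-\infty,+\infty]$ (with $\log 0=-\infty$, $\log(+\infty)=+\infty$); it does not depend on $t$ because $X$ has stationary increments. (The function $A(\cdot)$ is unrelated to the constant $A$ in the growth bound on $f$.) Multi-scaling is said to occur if the set $\{q\ge 1:-\infty<A(q)<\frac q2\}$ has nonempty interior. *)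

theory Defs
  imports "HOL-Probability.Probability"
begin

text \<open>
  Stochastic processes are functions \<^typ>\<open>real \<Rightarrow> 'a \<Rightarrow> real\<close>, first the time, then the outcome. Only
  times \<open>t \<ge> 0\<close> matter. Path properties are required almost surely.
\<close>

subsection \<open>Processes, Brownian motion, subordinators\<close>

definition path :: "(real \<Rightarrow> 'a \<Rightarrow> real) \<Rightarrow> 'a \<Rightarrow> (real \<Rightarrow> real)" where
  "path X \<omega> = (\<lambda>t\<in>{0..}. X t \<omega>)"

abbreviation path_space :: "(real \<Rightarrow> real) measure" where
  "path_space \<equiv> PiM {0..} (\<lambda>_. borel)"

definition stochastic_process :: "'a measure \<Rightarrow> (real \<Rightarrow> 'a \<Rightarrow> real) \<Rightarrow> bool" where
  "stochastic_process M X \<longleftrightarrow> (\<forall>t\<ge>0. X t \<in> borel_measurable M)"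

definition stationary_process :: "'a measure \<Rightarrow> (real \<Rightarrow> 'a \<Rightarrow> real) \<Rightarrow> bool" where
  "stationary_process M X \<longleftrightarrow>
     (\<forall>h\<ge>0. distr M path_space (path (\<lambda>t. X (t + h))) = distr M path_space (path X))"

definition independent_increments :: "'a measure \<Rightarrow> (real \<Rightarrow> 'a \<Rightarrow> real) \<Rightarrow> bool" where
  "independent_increments M X \<longleftrightarrow>
     (\<forall>(\<tau> :: nat \<Rightarrow> real) n. 0 \<le> \<tau> 0 \<longrightarrow> mono \<tau> \<longrightarrow>
        prob_space.indep_vars M (\<lambda>_. borel) (\<lambda>i \<omega>. X (\<tau> (Suc i)) \<omega> - X (\<tau> i) \<omega>) {..<n})"

definition stationary_increments :: "'a measure \<Rightarrow> (real \<Rightarrow> 'a \<Rightarrow> real) \<Rightarrow> bool" where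
  "stationary_increments M X \<longleftrightarrow>
     (\<forall>t\<ge>0. \<forall>h\<ge>0. distr M borel (\<lambda>\<omega>. X (t + h) \<omega> - X t \<omega>) = distr M borel (\<lambda>\<omega>. X h \<omega> - X 0 \<omega>))"

definition cadlag :: "(real \<Rightarrow> real) \<Rightarrow> bool" where
  "cadlag x \<longleftrightarrow>
     (\<forall>t\<ge>0. (x \<longlongrightarrow> x t) (at_right t)) \<and> (\<forall>t>0. \<exists>l. (x \<longlongrightarrow> l) (at_left t))"

definition standard_brownian_motion :: "'a measure \<Rightarrow> (real \<Rightarrow> 'a \<Rightarrow> real) \<Rightarrow> bool" where
  "standard_brownian_motion M B \<longleftrightarrow>
     stochastic_process M B \<and>
     (AE \<omega> in M. B 0 \<omega> = 0) \<and>
     independent_increments M B \<and>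
     (\<forall>s t. 0 \<le> s \<longrightarrow> s < t \<longrightarrow>
        distributed M lborel (\<lambda>\<omega>. B t \<omega> - B s \<omega>) (normal_density 0 (sqrt (t - s)))) \<and>
     (AE \<omega> in M. continuous_on {0..} (\<lambda>t. B t \<omega>))"

definition levy_process :: "'a measure \<Rightarrow> (real \<Rightarrow> 'a \<Rightarrow> real) \<Rightarrow> bool" where
  "levy_process M L \<longleftrightarrow>
     stochastic_process M L \<and>
     (AE \<omega> in M. L 0 \<omega> = 0) \<and>
     independent_increments M L \<and>
     stationary_increments M L \<and>
     (AE \<omega> in M. cadlag (\<lambda>t. L t \<omega>))"

definition subordinator_measure :: "real measure \<Rightarrow> bool" where
  "subordinator_measure \<nu> \<longleftrightarrow>
     sets \<nu> = sets (restrict_space borel {0<..}) \<and> (\<integral>\<^sup>+ x. ennreal (min 1 x) \<partial>\<nu>) < \<infinity>"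

definition laplace_exponent :: "real \<Rightarrow> real measure \<Rightarrow> real \<Rightarrow> real" where
  "laplace_exponent m \<nu> u = m * u + (\<integral>x. 1 - exp (- u * x) \<partial>\<nu>)"

definition levy_subordinator :: "'a measure \<Rightarrow> (real \<Rightarrow> 'a \<Rightarrow> real) \<Rightarrow> bool" where
  "levy_subordinator M L \<longleftrightarrow>
     levy_process M L \<and>
     (AE \<omega> in M. mono_on {0..} (\<lambda>t. L t \<omega>)) \<and>
     (\<exists>m \<nu>. 0 \<le> m \<and> subordinator_measure \<nu> \<and>
        (\<forall>t\<ge>0. \<forall>u\<ge>0. (\<integral>\<omega>. exp (- u * L t \<omega>) \<partial>M) = exp (- t * laplace_exponent m \<nu> u)))"

definition independent_processes ::
  "'a measure \<Rightarrow> (real \<Rightarrow> 'a \<Rightarrow> real) \<Rightarrow> (real \<Rightarrow> 'a \<Rightarrow> real) \<Rightarrow> bool" where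
  "independent_processes M X Y \<longleftrightarrow> prob_space.indep_var M path_space (path X) path_space (path Y)"

text \<open>
  The library's \<open>indep_var\<close> needs both variables to have the same value type, so independence is
  stated through the generated \<open>\<sigma>\<close>-algebras.
\<close>

definition independent_of_pair ::
  "'a measure \<Rightarrow> ('a \<Rightarrow> real) \<Rightarrow> (real \<Rightarrow> 'a \<Rightarrow> real) \<Rightarrow> (real \<Rightarrow> 'a \<Rightarrow> real) \<Rightarrow> bool" where
  "independent_of_pair M Z X Y \<longleftrightarrow>
     prob_space.indep_set M
       (sets (vimage_algebra (space M) Z borel))
       (sets (vimage_algebra (space M) (\<lambda>\<omega>. (path X \<omega>, path Y \<omega>)) (path_space \<Otimes>\<^sub>M path_space)))"

definition tendsto_in_probability ::
  "'a measure \<Rightarrow> ('i \<Rightarrow> 'a \<Rightarrow> real) \<Rightarrow> ('a \<Rightarrow> real) \<Rightarrow> 'i filter \<Rightarrow> bool" where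
  "tendsto_in_probability M Y Z F \<longleftrightarrow>
     (\<forall>\<epsilon>>0. ((\<lambda>i. measure M {\<omega> \<in> space M. \<bar>Y i \<omega> - Z \<omega>\<bar> > \<epsilon>}) \<longlongrightarrow> 0) F)"


subsection \<open>The Ito integral\<close>

text \<open>
  The filtration is indexed by all of \<^typ>\<open>real\<close> because of the library locale; its members at
  negative times are irrelevant (one may take them equal to the one at time 0).
\<close>

definition adapted_brownian_motion ::
  "'a measure \<Rightarrow> (real \<Rightarrow> 'a measure) \<Rightarrow> (real \<Rightarrow> 'a \<Rightarrow> real) \<Rightarrow> bool" where
  "adapted_brownian_motion M F B \<longleftrightarrow>
     filtration (space M) F \<and>
     (\<forall>t. sets (F t) \<subseteq> sets M) \<and>
     standard_brownian_motion M B \<and>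
     (\<forall>t\<ge>0. B t \<in> borel_measurable (F t)) \<and>
     (\<forall>s t. 0 \<le> s \<longrightarrow> s < t \<longrightarrow>
        prob_space.indep_set M (sets (F s))
          (sets (vimage_algebra (space M) (\<lambda>\<omega>. B t \<omega> - B s \<omega>) borel)))"

definition progressively_measurable ::
  "(real \<Rightarrow> 'a measure) \<Rightarrow> (real \<Rightarrow> 'a \<Rightarrow> real) \<Rightarrow> bool" where
  "progressively_measurable F H \<longleftrightarrow>
     (\<forall>T\<ge>0. (\<lambda>(s, \<omega>). H s \<omega>) \<in> borel_measurable (restrict_space borel {0..T} \<Otimes>\<^sub>M F T))"

text \<open>
  A triple \<open>(n, \<tau>, \<xi>)\<close> encodes the simple integrand
  \<open>\<Sum>i<n. \<xi>\<^sub>i 1\<^bsub>(\<tau>\<^sub>i, \<tau>\<^sub>i\<^sub>+\<^sub>1]\<^esub>\<close>.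
\<close>

type_synonym 'a simple = "nat \<times> (nat \<Rightarrow> real) \<times> (nat \<Rightarrow> 'a \<Rightarrow> real)"

definition simple_integrand :: "(real \<Rightarrow> 'a measure) \<Rightarrow> 'a simple \<Rightarrow> bool" where
  "simple_integrand F = (\<lambda>(n, \<tau>, \<xi>).
     0 \<le> \<tau> 0 \<and> mono \<tau> \<and>
     (\<forall>i<n. \<xi> i \<in> borel_measurable (F (\<tau> i)) \<and> (\<exists>C. \<forall>\<omega>\<in>space (F (\<tau> i)). \<bar>\<xi> i \<omega>\<bar> \<le> C)))"

definition simple_value :: "'a simple \<Rightarrow> real \<Rightarrow> 'a \<Rightarrow> real" where
  "simple_value = (\<lambda>(n, \<tau>, \<xi>) s \<omega>. \<Sum>i<n. \<xi> i \<omega> * indicator {\<tau> i<..\<tau> (Suc i)} s)"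

definition simple_integral :: "(real \<Rightarrow> 'a \<Rightarrow> real) \<Rightarrow> 'a simple \<Rightarrow> real \<Rightarrow> 'a \<Rightarrow> real" where
  "simple_integral B = (\<lambda>(n, \<tau>, \<xi>) t \<omega>.
     \<Sum>i<n. \<xi> i \<omega> * (B (min (\<tau> (Suc i)) t) \<omega> - B (min (\<tau> i) t) \<omega>))"

text \<open>
  \<open>ito_integral M F B H I\<close>: the process \<open>I\<close> is (a continuous version of) the stochastic integral
  of \<open>H\<close> with respect to the \<open>F\<close>-Brownian motion \<open>B\<close>, for progressively measurable, almost surely
  locally square integrable \<open>H\<close>. It is the limit in probability of the integrals of simple
  integrands approximating \<open>H\<close>; the limit does not depend on the approximating sequence.
  Convergence is asked for at each fixed time; together with the continuity of \<open>I\<close> this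
  determines \<open>I\<close> up to indistinguishability, and it avoids suprema over uncountably many times,
  which need not be measurable since \<open>M\<close> is not assumed complete.
\<close>

definition ito_integral ::
  "'a measure \<Rightarrow> (real \<Rightarrow> 'a measure) \<Rightarrow> (real \<Rightarrow> 'a \<Rightarrow> real) \<Rightarrow>
     (real \<Rightarrow> 'a \<Rightarrow> real) \<Rightarrow> (real \<Rightarrow> 'a \<Rightarrow> real) \<Rightarrow> bool" where
  "ito_integral M F B H I \<longleftrightarrow>
     adapted_brownian_motion M F B \<and>
     progressively_measurable F H \<and>
     (\<forall>T\<ge>0. AE \<omega> in M. set_integrable lborel {0..T} (\<lambda>s. (H s \<omega>)\<^sup>2)) \<and>
     stochastic_process M I \<and>
     (AE \<omega> in M. continuous_on {0..} (\<lambda>t. I t \<omega>)) \<and>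
     (\<exists>S :: nat \<Rightarrow> 'a simple.
        (\<forall>k. simple_integrand F (S k)) \<and>
        (\<forall>T\<ge>0. tendsto_in_probability M
           (\<lambda>k \<omega>. LINT s:{0..T}|lborel. (simple_value (S k) s \<omega> - H s \<omega>)\<^sup>2) (\<lambda>_. 0) sequentially) \<and>
        (\<forall>t\<ge>0. tendsto_in_probability M (\<lambda>k. simple_integral B (S k) t) (I t) sequentially))"


subsection \<open>The stochastic volatility system\<close>

text \<open>
  \<open>(X, V, \<sigma>)\<close> solves \<open>dX = \<sigma> dB\<close>, \<open>dV = - f(V) dt + dL\<close>, \<open>V = \<sigma>\<^sup>2\<close>, \<open>\<sigma> \<ge> 0\<close>, with respect to the
  filtration \<open>F\<close>. The initial value of \<open>X\<close> is arbitrary.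
\<close>

definition solves_system ::
  "'a measure \<Rightarrow> (real \<Rightarrow> 'a measure) \<Rightarrow> (real \<Rightarrow> real) \<Rightarrow> (real \<Rightarrow> 'a \<Rightarrow> real) \<Rightarrow> (real \<Rightarrow> 'a \<Rightarrow> real) \<Rightarrow>
     (real \<Rightarrow> 'a \<Rightarrow> real) \<Rightarrow> (real \<Rightarrow> 'a \<Rightarrow> real) \<Rightarrow> (real \<Rightarrow> 'a \<Rightarrow> real) \<Rightarrow> bool" where
  "solves_system M F f B L X V \<sigma> \<longleftrightarrow>
     stochastic_process M X \<and>
     ito_integral M F B \<sigma> (\<lambda>t \<omega>. X t \<omega> - X 0 \<omega>) \<and>
     stochastic_process M V \<and>
     (AE \<omega> in M. \<forall>t\<ge>0. set_integrable lborel {0..t} (\<lambda>s. f (V s \<omega>)) \<and>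
        V t \<omega> = V 0 \<omega> - (LINT s:{0..t}|lborel. f (V s \<omega>)) + L t \<omega>) \<and>
     (AE \<omega> in M. \<forall>t\<ge>0. 0 \<le> \<sigma> t \<omega> \<and> V t \<omega> = (\<sigma> t \<omega>)\<^sup>2)"


subsection \<open>Scaling function and multi-scaling\<close>

definition log_ennreal :: "ennreal \<Rightarrow> ereal" where
  "log_ennreal x =
     (if x = 0 then - \<infinity> else if x = \<infinity> then \<infinity> else ereal (ln (enn2real x)))"

definition abs_moment :: "'a measure \<Rightarrow> real \<Rightarrow> ('a \<Rightarrow> real) \<Rightarrow> ennreal" where
  "abs_moment M q Z = (\<integral>\<^sup>+ \<omega>. ennreal (\<bar>Z \<omega>\<bar> powr q) \<partial>M)"

text \<open>
  The base time \<open>t\<close> is kept as a parameter, since the independence of \<open>t\<close> is a property of \<open>X\<close>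
  having stationary increments.
\<close>

definition scaling_function :: "'a measure \<Rightarrow> (real \<Rightarrow> 'a \<Rightarrow> real) \<Rightarrow> real \<Rightarrow> real \<Rightarrow> ereal" where
  "scaling_function M X t q =
     Limsup (at_right 0)
       (\<lambda>h. log_ennreal (abs_moment M q (\<lambda>\<omega>. X (t + h) \<omega> - X t \<omega>)) / ereal (ln h))"

definition multi_scaling :: "'a measure \<Rightarrow> (real \<Rightarrow> 'a \<Rightarrow> real) \<Rightarrow> real \<Rightarrow> bool" where
  "multi_scaling M X t \<longleftrightarrow>
     interior {q. 1 \<le> q \<and> - \<infinity> < scaling_function M X t q \<and> scaling_function M X t q < ereal (q / 2)}
       \<noteq> {}"

end

theory Submission
  imports Defs
begin

text \<open>
  The volatility is a functional of the initial value and the subordinator (the Euler scheme of its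
  equation converges pathwise), hence independent of the Brownian motion. So the stochastic integral
  is conditionally Gaussian: with \<open>p = q / 2\<close> and \<open>J\<close> the integral of \<open>V\<close> over \<open>[t, t + h]\<close>, the
  moment of order \<open>q\<close> of \<open>X (t + h) - X t\<close> is a positive constant times \<open>E (J powr p)\<close>. Put
  \<open>U = V t + (L (t + h) - L t)\<close>. For small \<open>h\<close> the growth bound on \<open>f\<close> gives
  \<open>h * (V t / 2 - b) \<le> J \<le> h * U\<close> and \<open>U / 2 - b \<le> V (t + h)\<close>. If \<open>E (V t powr p)\<close> is infinite,
  then so is \<open>E (J powr p)\<close> for all small \<open>h\<close>, and the scaling function is \<open>- \<infinity>\<close> at \<open>q\<close>. Otherwise
  \<open>E (V (t + h) powr p)\<close> is finite by stationarity, hence so is \<open>E (U powr p)\<close>, and the scaling function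
  is at least \<open>q / 2\<close>. The set in the definition of multi-scaling is therefore empty.
\<close>

subsection \<open>Step functions on uniform grids\<close>

text \<open>Several obstacles shape the proof. The simple integrands behind
  \<open>ito_integral\<close> are arbitrary adapted ones and hide the Gaussian structure, so they
  are exchanged for samples of \<open>\<sigma>\<close> on a uniform grid. They approximate only in
  probability; the exchange therefore rests on an estimate for probabilities instead of the isometry
  in mean square. The grid sums again converge only in probability, so moments pass to the limit
  through bounded truncations of the power, and monotone convergence then gives an identity valid in
  [0, \<infinity>]. Conditioning is replaced by Fubini for the finitely many samples and increments
  of one grid.

  Sampling on a grid needs regular paths, and the equation supplies them: \<open>V\<close> is a
  continuous function plus the monotone path of \<open>L\<close>, hence continuous off a countable
  set.

  No moments of \<open>L\<close> are given. They are read off from \<open>V\<close> itself: over a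
  short time the drift consumes at most half of the initial value and of the added increments, up to
  a constant, and stationarity controls the moment of \<open>V\<close> at the later time.\<close>

definition step :: "(nat \<Rightarrow> real) \<Rightarrow> nat \<Rightarrow> (nat \<Rightarrow> real) \<Rightarrow> real \<Rightarrow> real" where
  "step \<rho> n c s = (\<Sum>i<n. c i * indicator {\<rho> i<..\<rho> (Suc i)} s)"

text \<open>The index runs past \<open>n\<close> as well, so that the whole sequence is monotone, as
  step functions, simple integrands and independent increments require.\<close>

definition grid :: "real \<Rightarrow> real \<Rightarrow> nat \<Rightarrow> nat \<Rightarrow> real" where
  "grid t h n i = t + h * real i / real n"

lemma step_measurable [measurable]: "step \<rho> n c \<in> borel_measurable borel"
  unfolding step_def by measurable

lemma step_eq:
  assumes "mono \<rho>" "i < n" "\<rho> i < s" "s \<le> \<rho> (Suc i)"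
  shows "step \<rho> n c s = c i"
proof -
  have "indicator {\<rho> j<..\<rho> (Suc j)} s = (if j = i then 1 else 0 :: real)" for j
  proof -
    have "j < i \<Longrightarrow> \<rho> (Suc j) \<le> \<rho> i" "i < j \<Longrightarrow> \<rho> (Suc i) \<le> \<rho> j"
      using assms(1) by (auto simp: mono_def)
    then show ?thesis using assms(3,4)
      by (cases j i rule: linorder_cases) (auto simp: indicator_def)
  qed
  then have "step \<rho> n c s = (\<Sum>j<n. if j = i then c j else 0)"
    unfolding step_def by (intro sum.cong) auto
  then show ?thesis using assms(2) by simp
qed

lemma step_outside: "(\<And>i. i < n \<Longrightarrow> \<not> (\<rho> i < s \<and> s \<le> \<rho> (Suc i))) \<Longrightarrow> step \<rho> n c s = 0"
  unfolding step_def by (intro sum.neutral) (auto simp: indicator_def)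

lemma ex_grid_cell:
  assumes "(\<rho> 0 :: real) < s" "s \<le> \<rho> n"
  shows "\<exists>i<n. \<rho> i < s \<and> s \<le> \<rho> (Suc i)"
  using assms
proof (induction n)
  case (Suc n)
  then show ?case
    by (metis leI less_Suc_eq)
qed simp

text \<open>At most one cell contains \<open>s\<close>; outside all cells the step function is 0,
  hence the condition on \<open>g 0\<close>.\<close>

lemma step_comp:
  assumes "mono \<rho>" "g 0 = 0"
  shows "g (step \<rho> n c s) = step \<rho> n (\<lambda>i. g (c i)) s"
proof (cases "\<exists>i<n. \<rho> i < s \<and> s \<le> \<rho> (Suc i)")
  case True
  then show ?thesis using assms(1) by (auto simp: step_eq)
next
  case False
  then have "step \<rho> n d s = 0" for d
    by (intro step_outside) auto
  then show ?thesis using assms(2) by simp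
qed

lemma step_set_integral:
  assumes "mono \<rho>"
  shows "(LINT s:{\<rho> 0..\<rho> n}|lborel. step \<rho> n c s) = (\<Sum>i<n. c i * (\<rho> (Suc i) - \<rho> i))"
proof -
  have m: "\<rho> i \<le> \<rho> j" if "i \<le> j" for i j using assms that by (auto simp: mono_def)
  have "(LINT s:{\<rho> 0..\<rho> n}|lborel. step \<rho> n c s)
     = (LINT s|lborel. (\<Sum>i<n. c i * indicator {\<rho> i<..\<rho> (Suc i)} s))"
    unfolding set_lebesgue_integral_def
  proof (rule Bochner_Integration.integral_cong[OF refl])
    fix s
    show "indicator {\<rho> 0..\<rho> n} s *\<^sub>R step \<rho> n c s = (\<Sum>i<n. c i * indicator {\<rho> i<..\<rho> (Suc i)} s)"
    proof (cases "s \<in> {\<rho> 0..\<rho> n}")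
      case False
      have "\<not> (\<rho> i < s \<and> s \<le> \<rho> (Suc i))" if "i < n" for i
        using False m[of 0 i] m[of "Suc i" n] that by auto
      then have "step \<rho> n c s = 0" by (rule step_outside)
      then show ?thesis by (simp add: step_def)
    qed (simp add: step_def)
  qed
  also have "\<dots> = (\<Sum>i<n. LINT s|lborel. c i * indicator {\<rho> i<..\<rho> (Suc i)} s)"
    using m by (intro Bochner_Integration.integral_sum integrable_mult_right integrable_real_indicator) auto
  also have "\<dots> = (\<Sum>i<n. c i * (\<rho> (Suc i) - \<rho> i))"
    using m by (intro sum.cong refl) simp
  finally show ?thesis .
qed

lemma grid_mono: "0 \<le> h \<Longrightarrow> mono (grid t h n)"
  unfolding grid_def by (auto simp: mono_def divide_right_mono mult_left_mono)

lemma grid_0 [simp]: "grid t h n 0 = t"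
  by (simp add: grid_def)

lemma grid_end [simp]: "grid t h (Suc k) (Suc k) = t + h"
  by (simp add: grid_def del: of_nat_Suc)

lemma grid_Suc: "grid t h n (Suc i) - grid t h n i = h / real n"
  by (simp add: grid_def field_simps add_divide_distrib)

lemma grid_bounds: "0 \<le> h \<Longrightarrow> i \<le> n \<Longrightarrow> 0 < n \<Longrightarrow> t \<le> grid t h n i \<and> grid t h n i \<le> t + h"
  by (auto simp: grid_def field_simps mult_left_mono)

abbreviation grid_step :: "real \<Rightarrow> real \<Rightarrow> nat \<Rightarrow> (real \<Rightarrow> real) \<Rightarrow> real \<Rightarrow> real" where
  "grid_step t h k x \<equiv> step (grid t h (Suc k)) (Suc k) (\<lambda>i. x (grid t h (Suc k) i))"

text \<open>The sample point is the left end of the cell that contains \<open>s\<close>; it does not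
  depend on the sampled function.\<close>

lemma grid_step_eq:
  assumes "0 < h" "t < s" "s \<le> t + h"
  shows "\<exists>u. t \<le> u \<and> u < s \<and> s \<le> u + h / real (Suc k) \<and> (\<forall>x. grid_step t h k x s = x u)"
proof -
  obtain i where i: "i < Suc k" "grid t h (Suc k) i < s" "s \<le> grid t h (Suc k) (Suc i)"
    using ex_grid_cell[of "grid t h (Suc k)" s "Suc k"] assms by auto
  then show ?thesis
    using grid_bounds[of h i "Suc k" t] grid_mono[of h t "Suc k"] step_eq[of "grid t h (Suc k)" i "Suc k" s]
      grid_Suc[of t h "Suc k" i] assms
    by (intro exI[of _ "grid t h (Suc k) i"]) auto
qed

lemma grid_step_tendsto:
  assumes "0 < h" "t < s" "s \<le> t + h" "isCont x s"
  shows "(\<lambda>k. grid_step t h k x s) \<longlonglongrightarrow> x s"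
proof -
  obtain u where u: "\<And>k. u k < s \<and> s \<le> u k + h / real (Suc k) \<and> (\<forall>x. grid_step t h k x s = x (u k))"
    using grid_step_eq[OF assms(1-3)] by metis
  have "u \<longlonglongrightarrow> s"
  proof (rule tendsto_sandwich[of "\<lambda>k. s - h / real (Suc k)" _ _ "\<lambda>_. s"])
    have "(\<lambda>k. s - h * inverse (real (Suc k))) \<longlonglongrightarrow> s - h * 0"
      by (intro tendsto_intros LIMSEQ_inverse_real_of_nat)
    then show "(\<lambda>k. s - h / real (Suc k)) \<longlonglongrightarrow> s" by (simp add: divide_inverse)
    show "\<forall>\<^sub>F n in sequentially. s - h / real (Suc n) \<le> u n" using u by (auto simp: algebra_simps intro!: always_eventually)
    show "\<forall>\<^sub>F n in sequentially. u n \<le> s" using u by (auto intro!: always_eventually less_imp_le)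
  qed simp
  then have "(\<lambda>k. x (u k)) \<longlonglongrightarrow> x s" using assms(4) by (rule isCont_tendsto_compose[rotated])
  then show ?thesis using u by simp
qed

text \<open>Dominated convergence: the exceptional set is countable, hence null, and
  \<open>G\<close> is bounded on the compact square of possible values. A function of two variables
  covers all later uses at once: the distance \<open>\<bar>u - v\<bar>\<close>, its square, and
  \<open>u\<^sup>2\<close>.\<close>

lemma grid_step_integral_tendsto:
  fixes x :: "real \<Rightarrow> real" and G :: "real \<Rightarrow> real \<Rightarrow> real"
  assumes h: "0 < h"
    and meas: "set_borel_measurable borel {t..t+h} x"
    and bounded: "\<And>s. s \<in> {t..t+h} \<Longrightarrow> \<bar>x s\<bar> \<le> C"
    and D: "countable D" "\<And>s. s \<in> {t<..<t+h} - D \<Longrightarrow> isCont x s"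
    and G: "continuous_on UNIV (\<lambda>(u, v). G u v)"
  shows "(\<lambda>k. LINT s:{t..t+h}|lborel. G (grid_step t h k x s) (x s))
    \<longlonglongrightarrow> (LINT s:{t..t+h}|lborel. G (x s) (x s))"
proof -
  \<comment> \<open>\<open>x\<close> is measurable on the interval only. Multiplied by the indicator
    it is measurable on the line, and the integrals over the interval do not change.\<close>
  let ?y = "\<lambda>s. indicator {t..t+h} s * x s"
  have [measurable]: "?y \<in> borel_measurable borel"
    using meas by (simp add: set_borel_measurable_def)
  have Gm: "(\<lambda>s. G (a s) (b s)) \<in> borel_measurable borel"
    if "a \<in> borel_measurable borel" "b \<in> borel_measurable borel" for a b :: "real \<Rightarrow> real"
    using measurable_compose[OF measurable_Pair[OF that] borel_measurable_continuous_onI[OF G, unfolded borel_prod[symmetric]]]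
    by simp
  have C: "0 \<le> C" using bounded[of t] h by auto
  have "compact ((\<lambda>(u, v). G u v) ` ({-C..C} \<times> {-C..C}))"
    by (intro compact_continuous_image continuous_on_subset[OF G] compact_Times) auto
  then have "bounded ((\<lambda>(u, v). G u v) ` ({-C..C} \<times> {-C..C}))"
    by (rule compact_imp_bounded)
  then obtain K where K': "\<forall>y\<in>(\<lambda>(u, v). G u v) ` ({-C..C} \<times> {-C..C}). norm y \<le> K"
    unfolding bounded_iff by blast
  have K: "\<bar>G u v\<bar> \<le> K" if "\<bar>u\<bar> \<le> C" "\<bar>v\<bar> \<le> C" for u v
  proof -
    have "(u, v) \<in> {-C..C} \<times> {-C..C}" using that by auto
    then show ?thesis using K' by fastforce
  qed
  have step_bound: "\<bar>grid_step t h k x s\<bar> \<le> C" if "s \<in> {t..t+h}" for k s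
  proof (cases "s = t")
    case True
    \<comment> \<open>The cells are open on the left, so \<open>t\<close> lies in none of them and
      receives the default value 0.\<close>
    have "grid_step t h k x s = 0"
      using True h by (intro step_outside) (auto simp: grid_def not_less)
    then show ?thesis using C by simp
  next
    case False
    then have "t < s" "s \<le> t + h" using that by auto
    then obtain u where "t \<le> u" "u < s" "grid_step t h k x s = x u"
      using grid_step_eq[OF h, of t s k] by blast
    then show ?thesis using bounded[of u] that by auto
  qed
  have "(\<lambda>k. LINT s|lborel. indicator {t..t+h} s *\<^sub>R G (grid_step t h k x s) (?y s))
    \<longlonglongrightarrow> (LINT s|lborel. indicator {t..t+h} s *\<^sub>R G (?y s) (?y s))"
  proof (rule integral_dominated_convergence[where w="\<lambda>s. indicator {t..t+h} s * K"])
    show "(\<lambda>s. indicator {t..t+h} s *\<^sub>R G (?y s) (?y s)) \<in> borel_measurable lborel"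
      using Gm[of ?y ?y] by simp
    show "(\<lambda>s. indicator {t..t+h} s *\<^sub>R G (grid_step t h k x s) (?y s)) \<in> borel_measurable lborel" for k
      using Gm[of "grid_step t h k x" ?y] by simp
    show "integrable lborel (\<lambda>s. indicator {t..t+h} s * K)"
      using h by (intro integrable_mult_left integrable_real_indicator) auto
    have "AE s in lborel. s \<notin> insert t (insert (t+h) D)"
      using D(1) by (intro AE_not_in countable_imp_null_set_lborel) auto
    then show "AE s in lborel. (\<lambda>k. indicator {t..t+h} s *\<^sub>R G (grid_step t h k x s) (?y s))
        \<longlonglongrightarrow> indicator {t..t+h} s *\<^sub>R G (?y s) (?y s)"
    proof eventually_elim
      case (elim s)
      show ?case
      proof (cases "s \<in> {t..t+h}")
        case True
        then have "(\<lambda>k. grid_step t h k x s) \<longlonglongrightarrow> x s"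
          using elim D(2) h by (intro grid_step_tendsto) auto
        then have "(\<lambda>k. (\<lambda>(u, v). G u v) (grid_step t h k x s, x s)) \<longlonglongrightarrow> (\<lambda>(u, v). G u v) (x s, x s)"
          by (intro continuous_on_tendsto_compose[OF G] tendsto_intros) auto
        then show ?thesis using True by simp
      qed simp
    qed
    show "AE s in lborel. norm (indicator {t..t+h} s *\<^sub>R G (grid_step t h k x s) (?y s)) \<le> indicator {t..t+h} s * K" for k
      using K step_bound bounded by (auto simp: indicator_def)
  qed
  moreover have "indicator {t..t+h} s *\<^sub>R G u (?y s) = indicator {t..t+h} s *\<^sub>R G u (x s)" for s u
    by (simp add: indicator_def)
  moreover have "indicator {t..t+h} s *\<^sub>R G (?y s) (?y s) = indicator {t..t+h} s *\<^sub>R G (x s) (x s)" for s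
    by (simp add: indicator_def)
  ultimately show ?thesis
    unfolding set_lebesgue_integral_def by (simp only:)
qed

subsection \<open>Paths of the volatility equation\<close>

lemma set_integrable_const_Icc: "set_integrable lborel {x..y::real} (\<lambda>_. c::real)"
  unfolding set_integrable_def by (cases "x \<le> y") (auto intro!: integrable_mult_left integrable_real_indicator)

text \<open>The equation for one fixed outcome: everything here is deterministic, and the noise is
  any nondecreasing function starting at 0.\<close>

locale volatility_path =
  fixes f :: "real \<Rightarrow> real" and a b :: real and v l :: "real \<Rightarrow> real"
  assumes f_nonneg: "\<And>x. 0 \<le> x \<Longrightarrow> 0 \<le> f x"
    and f_growth: "\<And>x. 0 \<le> x \<Longrightarrow> f x \<le> a * x + b"
    and f_lipschitz: "\<And>R. \<exists>K\<ge>0. \<forall>x\<in>{0..R}. \<forall>y\<in>{0..R}. \<bar>f x - f y\<bar> \<le> K * \<bar>x - y\<bar>"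
    and a_pos: "0 < a" and b_pos: "0 < b"
    and v_nonneg: "\<And>t. 0 \<le> t \<Longrightarrow> 0 \<le> v t"
    and drift_integrable: "\<And>t. 0 \<le> t \<Longrightarrow> set_integrable lborel {0..t} (\<lambda>s. f (v s))"
    and v_eq: "\<And>t. 0 \<le> t \<Longrightarrow> v t = v 0 - (LINT s:{0..t}|lborel. f (v s)) + l t"
    and l_mono: "mono_on {0..} l"
    and l_0: "l 0 = 0"
begin

lemma drift_integrable': "0 \<le> t \<Longrightarrow> set_integrable lborel {t..s} (\<lambda>u. f (v u))"
  by (cases "t \<le> s") (auto intro: set_integrable_subset[OF drift_integrable[of s]])

lemma l_le: "0 \<le> t \<Longrightarrow> t \<le> s \<Longrightarrow> l t \<le> l s"
  using l_mono by (auto simp: mono_on_def)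

lemma v_increment:
  assumes "0 \<le> t" "t \<le> s"
  shows "v s = v t - (LINT u:{t..s}|lborel. f (v u)) + (l s - l t)"
proof -
  have i: "set_integrable lborel {0..t} (\<lambda>u. f (v u))" "set_integrable lborel {t..s} (\<lambda>u. f (v u))"
    "set_integrable lborel {0..s} (\<lambda>u. f (v u))"
    using assms by (auto intro!: drift_integrable')
  \<comment> \<open>The closed intervals share the point \<open>t\<close>, so their indicators add
    up only almost everywhere.\<close>
  have "AE u in lborel. u \<noteq> t" by (rule AE_lborel_singleton)
  then have "AE u in lborel. indicator {0..s} u *\<^sub>R f (v u)
      = indicator {0..t} u *\<^sub>R f (v u) + indicator {t..s} u *\<^sub>R f (v u)"
    by eventually_elim (use assms in \<open>auto simp: indicator_def\<close>)
  then have "(LINT u:{0..s}|lborel. f (v u)) = (LINT u:{0..t}|lborel. f (v u)) + (LINT u:{t..s}|lborel. f (v u))"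
    using i unfolding set_lebesgue_integral_def set_integrable_def
    by (subst Bochner_Integration.integral_add[symmetric])
      (assumption+, intro integral_cong_AE borel_measurable_integrable Bochner_Integration.integrable_add)
  then show ?thesis using v_eq[of t] v_eq[of s] assms by simp
qed

lemma v_le:
  assumes "0 \<le> t" "t \<le> s"
  shows "v s \<le> v t + (l s - l t)"
proof -
  have "0 \<le> (LINT u:{t..s}|lborel. f (v u))"
    using assms f_nonneg v_nonneg by (auto simp: set_lebesgue_integral_def indicator_def intro!: integral_nonneg)
  then show ?thesis using v_increment[OF assms] by simp
qed

text \<open>Up to time \<open>s\<close> the path stays below \<open>?u\<close>, so the drift removes
  at most \<open>(s - t) * (a * ?u + b)\<close>. The two smallness conditions make this at most half
  of \<open>?u\<close> plus \<open>b\<close>.\<close>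

lemma v_ge:
  assumes "0 \<le> t" "t \<le> s" "s - t \<le> 1" "a * (s - t) \<le> 1 / 2"
  shows "(v t + (l s - l t)) / 2 - b \<le> v s"
proof -
  let ?u = "v t + (l s - l t)"
  have u: "0 \<le> ?u" using v_nonneg[of t] l_le[of t s] assms by simp
  have "(LINT u:{t..s}|lborel. f (v u)) \<le> (LINT u:{t..s}|lborel. a * ?u + b)"
  proof (rule set_integral_mono)
    show "set_integrable lborel {t..s} (\<lambda>u. f (v u))" using assms by (intro drift_integrable')
    show "set_integrable lborel {t..s} (\<lambda>_. a * ?u + b)"
      by (rule set_integrable_const_Icc)
    fix u assume u: "u \<in> {t..s}"
    have "v u \<le> ?u" using v_le[of t u] l_le[of u s] u assms by auto
    then have "a * v u \<le> a * ?u" using a_pos by simp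
    then show "f (v u) \<le> a * ?u + b" using f_growth[of "v u"] v_nonneg[of u] u assms by auto
  qed
  also have "\<dots> = (s - t) * (a * ?u + b)" using assms by (simp add: set_lebesgue_integral_def)
  also have "\<dots> = (a * (s - t)) * ?u + (s - t) * b" by (simp add: algebra_simps)
  also have "\<dots> \<le> (1 / 2) * ?u + 1 * b"
    using u b_pos assms by (intro add_mono mult_right_mono) auto
  finally have "(LINT u:{t..s}|lborel. f (v u)) \<le> ?u / 2 + b" by simp
  moreover have "v s = ?u - (LINT u:{t..s}|lborel. f (v u))"
    using v_increment[OF assms(1,2)] by simp
  ultimately show ?thesis by argo
qed

lemma drift_continuous: "continuous_on {0..T} (\<lambda>t. LINT s:{0..t}|lborel. f (v s))"
proof (cases "0 \<le> T")
  case True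
  have "continuous_on {0..T} (\<lambda>t. integral {0..t} (\<lambda>s. f (v s)))"
    using set_borel_integral_eq_integral(1)[OF drift_integrable[OF True]] by (rule indefinite_integral_continuous_1)
  then show ?thesis
    by (rule continuous_on_cong[THEN iffD1, rotated 2])
      (use set_borel_integral_eq_integral(2)[OF drift_integrable] in auto)
qed simp

text \<open>The equation exhibits \<open>v\<close> as a continuous function plus a monotone
  one.\<close>

lemma v_measurable:
  assumes "0 \<le> t" shows "set_borel_measurable borel {t..s} v"
proof -
  have "(\<lambda>u. v 0 - (LINT s:{0..u}|lborel. f (v s)) + l u) \<in> borel_measurable (restrict_space borel {0..s})"
  proof (intro borel_measurable_add borel_measurable_diff borel_measurable_const)
    show "(\<lambda>u. LINT s:{0..u}|lborel. f (v s)) \<in> borel_measurable (restrict_space borel {0..s})"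
      by (rule borel_measurable_continuous_on_restrict[OF drift_continuous])
    show "l \<in> borel_measurable (restrict_space borel {0..s})"
      by (rule borel_measurable_mono_on_fnc) (use l_mono in \<open>auto simp: mono_on_def\<close>)
  qed
  also have "?this \<longleftrightarrow> v \<in> borel_measurable (restrict_space borel {0..s})"
    by (rule measurable_cong) (auto simp: space_restrict_space v_eq[symmetric])
  finally have "set_borel_measurable borel {0..s} v"
    by (simp add: set_borel_measurable_def borel_measurable_restrict_space_iff)
  then show ?thesis
    by (rule set_borel_measurable_subset) (use assms in auto)
qed

text \<open>The drift integral is continuous, so \<open>v\<close> can jump only where
  \<open>l\<close> does, and a monotone function has countably many jumps. Time 0 is left out
  because \<open>isCont\<close> is two-sided.\<close>

lemma v_continuous: "\<exists>D. countable D \<and> (\<forall>s\<in>{0<..} - D. isCont v s)"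
proof (intro exI conjI ballI)
  show "countable {s\<in>{0<..}. \<not> isCont l s}"
    by (rule mono_on_ctble_discont_open) (use l_mono in \<open>auto simp: mono_on_def\<close>)
  fix s assume s: "s \<in> {0<..} - {s\<in>{0<..}. \<not> isCont l s}"
  have "continuous_on {0<..<s + 1} (\<lambda>t. LINT s:{0..t}|lborel. f (v s))"
    by (rule continuous_on_subset[OF drift_continuous[of "s + 1"]]) auto
  then have "isCont (\<lambda>t. LINT s:{0..t}|lborel. f (v s)) s"
    using s by (subst (asm) continuous_on_eq_continuous_at) auto
  then have "isCont (\<lambda>u. v 0 - (LINT s:{0..u}|lborel. f (v s)) + l u) s"
    using s by (intro continuous_intros) auto
  moreover have "\<forall>\<^sub>F u in nhds s. v 0 - (LINT s:{0..u}|lborel. f (v s)) + l u = v u"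
    using eventually_nhds_in_open[of "{0<..}" s] s
    by (auto elim!: eventually_mono simp: v_eq[symmetric])
  ultimately show "isCont v s"
    using isCont_cong[of "\<lambda>u. v 0 - (LINT s:{0..u}|lborel. f (v s)) + l u" v s] by blast
qed

lemma v_bounded: "s \<in> {t..t+h} \<Longrightarrow> 0 \<le> t \<Longrightarrow> \<bar>v s\<bar> \<le> v 0 + l (t + h)"
  using v_le[of 0 s] l_le[of s "t+h"] v_nonneg[of s] l_0 by auto

lemma v_integrable:
  assumes "0 \<le> t" shows "set_integrable lborel {t..t+h} v"
proof (rule set_integrable_bound[OF set_integrable_const_Icc[of t "t+h" "v 0 + l (t + h)"]])
  show "set_borel_measurable lborel {t..t+h} v"
    using v_measurable[OF assms, of "t+h"] by (simp add: set_borel_measurable_def)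
  show "AE s in lborel. s \<in> {t..t+h} \<longrightarrow> norm (v s) \<le> norm (v 0 + l (t + h))"
    using v_bounded[of _ t h] assms by (auto intro!: AE_I2 order_trans[OF _ abs_ge_self])
qed

lemma v_integral_le:
  assumes "0 \<le> t" "0 \<le> h"
  shows "(LINT s:{t..t+h}|lborel. v s) \<le> h * (v t + (l (t + h) - l t))"
proof -
  have "(LINT s:{t..t+h}|lborel. v s) \<le> (LINT s:{t..t+h}|lborel. v t + (l (t + h) - l t))"
  proof (rule set_integral_mono[OF v_integrable[OF assms(1)]])
    show "set_integrable lborel {t..t+h} (\<lambda>_. v t + (l (t + h) - l t))"
      by (rule set_integrable_const_Icc)
    fix s assume "s \<in> {t..t+h}"
    then show "v s \<le> v t + (l (t + h) - l t)" using v_le[of t s] l_le[of s "t+h"] assms by auto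
  qed
  also have "\<dots> = h * (v t + (l (t + h) - l t))" using assms by (simp add: set_lebesgue_integral_def)
  finally show ?thesis .
qed

lemma v_integral_ge:
  assumes "0 \<le> t" "0 \<le> h" "h \<le> 1" "a * h \<le> 1 / 2"
  shows "h * (v t / 2 - b) \<le> (LINT s:{t..t+h}|lborel. v s)"
proof -
  have "h * (v t / 2 - b) = (LINT s:{t..t+h}|lborel. v t / 2 - b)" using assms by (simp add: set_lebesgue_integral_def)
  also have "\<dots> \<le> (LINT s:{t..t+h}|lborel. v s)"
  proof (rule set_integral_mono[OF _ v_integrable[OF assms(1)]])
    show "set_integrable lborel {t..t+h} (\<lambda>_. v t / 2 - b)"
      by (rule set_integrable_const_Icc)
    fix s assume s: "s \<in> {t..t+h}"
    then have "a * (s - t) \<le> a * h" using a_pos by simp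
    then show "v t / 2 - b \<le> v s" using v_ge[of t s] l_le[of t s] assms s by (simp add: field_simps)
  qed
  finally show ?thesis .
qed

end

text \<open>The argument of \<open>f\<close> is clamped to \<open>{0..R}\<close>, where
  \<open>f\<close> has a single Lipschitz constant; the approximations themselves may leave this
  interval.\<close>

primrec euler :: "(real \<Rightarrow> real) \<Rightarrow> real \<Rightarrow> real \<Rightarrow> real \<Rightarrow> (nat \<Rightarrow> real) \<Rightarrow> nat \<Rightarrow> real" where
  "euler f R \<delta> x d 0 = x"
| "euler f R \<delta> x d (Suc i) = euler f R \<delta> x d i - \<delta> * f (max 0 (min (euler f R \<delta> x d i) R)) + d i"

text \<open>Each source term \<open>d j\<close> is amplified by at most \<open>i\<close> factors
  \<open>1 + c\<close>, so the largest power can stand in front of the whole sum.\<close>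

lemma discrete_gronwall:
  fixes e d :: "nat \<Rightarrow> real"
  assumes "e 0 = 0" "0 \<le> c" "\<And>i. i < n \<Longrightarrow> 0 \<le> d i" "\<And>i. i < n \<Longrightarrow> e (Suc i) \<le> (1 + c) * e i + d i"
  shows "i \<le> n \<Longrightarrow> e i \<le> (1 + c) ^ i * (\<Sum>j<i. d j)"
proof (induction i)
  case (Suc i)
  have "e (Suc i) \<le> (1 + c) * e i + d i" using Suc.prems assms(4) by simp
  also have "\<dots> \<le> (1 + c) * ((1 + c) ^ i * (\<Sum>j<i. d j)) + (1 + c) ^ Suc i * d i"
  proof (intro add_mono mult_left_mono)
    have "1 * d i \<le> (1 + c) ^ Suc i * d i"
      using Suc.prems assms(2,3) by (intro mult_right_mono one_le_power) auto
    then show "d i \<le> (1 + c) ^ Suc i * d i" by simp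
  qed (use Suc assms(2) in auto)
  finally show ?case by (simp add: algebra_simps)
qed (use assms in simp)

context volatility_path
begin

text \<open>The increments of \<open>l\<close> enter the scheme exactly, so errors come only from
  freezing the drift. The new error on one cell is at most \<open>K\<close> times the integral of
  \<open>\<bar>v (g i) - v s\<bar>\<close>; added up, these integrals are the L1 distance between
  \<open>v\<close> and its grid samples. This distance tends to 0 by dominated convergence in spite
  of the jumps.\<close>

lemma euler_tendsto:
  assumes h: "0 < h"
  shows "(\<lambda>k. euler f (v 0 + l h) (h / real (Suc k)) (v 0)
      (\<lambda>i. l (grid 0 h (Suc k) (Suc i)) - l (grid 0 h (Suc k) i)) (Suc k)) \<longlonglongrightarrow> v h"
proof -
  \<comment> \<open>The drift only lowers the path, so \<open>v 0 + l h\<close> bounds it on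
    \<open>{0..h}\<close>. This level is a function of the data, which keeps the scheme measurable
    when the outcome varies.\<close>
  define R where "R = v 0 + l h"
  have v_R: "v s \<in> {0..R}" if "0 \<le> s" "s \<le> h" for s
    using v_bounded[of s 0 h] v_nonneg[of s] that unfolding R_def by auto
  have R: "0 \<le> R" using v_R[of 0] h by auto
  obtain K where K: "0 \<le> K" "\<And>x y. x \<in> {0..R} \<Longrightarrow> y \<in> {0..R} \<Longrightarrow> \<bar>f x - f y\<bar> \<le> K * \<bar>x - y\<bar>"
    using f_lipschitz[of R] by auto
  define J where "J = (\<lambda>k. LINT s:{0..h}|lborel. \<bar>grid_step 0 h k v s - v s\<bar>)"
  obtain D where D: "countable D" "\<And>s. s \<in> {0<..} - D \<Longrightarrow> isCont v s"
    using v_continuous by auto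
  have "(\<lambda>k. LINT s:{0..0 + h}|lborel. \<bar>grid_step 0 h k v s - v s\<bar>)
      \<longlonglongrightarrow> (LINT s:{0..0 + h}|lborel. \<bar>v s - v s\<bar>)"
    using v_R D(2) by (intro grid_step_integral_tendsto[OF h v_measurable _ D(1), where C=R])
      (auto simp: case_prod_beta' intro!: continuous_intros)
  then have J: "J \<longlonglongrightarrow> 0" by (simp add: J_def)
  have bound: "\<bar>euler f R (h / real (Suc k)) (v 0)
      (\<lambda>i. l (grid 0 h (Suc k) (Suc i)) - l (grid 0 h (Suc k) i)) (Suc k) - v h\<bar> \<le> exp (K * h) * (K * J k)" for k
  proof -
    define g where "g = grid 0 h (Suc k)"
    define \<delta> where "\<delta> = h / real (Suc k)"
    define E where "E = euler f R \<delta> (v 0) (\<lambda>i. l (g (Suc i)) - l (g i))"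
    define e where "e = (\<lambda>i. \<bar>E i - v (g i)\<bar>)"
    define d where "d = (\<lambda>i. K * (LINT s:{g i..g (Suc i)}|lborel. \<bar>v (g i) - v s\<bar>))"
    have \<delta>: "0 < \<delta>" "g (Suc i) = g i + \<delta>" "g (Suc i) - g i = \<delta>" for i
      using h grid_Suc[of 0 h "Suc k" i] by (auto simp: \<delta>_def g_def)
    have g: "0 \<le> g i" "g i \<le> h" if "i \<le> Suc k" for i
      using grid_bounds[of h i "Suc k" 0] h that by (auto simp: g_def)
    have g_mono: "mono g" unfolding g_def using h by (intro grid_mono) auto
    have int: "set_integrable lborel {g i..g (Suc i)} (\<lambda>s. \<bar>v (g i) - v s\<bar>)" if "i < Suc k" for i
    proof (intro set_integrable_abs set_integral_diff(1))
      show "set_integrable lborel {g i..g (Suc i)} (\<lambda>_. v (g i))"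
        by (rule set_integrable_const_Icc)
      show "set_integrable lborel {g i..g (Suc i)} v" using v_integrable[of "g i" \<delta>] g that \<delta>(2) by simp
    qed
    have step: "e (Suc i) \<le> (1 + K * \<delta>) * e i + d i" if i: "i < Suc k" for i
    proof -
      let ?c = "max 0 (min (E i) R)" and ?I = "{g i..g (Suc i)}"
      have le: "0 \<le> g i" "g i \<le> h" "0 \<le> g (Suc i)" "g (Suc i) \<le> h" "g i \<le> g (Suc i)"
        using g[of i] g[of "Suc i"] i \<delta>(1) \<delta>(2)[of i] by auto
      have c: "?c \<in> {0..R}" using R by auto
      have const: "set_integrable lborel ?I (\<lambda>_. x)" for x :: real
        by (rule set_integrable_const_Icc)
      have fint: "set_integrable lborel ?I (\<lambda>s. f (v s))" using le by (intro drift_integrable')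
      have "E (Suc i) - v (g (Suc i)) = E i - v (g i) + ((LINT s:?I|lborel. f (v s)) - \<delta> * f ?c)"
        using v_increment[of "g i" "g (Suc i)"] le by (simp add: E_def)
      also have "(LINT s:?I|lborel. f (v s)) - \<delta> * f ?c = (LINT s:?I|lborel. f (v s) - f ?c)"
        using le(5) \<delta>(3)[of i] by (subst set_integral_diff(2)[OF fint const]) (simp add: set_lebesgue_integral_def)
      finally have "e (Suc i) \<le> e i + \<bar>LINT s:?I|lborel. f (v s) - f ?c\<bar>"
        unfolding e_def by linarith
      also have "\<bar>LINT s:?I|lborel. f (v s) - f ?c\<bar> \<le> (LINT s:?I|lborel. \<bar>f (v s) - f ?c\<bar>)"
        using set_integral_norm_bound[OF set_integral_diff(1)[OF fint const[of "f ?c"]]] by simp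
      also have "\<dots> \<le> (LINT s:?I|lborel. K * \<bar>v (g i) - v s\<bar> + K * e i)"
      proof (rule set_integral_mono)
        show "set_integrable lborel ?I (\<lambda>s. \<bar>f (v s) - f ?c\<bar>)"
          by (intro set_integrable_abs set_integral_diff(1) fint const)
        show "set_integrable lborel ?I (\<lambda>s. K * \<bar>v (g i) - v s\<bar> + K * e i)"
          by (intro set_integral_add(1) set_integrable_mult_right int i const)
        fix s assume s: "s \<in> ?I"
        have "v (g i) \<in> {0..R}" "v s \<in> {0..R}" using v_R le s by auto
        \<comment> \<open>Clamping \<open>E i\<close> to \<open>{0..R}\<close> cannot increase its
          distance to the point \<open>v (g i)\<close> of that interval.\<close>
        then have "\<bar>v (g i) - ?c\<bar> \<le> e i" unfolding e_def by auto
        moreover have "\<bar>f (v s) - f ?c\<bar> \<le> K * \<bar>v s - ?c\<bar>"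
          using K(2) \<open>v s \<in> {0..R}\<close> c by blast
        moreover have "\<bar>v s - ?c\<bar> \<le> \<bar>v (g i) - v s\<bar> + \<bar>v (g i) - ?c\<bar>" by linarith
        ultimately have "\<bar>f (v s) - f ?c\<bar> \<le> K * (\<bar>v (g i) - v s\<bar> + e i)"
          using K(1) by (meson add_left_mono mult_left_mono order_trans)
        then show "\<bar>f (v s) - f ?c\<bar> \<le> K * \<bar>v (g i) - v s\<bar> + K * e i" by (simp add: algebra_simps)
      qed
      also have "\<dots> = d i + \<delta> * (K * e i)"
        using le(5) \<delta>(3)[of i] unfolding d_def
        by (subst set_integral_add(2)[OF set_integrable_mult_right[OF int[OF i]] const]) (simp add: set_lebesgue_integral_def)
      finally show ?thesis by (simp add: algebra_simps)
    qed
    have "e (Suc k) \<le> (1 + K * \<delta>) ^ Suc k * (\<Sum>i<Suc k. d i)"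
    proof (rule discrete_gronwall[where n = "Suc k"])
      show "e 0 = 0" by (simp add: e_def E_def g_def)
      show "0 \<le> d i" for i
        unfolding d_def set_lebesgue_integral_def using K(1) by (intro mult_nonneg_nonneg integral_nonneg) auto
    qed (use step K(1) \<delta>(1) in auto)
    also have "(\<Sum>i<Suc k. d i) = K * J k"
    proof -
      \<comment> \<open>Without their left ends the cells are disjoint, so the sum of integrals
        becomes a single integral.\<close>
      have half_open: "set_integrable lborel {g i<..g (Suc i)} (\<lambda>s. \<bar>v (g i) - v s\<bar>)" if "i < Suc k" for i
        by (rule set_integrable_subset[OF int[OF that]]) auto
      have "(\<Sum>i<Suc k. LINT s:{g i..g (Suc i)}|lborel. \<bar>v (g i) - v s\<bar>)
          = (\<Sum>i<Suc k. LINT s:{g i<..g (Suc i)}|lborel. \<bar>v (g i) - v s\<bar>)"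
      proof (rule sum.cong[OF refl])
        fix i assume "i \<in> {..<Suc k}"
        then have i: "i < Suc k" by simp
        have "AE s in lborel. s \<noteq> g i" by (rule AE_lborel_singleton)
        then have "AE s in lborel. indicator {g i..g (Suc i)} s *\<^sub>R \<bar>v (g i) - v s\<bar>
            = indicator {g i<..g (Suc i)} s *\<^sub>R \<bar>v (g i) - v s\<bar>"
          by eventually_elim (auto simp: indicator_def)
        then show "(LINT s:{g i..g (Suc i)}|lborel. \<bar>v (g i) - v s\<bar>) = (LINT s:{g i<..g (Suc i)}|lborel. \<bar>v (g i) - v s\<bar>)"
          using int[OF i] half_open[OF i] unfolding set_lebesgue_integral_def set_integrable_def
          by (intro integral_cong_AE borel_measurable_integrable)
      qed
      also have "\<dots> = (LINT s|lborel. (\<Sum>i<Suc k. indicator {g i<..g (Suc i)} s *\<^sub>R \<bar>v (g i) - v s\<bar>))"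
        using half_open unfolding set_lebesgue_integral_def set_integrable_def
        by (intro Bochner_Integration.integral_sum[symmetric]) auto
      also have "\<dots> = (LINT s|lborel. indicator {0<..h} s * \<bar>step g (Suc k) (\<lambda>i. v (g i)) s - v s\<bar>)"
      proof (rule Bochner_Integration.integral_cong[OF refl])
        fix s
        have "(\<Sum>i<Suc k. indicator {g i<..g (Suc i)} s *\<^sub>R \<bar>v (g i) - v s\<bar>) = step g (Suc k) (\<lambda>i. \<bar>v (g i) - v s\<bar>) s"
          by (simp add: step_def mult.commute del: sum.lessThan_Suc)
        also have "\<dots> = indicator {0<..h} s * \<bar>step g (Suc k) (\<lambda>i. v (g i)) s - v s\<bar>"
        proof (cases "s \<in> {0<..h}")
          case True
          then obtain i where "i < Suc k" "g i < s" "s \<le> g (Suc i)"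
            using ex_grid_cell[of g s "Suc k"] by (auto simp: g_def)
          then show ?thesis using True g_mono by (simp add: step_eq)
        next
          case False
          have "step g (Suc k) c s = 0" for c
          proof (rule step_outside)
            fix i assume "i < Suc k"
            then show "\<not> (g i < s \<and> s \<le> g (Suc i))"
              using False g[of i] g[of "Suc i"] by auto
          qed
          then show ?thesis using False by simp
        qed
        finally show "(\<Sum>i<Suc k. indicator {g i<..g (Suc i)} s *\<^sub>R \<bar>v (g i) - v s\<bar>)
          = indicator {0<..h} s * \<bar>step g (Suc k) (\<lambda>i. v (g i)) s - v s\<bar>" .
      qed
      also have "\<dots> = J k"
      proof -
        have "AE s in lborel. s \<noteq> (0::real)" by (rule AE_lborel_singleton)
        then have ae: "AE s in lborel. indicator {0<..h} s * \<bar>step g (Suc k) (\<lambda>i. v (g i)) s - v s\<bar>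
          = indicator {0..h} s * \<bar>step g (Suc k) (\<lambda>i. v (g i)) s - v s\<bar>"
          by eventually_elim (auto simp: indicator_def)
        have [measurable]: "(\<lambda>s. indicator {0..h} s * v s) \<in> borel_measurable borel"
          using v_measurable[of 0 h] by (simp add: set_borel_measurable_def)
        have m: "(\<lambda>s. indicator A s * \<bar>step g (Suc k) (\<lambda>i. v (g i)) s - v s\<bar>) \<in> borel_measurable lborel"
          if A: "A \<subseteq> {0..h}" "A \<in> sets borel" for A
        proof -
          have [measurable]: "A \<in> sets borel" by fact
          have "(\<lambda>s. indicator A s * \<bar>step g (Suc k) (\<lambda>i. v (g i)) s - v s\<bar>)
            = (\<lambda>s. indicator A s * \<bar>step g (Suc k) (\<lambda>i. v (g i)) s - indicator {0..h} s * v s\<bar>)"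
            using A(1) by (auto simp: indicator_def fun_eq_iff)
          also have "\<dots> \<in> borel_measurable lborel" by measurable
          finally show ?thesis .
        qed
        show ?thesis
          using integral_cong_AE[OF m m ae] greaterThanAtMost_subseteq_atLeastAtMost_iff[of 0 h 0 h]
          by (simp add: J_def set_lebesgue_integral_def g_def)
      qed
      finally show ?thesis by (simp only: d_def sum_distrib_left[symmetric])
    qed
    also have "(1 + K * \<delta>) ^ Suc k * (K * J k) \<le> exp (K * h) * (K * J k)"
    proof (rule mult_right_mono)
      have "(1 + K * \<delta>) ^ Suc k \<le> exp (K * \<delta>) ^ Suc k"
        using K(1) \<delta>(1) by (intro power_mono exp_ge_add_one_self) auto
      also have "\<dots> = exp (real (Suc k) * (K * \<delta>))" by (rule exp_of_nat_mult[symmetric])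
      also have "real (Suc k) * (K * \<delta>) = K * h" unfolding \<delta>_def by (simp del: of_nat_Suc)
      finally show "(1 + K * \<delta>) ^ Suc k \<le> exp (K * h)" .
      show "0 \<le> K * J k"
        unfolding J_def set_lebesgue_integral_def using K(1) by (intro mult_nonneg_nonneg integral_nonneg) auto
    qed
    finally show ?thesis by (simp only: e_def E_def g_def \<delta>_def grid_end add_0)
  qed
  have "(\<lambda>k. exp (K * h) * (K * J k)) \<longlonglongrightarrow> exp (K * h) * (K * 0)"
    by (intro tendsto_intros J)
  then have lim: "(\<lambda>k. exp (K * h) * (K * J k)) \<longlonglongrightarrow> 0"
    by (simp only: mult_zero_right)
  have "(\<lambda>k. euler f R (h / real (Suc k)) (v 0)
      (\<lambda>i. l (grid 0 h (Suc k) (Suc i)) - l (grid 0 h (Suc k) i)) (Suc k) - v h) \<longlonglongrightarrow> 0"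
    by (rule Lim_null_comparison[OF _ lim], rule always_eventually) (simp only: real_norm_def bound simp_thms)
  then show ?thesis unfolding R_def by (rule LIM_zero_cancel)
qed

end

subsection \<open>Integrals of simple integrands\<close>

text \<open>Passes from independent algebras to variables measurable with respect to them; it serves
  both the filtration and the algebra generated by the path of \<open>B\<close>.\<close>

lemma (in prob_space) indep_var_of_indep_set:
  assumes "indep_set (sets A) (sets C)" "space A = space M" "space C = space M"
    and U: "U \<in> measurable A S" and W: "W \<in> measurable C T"
  shows "indep_var S U T W"
proof -
  have sub: "sets A \<subseteq> events" "sets C \<subseteq> events"
    using assms(1) by (auto simp: indep_set_def indep_sets_def UNIV_bool)
  have sA: "subalgebra M A" and sC: "subalgebra M C"
    using sub assms(2,3) by (auto simp: subalgebra_def)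
  have gen: "sigma_sets (space M) {U -` D \<inter> space M |D. D \<in> sets S} \<subseteq> sets A"
    "sigma_sets (space M) {W -` D \<inter> space M |D. D \<in> sets T} \<subseteq> sets C"
    using measurable_sets[OF U] measurable_sets[OF W] assms(2,3)
    by (auto intro!: sets.sigma_sets_subset[of _ A, unfolded assms(2)] sets.sigma_sets_subset[of _ C, unfolded assms(3)])
  show ?thesis
    unfolding indep_var_eq
  proof (intro conjI indep_setI indep_setD[OF assms(1)])
    show "random_variable S U" "random_variable T W"
      using measurable_from_subalg[OF sA U] measurable_from_subalg[OF sC W] by auto
  qed (use gen sub in blast)+
qed

lemma (in prob_space) integrable_square_bounded:
  fixes X :: "'a \<Rightarrow> real"
  assumes "X \<in> borel_measurable M" "\<And>\<omega>. \<omega> \<in> space M \<Longrightarrow> \<bar>X \<omega>\<bar> \<le> C"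
  shows "integrable M (\<lambda>\<omega>. (X \<omega>)\<^sup>2)"
proof (rule integrable_const_bound[of _ "C\<^sup>2"])
  have "(X \<omega>)\<^sup>2 \<le> C\<^sup>2" if "\<omega> \<in> space M" for \<omega>
    using power_mono[OF assms(2)[OF that], of 2] by simp
  then show "AE \<omega> in M. norm ((X \<omega>)\<^sup>2) \<le> C\<^sup>2" by (auto intro!: AE_I2)
qed (use assms(1) in simp)

section \<open>Discrete stochastic integrals of adapted coefficients\<close>

locale adapted_bm = prob_space M for M :: "'a measure" +
  fixes F :: "real \<Rightarrow> 'a measure" and B :: "real \<Rightarrow> 'a \<Rightarrow> real"
  assumes adapted: "adapted_brownian_motion M F B"
begin

lemma space_F: "space (F t) = space M"
  using adapted by (auto simp: adapted_brownian_motion_def filtration_def)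

lemma subalgebra_F: "subalgebra M (F t)"
  using adapted by (auto simp: adapted_brownian_motion_def subalgebra_def space_F)

lemma measurable_F: "X \<in> measurable (F t) N \<Longrightarrow> X \<in> measurable M N"
  by (rule measurable_from_subalg[OF subalgebra_F])

lemma measurable_F_mono: "X \<in> measurable (F s) N \<Longrightarrow> s \<le> t \<Longrightarrow> X \<in> measurable (F t) N"
  by (rule measurable_from_subalg[of "F t" "F s"])
    (use adapted in \<open>auto simp: adapted_brownian_motion_def subalgebra_def space_F filtration_def\<close>)

lemma B_adapted: "0 \<le> t \<Longrightarrow> B t \<in> borel_measurable (F t)"
  using adapted by (auto simp: adapted_brownian_motion_def)

lemma B_measurable: "0 \<le> t \<Longrightarrow> B t \<in> borel_measurable M"
  by (rule measurable_F[OF B_adapted])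

lemma increment_normal:
  "0 \<le> s \<Longrightarrow> s < t \<Longrightarrow> distributed M lborel (\<lambda>\<omega>. B t \<omega> - B s \<omega>) (normal_density 0 (sqrt (t - s)))"
  using adapted by (auto simp: adapted_brownian_motion_def standard_brownian_motion_def)

lemma increment_moments:
  assumes "0 \<le> s" "s < t"
  shows "integrable M (\<lambda>\<omega>. B t \<omega> - B s \<omega>)" "expectation (\<lambda>\<omega>. B t \<omega> - B s \<omega>) = 0"
    "integrable M (\<lambda>\<omega>. (B t \<omega> - B s \<omega>)\<^sup>2)" "expectation (\<lambda>\<omega>. (B t \<omega> - B s \<omega>)\<^sup>2) = t - s"
proof -
  note D = increment_normal[OF assms]
  have pos: "0 < sqrt (t - s)" using assms by simp
  show "integrable M (\<lambda>\<omega>. B t \<omega> - B s \<omega>)"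
    using integrable_normal_moment_nz_1[OF pos, of 0]
    by (subst distributed_integrable[OF D, of "\<lambda>x. x", symmetric]) auto
  show E: "expectation (\<lambda>\<omega>. B t \<omega> - B s \<omega>) = 0"
    by (rule normal_distributed_expectation[OF pos D])
  show "integrable M (\<lambda>\<omega>. (B t \<omega> - B s \<omega>)\<^sup>2)"
    using integrable_normal_moment[OF pos, of 0 2]
    by (subst distributed_integrable[OF D, of "\<lambda>x. x\<^sup>2", symmetric]) auto
  show "expectation (\<lambda>\<omega>. (B t \<omega> - B s \<omega>)\<^sup>2) = t - s"
    using normal_distributed_variance[OF pos D] assms by (simp add: E)
qed

lemma increment_indep:
  assumes "0 \<le> s" "s < t" "U \<in> borel_measurable (F s)" "g \<in> borel_measurable borel"
  shows "indep_var borel U borel (\<lambda>\<omega>. g (B t \<omega> - B s \<omega>))"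
proof (rule indep_var_of_indep_set)
  show "indep_set (sets (F s)) (sets (vimage_algebra (space M) (\<lambda>\<omega>. B t \<omega> - B s \<omega>) borel))"
    using adapted assms by (auto simp: adapted_brownian_motion_def)
  show "(\<lambda>\<omega>. g (B t \<omega> - B s \<omega>)) \<in> borel_measurable (vimage_algebra (space M) (\<lambda>\<omega>. B t \<omega> - B s \<omega>) borel)"
    by (rule measurable_compose[OF measurable_vimage_algebra1 assms(4)]) simp
qed (use assms in \<open>auto simp: space_F\<close>)

text \<open>Induction on the number of cells: the mixed term has mean zero because the new increment
  is centered and independent of everything known at its left end.\<close>

lemma transform_isometry:
  assumes "mono \<rho>" "0 \<le> \<rho> 0"
    and "\<And>i. i < n \<Longrightarrow> \<zeta> i \<in> borel_measurable (F (\<rho> i))"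
    and "\<And>i. i < n \<Longrightarrow> \<exists>C. \<forall>\<omega>\<in>space M. \<bar>\<zeta> i \<omega>\<bar> \<le> C"
  shows "(\<lambda>\<omega>. \<Sum>i<n. \<zeta> i \<omega> * (B (\<rho> (Suc i)) \<omega> - B (\<rho> i) \<omega>)) \<in> borel_measurable (F (\<rho> n))
    \<and> integrable M (\<lambda>\<omega>. (\<Sum>i<n. \<zeta> i \<omega> * (B (\<rho> (Suc i)) \<omega> - B (\<rho> i) \<omega>))\<^sup>2)
    \<and> expectation (\<lambda>\<omega>. (\<Sum>i<n. \<zeta> i \<omega> * (B (\<rho> (Suc i)) \<omega> - B (\<rho> i) \<omega>))\<^sup>2)
      = expectation (\<lambda>\<omega>. \<Sum>i<n. (\<zeta> i \<omega>)\<^sup>2 * (\<rho> (Suc i) - \<rho> i))"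
  using assms(3,4)
proof (induction n)
  case (Suc n)
  define N where "N = (\<lambda>\<omega>. \<Sum>i<n. \<zeta> i \<omega> * (B (\<rho> (Suc i)) \<omega> - B (\<rho> i) \<omega>))"
  define Q where "Q = (\<lambda>\<omega>. \<Sum>i<n. (\<zeta> i \<omega>)\<^sup>2 * (\<rho> (Suc i) - \<rho> i))"
  define D where "D = (\<lambda>\<omega>. B (\<rho> (Suc n)) \<omega> - B (\<rho> n) \<omega>)"
  define z where "z = \<zeta> n"
  have \<rho>: "0 \<le> \<rho> i" "\<rho> i \<le> \<rho> (Suc i)" for i
    using assms(1,2) by (auto simp: mono_def intro: order_trans[of _ "\<rho> 0"])
  have N: "N \<in> borel_measurable (F (\<rho> n))" "integrable M (\<lambda>\<omega>. (N \<omega>)\<^sup>2)"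
      "expectation (\<lambda>\<omega>. (N \<omega>)\<^sup>2) = expectation Q"
    using Suc unfolding N_def Q_def by auto
  have z: "z \<in> borel_measurable (F (\<rho> n))" unfolding z_def using Suc.prems by simp
  obtain C where C: "\<And>\<omega>. \<omega> \<in> space M \<Longrightarrow> \<bar>z \<omega>\<bar> \<le> C" using Suc.prems(2)[of n] unfolding z_def by auto
  have D_meas: "D \<in> borel_measurable (F (\<rho> (Suc n)))"
    unfolding D_def by (intro borel_measurable_diff B_adapted measurable_F_mono[OF B_adapted] \<rho>)
  note [measurable] = measurable_F[OF N(1)] measurable_F[OF z] measurable_F[OF D_meas]
  have meas: "(\<lambda>\<omega>. N \<omega> + z \<omega> * D \<omega>) \<in> borel_measurable (F (\<rho> (Suc n)))"
    by (intro borel_measurable_add borel_measurable_times D_meas measurable_F_mono[OF N(1)] measurable_F_mono[OF z] \<rho>)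
  have int_z2: "integrable M (\<lambda>\<omega>. (z \<omega>)\<^sup>2)"
    by (rule integrable_square_bounded[OF measurable_F[OF z] C])
  have int_z2_i: "integrable M (\<lambda>\<omega>. (\<zeta> i \<omega>)\<^sup>2)" if i: "i < Suc n" for i
  proof -
    obtain C where C: "\<And>\<omega>. \<omega> \<in> space M \<Longrightarrow> \<bar>\<zeta> i \<omega>\<bar> \<le> C" using Suc.prems(2)[OF i] by auto
    show ?thesis
      by (rule integrable_square_bounded[OF measurable_F[OF Suc.prems(1)[OF i]] C])
  qed
  have int_Q: "integrable M Q" unfolding Q_def using int_z2_i by auto
  have key: "integrable M (\<lambda>\<omega>. (N \<omega> + z \<omega> * D \<omega>)\<^sup>2) \<and>
    expectation (\<lambda>\<omega>. (N \<omega> + z \<omega> * D \<omega>)\<^sup>2) = expectation (\<lambda>\<omega>. (N \<omega>)\<^sup>2) + expectation (\<lambda>\<omega>. (z \<omega>)\<^sup>2) * (\<rho> (Suc n) - \<rho> n)"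
  \<comment> \<open>A partition may repeat a point. The increment is then 0 and has no normal
    density, so such a cell is treated apart.\<close>
  proof (cases "\<rho> n = \<rho> (Suc n)")
    case True
    then have "D = (\<lambda>_. 0)" by (simp add: D_def)
    then show ?thesis using N True by simp
  next
    case False
    then have lt: "\<rho> n < \<rho> (Suc n)" using \<rho>(2)[of n] by simp
    have mom: "integrable M (\<lambda>\<omega>. D \<omega>)" "expectation (\<lambda>\<omega>. D \<omega>) = 0" "integrable M (\<lambda>\<omega>. (D \<omega>)\<^sup>2)"
        "expectation (\<lambda>\<omega>. (D \<omega>)\<^sup>2) = \<rho> (Suc n) - \<rho> n"
      unfolding D_def by (fact increment_moments[OF \<rho>(1)[of n] lt])+
    \<comment> \<open>\<open>N\<close> need not be bounded; the product is dominated by the sum of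
      the two squares, which are integrable.\<close>
    have int_Nz: "integrable M (\<lambda>\<omega>. N \<omega> * z \<omega>)"
    proof (rule Bochner_Integration.integrable_bound)
      show "integrable M (\<lambda>\<omega>. (N \<omega>)\<^sup>2 + (z \<omega>)\<^sup>2)" by (intro Bochner_Integration.integrable_add N int_z2)
      have "\<bar>x * y\<bar> \<le> x\<^sup>2 + y\<^sup>2" for x y :: real
      proof -
        have "2 * (\<bar>x\<bar> * \<bar>y\<bar>) \<le> \<bar>x\<bar>\<^sup>2 + \<bar>y\<bar>\<^sup>2" using sum_squares_bound[of "\<bar>x\<bar>" "\<bar>y\<bar>"] by (simp add: mult.assoc)
        moreover have "0 \<le> \<bar>x\<bar> * \<bar>y\<bar>" by simp
        ultimately show ?thesis unfolding abs_mult power2_abs by linarith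
      qed
      then show "AE \<omega> in M. norm (N \<omega> * z \<omega>) \<le> norm ((N \<omega>)\<^sup>2 + (z \<omega>)\<^sup>2)" by (auto intro!: AE_I2)
    qed simp
    have i1: "indep_var borel (\<lambda>\<omega>. N \<omega> * z \<omega>) borel (\<lambda>\<omega>. D \<omega>)"
      using increment_indep[OF \<rho>(1)[of n] lt borel_measurable_times[OF N(1) z], of "\<lambda>x. x"] by (simp add: D_def)
    have i2: "indep_var borel (\<lambda>\<omega>. (z \<omega>)\<^sup>2) borel (\<lambda>\<omega>. (D \<omega>)\<^sup>2)"
      using increment_indep[OF \<rho>(1)[of n] lt borel_measurable_power[OF z], of "\<lambda>x. x\<^sup>2"] by (simp add: D_def)
    have 1: "integrable M (\<lambda>\<omega>. N \<omega> * z \<omega> * D \<omega>)" "expectation (\<lambda>\<omega>. N \<omega> * z \<omega> * D \<omega>) = 0"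
      using indep_var_integrable[OF i1 int_Nz mom(1)] indep_var_lebesgue_integral[OF i1 int_Nz mom(1)] mom(2) by auto
    have 2: "integrable M (\<lambda>\<omega>. (z \<omega>)\<^sup>2 * (D \<omega>)\<^sup>2)"
        "expectation (\<lambda>\<omega>. (z \<omega>)\<^sup>2 * (D \<omega>)\<^sup>2) = expectation (\<lambda>\<omega>. (z \<omega>)\<^sup>2) * (\<rho> (Suc n) - \<rho> n)"
      using indep_var_integrable[OF i2 int_z2 mom(3)] indep_var_lebesgue_integral[OF i2 int_z2 mom(3)] mom(4) by auto
    have "(\<lambda>\<omega>. (N \<omega> + z \<omega> * D \<omega>)\<^sup>2) = (\<lambda>\<omega>. (N \<omega>)\<^sup>2 + 2 * (N \<omega> * z \<omega> * D \<omega>) + (z \<omega>)\<^sup>2 * (D \<omega>)\<^sup>2)"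
      by (auto simp: power2_eq_square algebra_simps)
    then show ?thesis using N(2) 1 2 by simp
  qed
  have eq: "(\<Sum>i<Suc n. \<zeta> i \<omega> * (B (\<rho> (Suc i)) \<omega> - B (\<rho> i) \<omega>)) = N \<omega> + z \<omega> * D \<omega>"
    "(\<Sum>i<Suc n. (\<zeta> i \<omega>)\<^sup>2 * (\<rho> (Suc i) - \<rho> i)) = Q \<omega> + (z \<omega>)\<^sup>2 * (\<rho> (Suc n) - \<rho> n)" for \<omega>
    by (simp_all add: N_def Q_def z_def D_def)
  show ?case unfolding eq using meas key N(3) int_Q int_z2 by simp
qed simp

text \<open>
  The coefficients are cut off as soon as the running quadratic sum exceeds \<open>\<delta>\<close>; the isometry and
  Markov's inequality apply to what is left, and off an event of small probability nothing is cut.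
\<close>

lemma transform_prob_bound:
  assumes "mono \<rho>" "0 \<le> \<rho> 0"
    and meas: "\<And>i. i < n \<Longrightarrow> \<zeta> i \<in> borel_measurable (F (\<rho> i))"
    and bdd: "\<And>i. i < n \<Longrightarrow> \<exists>C. \<forall>\<omega>\<in>space M. \<bar>\<zeta> i \<omega>\<bar> \<le> C"
    and pos: "0 < \<epsilon>" "0 < \<delta>"
  shows "prob {\<omega>\<in>space M. \<bar>\<Sum>i<n. \<zeta> i \<omega> * (B (\<rho> (Suc i)) \<omega> - B (\<rho> i) \<omega>)\<bar> > \<epsilon>}
    \<le> prob {\<omega>\<in>space M. (\<Sum>i<n. (\<zeta> i \<omega>)\<^sup>2 * (\<rho> (Suc i) - \<rho> i)) > \<delta>} + \<delta> / \<epsilon>\<^sup>2"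
proof -
  define S where "S = (\<lambda>m \<omega>. \<Sum>i<m. (\<zeta> i \<omega>)\<^sup>2 * (\<rho> (Suc i) - \<rho> i))"
  \<comment> \<open>The test at cell \<open>i\<close> includes the term of that cell, so the
    retained sum never exceeds \<open>\<delta>\<close>. It is still decided at time
    \<open>\<rho> i\<close>, because the cell lengths are deterministic.\<close>
  define \<xi> where "\<xi> = (\<lambda>i \<omega>. if S (Suc i) \<omega> \<le> \<delta> then \<zeta> i \<omega> else 0)"
  define N where "N = (\<lambda>\<omega>. \<Sum>i<n. \<xi> i \<omega> * (B (\<rho> (Suc i)) \<omega> - B (\<rho> i) \<omega>))"
  have \<rho>: "\<rho> i \<le> \<rho> j" if "i \<le> j" for i j using assms(1) that by (auto simp: mono_def)
  have S_mono: "S i \<omega> \<le> S j \<omega>" if "i \<le> j" for i j \<omega>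
    unfolding S_def using that \<rho> by (intro sum_mono2) auto
  have S_meas: "S i \<in> borel_measurable (F (\<rho> j))" if "i \<le> Suc j" "j < n" for i j
    unfolding S_def
  proof (intro borel_measurable_sum borel_measurable_times borel_measurable_power borel_measurable_const)
    fix m assume "m \<in> {..<i}"
    then show "\<zeta> m \<in> borel_measurable (F (\<rho> j))"
      using that by (intro measurable_F_mono[OF meas] \<rho>) auto
  qed
  have \<xi>_meas: "\<xi> i \<in> borel_measurable (F (\<rho> i))" if "i < n" for i
  proof -
    note [measurable] = S_meas[OF order.refl that] meas[OF that]
    show ?thesis unfolding \<xi>_def by measurable
  qed
  have \<xi>_bdd: "\<exists>C. \<forall>\<omega>\<in>space M. \<bar>\<xi> i \<omega>\<bar> \<le> C" if "i < n" for i
  proof -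
    obtain C where C: "\<And>\<omega>. \<omega> \<in> space M \<Longrightarrow> \<bar>\<zeta> i \<omega>\<bar> \<le> C" using bdd[OF \<open>i < n\<close>] by auto
    then show ?thesis by (intro exI[of _ "max C 0"]) (force simp: \<xi>_def)
  qed
  have bound: "(\<Sum>i<m. (\<xi> i \<omega>)\<^sup>2 * (\<rho> (Suc i) - \<rho> i)) \<le> \<delta>" for m \<omega>
  proof (induction m)
    case (Suc m)
    show ?case
    proof (cases "S (Suc m) \<omega> \<le> \<delta>")
      case True
      have "(\<Sum>i<Suc m. (\<xi> i \<omega>)\<^sup>2 * (\<rho> (Suc i) - \<rho> i)) \<le> S (Suc m) \<omega>"
        unfolding S_def by (intro sum_mono mult_right_mono) (auto simp: \<xi>_def \<rho>)
      then show ?thesis using True by simp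
    next
      case False
      then show ?thesis using Suc by (simp add: \<xi>_def)
    qed
  qed (use pos in simp)
  have iso: "N \<in> borel_measurable (F (\<rho> n))" "integrable M (\<lambda>\<omega>. (N \<omega>)\<^sup>2)"
      "expectation (\<lambda>\<omega>. (N \<omega>)\<^sup>2) = expectation (\<lambda>\<omega>. \<Sum>i<n. (\<xi> i \<omega>)\<^sup>2 * (\<rho> (Suc i) - \<rho> i))"
    using transform_isometry[of \<rho> n \<xi>, OF assms(1,2) \<xi>_meas \<xi>_bdd] unfolding N_def by auto
  have [measurable]: "N \<in> borel_measurable M" by (rule measurable_F[OF iso(1)])
  have [measurable]: "S n \<in> borel_measurable M"
    unfolding S_def using measurable_F[OF meas] by (auto intro!: borel_measurable_sum)
  have "expectation (\<lambda>\<omega>. (N \<omega>)\<^sup>2) = expectation (\<lambda>\<omega>. \<Sum>i<n. (\<xi> i \<omega>)\<^sup>2 * (\<rho> (Suc i) - \<rho> i))"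
    by (rule iso(3))
  also have "\<dots> \<le> \<delta>"
  proof (intro integral_le_const bound AE_I2)
    have [measurable]: "\<xi> i \<in> borel_measurable M" if "i < n" for i using measurable_F[OF \<xi>_meas[OF that]] .
    have "0 \<le> (\<Sum>i<n. (\<xi> i \<omega>)\<^sup>2 * (\<rho> (Suc i) - \<rho> i))" for \<omega>
      using \<rho> by (intro sum_nonneg) auto
    then show "integrable M (\<lambda>\<omega>. \<Sum>i<n. (\<xi> i \<omega>)\<^sup>2 * (\<rho> (Suc i) - \<rho> i))"
      using bound by (intro integrable_const_bound[of _ \<delta>] AE_I2) auto
  qed
  finally have E: "expectation (\<lambda>\<omega>. (N \<omega>)\<^sup>2) \<le> \<delta>" .
  have "prob {\<omega>\<in>space M. \<bar>\<Sum>i<n. \<zeta> i \<omega> * (B (\<rho> (Suc i)) \<omega> - B (\<rho> i) \<omega>)\<bar> > \<epsilon>}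
    \<le> prob ({\<omega>\<in>space M. S n \<omega> > \<delta>} \<union> {\<omega>\<in>space M. (N \<omega>)\<^sup>2 \<ge> \<epsilon>\<^sup>2})"
  proof (rule finite_measure_mono)
    show "{\<omega>\<in>space M. \<bar>\<Sum>i<n. \<zeta> i \<omega> * (B (\<rho> (Suc i)) \<omega> - B (\<rho> i) \<omega>)\<bar> > \<epsilon>}
      \<subseteq> {\<omega>\<in>space M. S n \<omega> > \<delta>} \<union> {\<omega>\<in>space M. (N \<omega>)\<^sup>2 \<ge> \<epsilon>\<^sup>2}"
    proof safe
      fix \<omega> assume \<omega>: "\<omega> \<in> space M" "\<bar>\<Sum>i<n. \<zeta> i \<omega> * (B (\<rho> (Suc i)) \<omega> - B (\<rho> i) \<omega>)\<bar> > \<epsilon>" "\<not> \<epsilon>\<^sup>2 \<le> (N \<omega>)\<^sup>2"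
      show "\<delta> < S n \<omega>"
      proof (rule ccontr)
        assume "\<not> \<delta> < S n \<omega>"
        then have "\<xi> i \<omega> = \<zeta> i \<omega>" if "i < n" for i
          using S_mono[of "Suc i" n \<omega>] that by (simp add: \<xi>_def)
        then have "N \<omega> = (\<Sum>i<n. \<zeta> i \<omega> * (B (\<rho> (Suc i)) \<omega> - B (\<rho> i) \<omega>))"
          by (simp add: N_def)
        then have "\<epsilon> < \<bar>N \<omega>\<bar>" using \<omega> by simp
        then have "\<epsilon>\<^sup>2 \<le> \<bar>N \<omega>\<bar>\<^sup>2" using pos by (intro power_mono) auto
        then show False using \<omega>(3) by simp
      qed
    qed
  qed measurable
  also have "\<dots> \<le> prob {\<omega>\<in>space M. S n \<omega> > \<delta>} + prob {\<omega>\<in>space M. (N \<omega>)\<^sup>2 \<ge> \<epsilon>\<^sup>2}"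
    by (rule measure_Un_le) measurable
  also have "prob {\<omega>\<in>space M. (N \<omega>)\<^sup>2 \<ge> \<epsilon>\<^sup>2} \<le> expectation (\<lambda>\<omega>. (N \<omega>)\<^sup>2) / \<epsilon>\<^sup>2"
    using iso pos by (intro integral_Markov_inequality_measure[where A="{}"]) auto
  also have "\<dots> \<le> \<delta> / \<epsilon>\<^sup>2"
    using E by (intro divide_right_mono) auto
  finally show ?thesis by (simp add: S_def)
qed

end

section \<open>Convergence in probability\<close>

lemma (in prob_space) tendsto_in_probability_combine:
  assumes c: "0 < c"
    and [measurable]: "\<And>k. Y k \<in> borel_measurable M" "Y\<^sub>0 \<in> borel_measurable M"
      "\<And>k. Z k \<in> borel_measurable M" "Z\<^sub>0 \<in> borel_measurable M"
    and Y: "tendsto_in_probability M Y Y\<^sub>0 G" and Z: "tendsto_in_probability M Z Z\<^sub>0 G"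
    and bound: "\<And>k. AE \<omega> in M. \<bar>W k \<omega> - W\<^sub>0 \<omega>\<bar> \<le> c * \<bar>Y k \<omega> - Y\<^sub>0 \<omega>\<bar> + c * \<bar>Z k \<omega> - Z\<^sub>0 \<omega>\<bar>"
  shows "tendsto_in_probability M W W\<^sub>0 G"
  unfolding tendsto_in_probability_def
proof (intro allI impI)
  fix \<epsilon> :: real assume \<epsilon>: "0 < \<epsilon>"
  define \<eta> where "\<eta> = \<epsilon> / (2 * c)"
  have \<eta>: "0 < \<eta>" "c * \<eta> = \<epsilon> / 2" using \<epsilon> c by (auto simp: \<eta>_def)
  have lim: "((\<lambda>k. prob {\<omega>\<in>space M. \<bar>Y k \<omega> - Y\<^sub>0 \<omega>\<bar> > \<eta>} + prob {\<omega>\<in>space M. \<bar>Z k \<omega> - Z\<^sub>0 \<omega>\<bar> > \<eta>}) \<longlongrightarrow> 0 + 0) G"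
    using Y Z \<eta>(1) unfolding tendsto_in_probability_def by (intro tendsto_add) auto
  have le: "prob {\<omega>\<in>space M. \<bar>W k \<omega> - W\<^sub>0 \<omega>\<bar> > \<epsilon>}
    \<le> prob {\<omega>\<in>space M. \<bar>Y k \<omega> - Y\<^sub>0 \<omega>\<bar> > \<eta>} + prob {\<omega>\<in>space M. \<bar>Z k \<omega> - Z\<^sub>0 \<omega>\<bar> > \<eta>}" for k
  proof -
    have "prob {\<omega>\<in>space M. \<bar>W k \<omega> - W\<^sub>0 \<omega>\<bar> > \<epsilon>}
      \<le> prob ({\<omega>\<in>space M. \<bar>Y k \<omega> - Y\<^sub>0 \<omega>\<bar> > \<eta>} \<union> {\<omega>\<in>space M. \<bar>Z k \<omega> - Z\<^sub>0 \<omega>\<bar> > \<eta>})"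
    proof (rule finite_measure_mono_AE)
      show "AE \<omega> in M. \<omega> \<in> {\<omega>\<in>space M. \<bar>W k \<omega> - W\<^sub>0 \<omega>\<bar> > \<epsilon>} \<longrightarrow>
        \<omega> \<in> {\<omega>\<in>space M. \<bar>Y k \<omega> - Y\<^sub>0 \<omega>\<bar> > \<eta>} \<union> {\<omega>\<in>space M. \<bar>Z k \<omega> - Z\<^sub>0 \<omega>\<bar> > \<eta>}"
        using bound[of k]
      proof eventually_elim
        case (elim \<omega>)
        have "\<bar>W k \<omega> - W\<^sub>0 \<omega>\<bar> \<le> \<epsilon>" if "\<bar>Y k \<omega> - Y\<^sub>0 \<omega>\<bar> \<le> \<eta>" "\<bar>Z k \<omega> - Z\<^sub>0 \<omega>\<bar> \<le> \<eta>"
          using elim mult_left_mono[OF that(1), of c] mult_left_mono[OF that(2), of c] c \<eta>(2) by simp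
        then show ?case by force
      qed
    qed measurable
    also have "\<dots> \<le> prob {\<omega>\<in>space M. \<bar>Y k \<omega> - Y\<^sub>0 \<omega>\<bar> > \<eta>} + prob {\<omega>\<in>space M. \<bar>Z k \<omega> - Z\<^sub>0 \<omega>\<bar> > \<eta>}"
      by (rule measure_Un_le) measurable
    finally show ?thesis .
  qed
  show "((\<lambda>k. prob {\<omega>\<in>space M. \<bar>W k \<omega> - W\<^sub>0 \<omega>\<bar> > \<epsilon>}) \<longlongrightarrow> 0) G"
  proof (rule tendsto_sandwich[OF _ _ tendsto_const])
    show "\<forall>\<^sub>F k in G. prob {\<omega>\<in>space M. \<bar>W k \<omega> - W\<^sub>0 \<omega>\<bar> > \<epsilon>}
      \<le> prob {\<omega>\<in>space M. \<bar>Y k \<omega> - Y\<^sub>0 \<omega>\<bar> > \<eta>} + prob {\<omega>\<in>space M. \<bar>Z k \<omega> - Z\<^sub>0 \<omega>\<bar> > \<eta>}"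
      by (rule always_eventually, rule allI, rule le)
    show "((\<lambda>k. prob {\<omega>\<in>space M. \<bar>Y k \<omega> - Y\<^sub>0 \<omega>\<bar> > \<eta>} + prob {\<omega>\<in>space M. \<bar>Z k \<omega> - Z\<^sub>0 \<omega>\<bar> > \<eta>}) \<longlongrightarrow> 0) G"
      using lim by simp
  qed simp
qed

lemma (in prob_space) tendsto_in_probability_AE:
  assumes [measurable]: "\<And>k. Y k \<in> borel_measurable M" "Z \<in> borel_measurable M"
    and "AE \<omega> in M. (\<lambda>k. Y k \<omega>) \<longlonglongrightarrow> Z \<omega>"
  shows "tendsto_in_probability M Y Z sequentially"
  unfolding tendsto_in_probability_def
proof (intro allI impI)
  fix \<epsilon> :: real assume \<epsilon>: "0 < \<epsilon>"
  have "(\<lambda>k. expectation (\<lambda>\<omega>. indicator {\<omega>\<in>space M. \<bar>Y k \<omega> - Z \<omega>\<bar> > \<epsilon>} \<omega> :: real)) \<longlonglongrightarrow> expectation (\<lambda>_. 0)"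
  proof (rule integral_dominated_convergence[where w="\<lambda>_. 1"])
    show "AE \<omega> in M. (\<lambda>k. indicator {\<omega>\<in>space M. \<bar>Y k \<omega> - Z \<omega>\<bar> > \<epsilon>} \<omega> :: real) \<longlonglongrightarrow> 0"
      using assms(3)
    proof eventually_elim
      case (elim \<omega>)
      then have "\<forall>\<^sub>F k in sequentially. dist (Y k \<omega>) (Z \<omega>) < \<epsilon>" using \<epsilon> by (rule tendstoD)
      then show ?case
        by (intro tendsto_eventually) (auto elim!: eventually_mono simp: dist_real_def indicator_def)
    qed
  qed (auto intro!: AE_I2 simp: indicator_def)
  then show "(\<lambda>k. prob {\<omega>\<in>space M. \<bar>Y k \<omega> - Z \<omega>\<bar> > \<epsilon>}) \<longlonglongrightarrow> 0" by simp
qed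

text \<open>
  Two simple integrands are compared on a common refinement of their partitions, restricted to
  \<open>[t, t + h]\<close>.
\<close>

lemma ex_partition:
  fixes t h :: real
  assumes "finite A" "A \<subseteq> {t..t+h}" "t \<in> A" "t + h \<in> A"
  obtains \<rho> :: "nat \<Rightarrow> real" and m where "mono \<rho>" "\<rho> 0 = t" "\<rho> m = t + h" "A \<subseteq> \<rho> ` {..m}"
proof
  define l where "l = sorted_list_of_set A"
  define m where "m = length l - 1"
  have l: "set l = A" "sorted l" "l \<noteq> []"
    using assms by (auto simp: l_def)
  have lt: "min j m < length l" for j
    using l(3) by (cases l) (auto simp: m_def)
  \<comment> \<open>Beyond index \<open>m\<close> the last point is repeated, which turns the finite
    list into a monotone sequence on all naturals.\<close>
  show mono: "mono (\<lambda>j. l ! min j m)"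
    using l lt by (auto simp: mono_def intro!: sorted_nth_mono)
  show A: "A \<subseteq> (\<lambda>j. l ! min j m) ` {..m}"
  proof
    fix x assume "x \<in> A"
    then obtain j where "j < length l" "l ! j = x" using l(1) by (auto simp: in_set_conv_nth)
    then show "x \<in> (\<lambda>j. l ! min j m) ` {..m}" by (intro image_eqI[of _ _ j]) (auto simp: m_def)
  qed
  have "l ! min j m \<in> A" for j
    using l(1) nth_mem[OF lt] by auto
  then have in_A: "l ! min j m \<in> {t..t+h}" for j using assms(2) by blast
  obtain j where "t = l ! min j m" "j \<in> {..m}" using A assms(3) by blast
  then show "l ! min 0 m = t" using monoD[OF mono, of 0 j] in_A[of 0] by auto
  obtain j where "t + h = l ! min j m" "j \<in> {..m}" using A assms(4) by blast
  then show "l ! min m m = t + h" using monoD[OF mono, of j m] in_A[of m] by auto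
qed

definition clip :: "real \<Rightarrow> real \<Rightarrow> real \<Rightarrow> real" where
  "clip t h x = max t (min x (t + h))"

text \<open>The cells that start before \<open>w\<close> are those to the left of
  \<open>clip t h w\<close>, up to cells of length zero, whose terms vanish; the remaining sum
  telescopes.\<close>

lemma threshold_sum:
  fixes G :: "real \<Rightarrow> real"
  assumes "mono \<rho>" "\<rho> 0 = t" "\<rho> m = t + h" "clip t h w \<in> \<rho> ` {..m}"
  shows "(\<Sum>j<m. of_bool (\<rho> j < w) * (G (\<rho> (Suc j)) - G (\<rho> j))) = G (clip t h w) - G t"
proof -
  obtain b where b: "b \<le> m" "\<rho> b = clip t h w" using assms(4) by auto
  have \<rho>: "\<rho> i \<le> \<rho> j" if "i \<le> j" for i j using assms(1) that by (auto simp: mono_def)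
  have "(\<Sum>j<m. of_bool (\<rho> j < w) * (G (\<rho> (Suc j)) - G (\<rho> j))) = (\<Sum>j<m. if j < b then G (\<rho> (Suc j)) - G (\<rho> j) else 0)"
  proof (rule sum.cong[OF refl])
    fix j assume "j \<in> {..<m}"
    then have j: "t \<le> \<rho> j" "\<rho> (Suc j) \<le> t + h" "\<rho> j \<le> \<rho> (Suc j)"
      using \<rho>[of 0 j] \<rho>[of "Suc j" m] \<rho>[of j "Suc j"] assms(2,3) by auto
    have "(j < b \<and> \<rho> (Suc j) \<le> clip t h w) \<or> (\<not> j < b \<and> clip t h w \<le> \<rho> j)"
      using \<rho>[of "Suc j" b] \<rho>[of b j] b by (cases "j < b") auto
    then have "(j < b \<longleftrightarrow> \<rho> j < w) \<or> \<rho> j = \<rho> (Suc j)"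
      using j by (auto simp: clip_def max_def min_def split: if_splits)
    then show "of_bool (\<rho> j < w) * (G (\<rho> (Suc j)) - G (\<rho> j)) = (if j < b then G (\<rho> (Suc j)) - G (\<rho> j) else 0)"
      by auto
  qed
  also have "\<dots> = (\<Sum>j<b. G (\<rho> (Suc j)) - G (\<rho> j))"
    using b(1) by (intro sum.mono_neutral_cong_right) auto
  also have "\<dots> = G (\<rho> b) - G (\<rho> 0)" by (rule sum_lessThan_telescope)
  finally show ?thesis using b assms(2) by simp
qed

text \<open>The value taken immediately to the right of \<open>r\<close>; hence the cells are closed
  on the left here, unlike in \<open>simple_value\<close>. This value is already known at time
  \<open>r\<close>.\<close>

definition simple_coeff :: "'a simple \<Rightarrow> real \<Rightarrow> 'a \<Rightarrow> real" where
  "simple_coeff = (\<lambda>(n, \<tau>, \<xi>) r \<omega>. \<Sum>i<n. \<xi> i \<omega> * of_bool (\<tau> i \<le> r \<and> r < \<tau> (Suc i)))"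

text \<open>Each indicator is a difference of two thresholds, so \<open>threshold_sum\<close>
  applies after exchanging the sums. With \<open>G\<close> a Brownian path this computes the
  integral, with \<open>G\<close> a threshold function at \<open>s\<close> the value of the
  integrand at \<open>s\<close>.\<close>

lemma simple_coeff_sum:
  fixes G :: "real \<Rightarrow> real"
  assumes "mono \<rho>" "\<rho> 0 = t" "\<rho> m = t + h" "mono \<tau>" "\<forall>i\<le>n. clip t h (\<tau> i) \<in> \<rho> ` {..m}"
  shows "(\<Sum>j<m. simple_coeff (n, \<tau>, \<xi>) (\<rho> j) \<omega> * (G (\<rho> (Suc j)) - G (\<rho> j)))
    = (\<Sum>i<n. \<xi> i \<omega> * (G (clip t h (\<tau> (Suc i))) - G (clip t h (\<tau> i))))"
proof -
  let ?d = "\<lambda>j. G (\<rho> (Suc j)) - G (\<rho> j)"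
  have "(\<Sum>j<m. simple_coeff (n, \<tau>, \<xi>) (\<rho> j) \<omega> * ?d j)
      = (\<Sum>i<n. \<Sum>j<m. \<xi> i \<omega> * (of_bool (\<tau> i \<le> \<rho> j \<and> \<rho> j < \<tau> (Suc i)) * ?d j))"
    by (subst sum.swap) (simp only: simple_coeff_def prod.case sum_distrib_right mult.assoc)
  also have "\<dots> = (\<Sum>i<n. \<xi> i \<omega> * (G (clip t h (\<tau> (Suc i))) - G (clip t h (\<tau> i))))"
  proof (rule sum.cong[OF refl])
    fix i assume "i \<in> {..<n}"
    then have i: "i \<le> n" "Suc i \<le> n" by auto
    have "\<tau> i \<le> \<tau> (Suc i)" using assms(4) by (auto simp: mono_def)
    then have "of_bool (\<tau> i \<le> \<rho> j \<and> \<rho> j < \<tau> (Suc i)) * ?d j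
        = of_bool (\<rho> j < \<tau> (Suc i)) * ?d j - of_bool (\<rho> j < \<tau> i) * ?d j" for j
      by (auto simp: of_bool_def)
    then have "(\<Sum>j<m. of_bool (\<tau> i \<le> \<rho> j \<and> \<rho> j < \<tau> (Suc i)) * ?d j) = G (clip t h (\<tau> (Suc i))) - G (clip t h (\<tau> i))"
      using threshold_sum[OF assms(1-3) assms(5)[rule_format, OF i(1)], of G] threshold_sum[OF assms(1-3) assms(5)[rule_format, OF i(2)], of G]
      by (simp add: sum_subtractf)
    then show "(\<Sum>j<m. \<xi> i \<omega> * (of_bool (\<tau> i \<le> \<rho> j \<and> \<rho> j < \<tau> (Suc i)) * ?d j))
      = \<xi> i \<omega> * (G (clip t h (\<tau> (Suc i))) - G (clip t h (\<tau> i)))"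
      by (simp add: sum_distrib_left[symmetric])
  qed
  finally show ?thesis .
qed

lemma simple_integral_increment:
  assumes "mono \<rho>" "\<rho> 0 = t" "\<rho> m = t + h" "mono \<tau>" "\<forall>i\<le>n. clip t h (\<tau> i) \<in> \<rho> ` {..m}" "0 \<le> h"
  shows "simple_integral B (n, \<tau>, \<xi>) (t + h) \<omega> - simple_integral B (n, \<tau>, \<xi>) t \<omega>
    = (\<Sum>j<m. simple_coeff (n, \<tau>, \<xi>) (\<rho> j) \<omega> * (B (\<rho> (Suc j)) \<omega> - B (\<rho> j) \<omega>))"
proof -
  have "B (min u (t + h)) \<omega> - B (min u t) \<omega> = B (clip t h u) \<omega> - B t \<omega>" for u
    using assms(6) by (auto simp: clip_def min_def max_def)
  then have split: "B (min u (t + h)) \<omega> = B (min u t) \<omega> + (B (clip t h u) \<omega> - B t \<omega>)" for u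
    by (simp add: algebra_simps)
  have "simple_integral B (n, \<tau>, \<xi>) (t + h) \<omega> - simple_integral B (n, \<tau>, \<xi>) t \<omega>
      = (\<Sum>i<n. \<xi> i \<omega> * (B (clip t h (\<tau> (Suc i))) \<omega> - B (clip t h (\<tau> i)) \<omega>))"
    unfolding simple_integral_def prod.case sum_subtractf[symmetric]
    by (intro sum.cong refl) (simp only: split, simp add: algebra_simps)
  then show ?thesis
    by (simp only: simple_coeff_sum[where G = "\<lambda>u. B u \<omega>", OF assms(1-5)])
qed

lemma simple_value_step:
  assumes "mono \<rho>" "\<rho> 0 = t" "\<rho> m = t + h" "mono \<tau>" "\<forall>i\<le>n. clip t h (\<tau> i) \<in> \<rho> ` {..m}"
    and s: "t < s" "s \<le> t + h"
  shows "simple_value (n, \<tau>, \<xi>) s \<omega> = step \<rho> m (\<lambda>j. simple_coeff (n, \<tau>, \<xi>) (\<rho> j) \<omega>) s"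
proof -
  have le: "x i \<le> x (Suc i)" if "mono x" for x :: "nat \<Rightarrow> real" and i
    using that by (auto simp: mono_def)
  have "s \<le> clip t h u \<longleftrightarrow> s \<le> u" for u
    using s by (auto simp: clip_def)
  \<comment> \<open>The indicator of a half-open cell is written as an increment of
    \<open>\<lambda>u. of_bool (s \<le> u)\<close>, so that the general summation formula applies to
    pointwise values.\<close>
  then have 1: "indicator {\<tau> i<..\<tau> (Suc i)} s = (of_bool (s \<le> clip t h (\<tau> (Suc i))) - of_bool (s \<le> clip t h (\<tau> i)) :: real)" for i
    using le[OF assms(4), of i] by (auto simp: indicator_def)
  have 2: "indicator {\<rho> j<..\<rho> (Suc j)} s = (of_bool (s \<le> \<rho> (Suc j)) - of_bool (s \<le> \<rho> j) :: real)" for j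
    using le[OF assms(1), of j] by (auto simp: indicator_def)
  show ?thesis
    unfolding simple_value_def prod.case step_def 1 2
    by (rule simple_coeff_sum[where G = "\<lambda>u. of_bool (s \<le> u)", OF assms(1-5), symmetric])
qed

lemma simple_value_measurable [measurable]: "(\<lambda>s. simple_value S s \<omega>) \<in> borel_measurable borel"
  by (cases S) (simp only: simple_value_def prod.case, measurable)

context adapted_bm
begin

lemma simple_coeff_measurable:
  assumes "simple_integrand F S"
  shows "simple_coeff S r \<in> borel_measurable (F r)"
proof -
  obtain n \<tau> \<xi> where S: "S = (n, \<tau>, \<xi>)" by (cases S)
  show ?thesis
    unfolding S simple_coeff_def prod.case
  proof (rule borel_measurable_sum)
    fix i assume i: "i \<in> {..<n}"
    show "(\<lambda>\<omega>. \<xi> i \<omega> * of_bool (\<tau> i \<le> r \<and> r < \<tau> (Suc i))) \<in> borel_measurable (F r)"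
      using assms i measurable_F_mono[of "\<xi> i" "\<tau> i" borel r]
      by (cases "\<tau> i \<le> r \<and> r < \<tau> (Suc i)") (auto simp: S simple_integrand_def)
  qed
qed

lemma simple_coeff_bounded:
  assumes "simple_integrand F S"
  shows "\<exists>C. \<forall>\<omega>\<in>space M. \<bar>simple_coeff S r \<omega>\<bar> \<le> C"
proof -
  obtain n \<tau> \<xi> where S: "S = (n, \<tau>, \<xi>)" by (cases S)
  obtain C where C: "\<And>i \<omega>. i < n \<Longrightarrow> \<omega> \<in> space M \<Longrightarrow> \<bar>\<xi> i \<omega>\<bar> \<le> C i"
    using assms unfolding S simple_integrand_def prod.case space_F by metis
  have "\<bar>simple_coeff S r \<omega>\<bar> \<le> (\<Sum>i<n. C i)" if "\<omega> \<in> space M" for \<omega>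
    unfolding S simple_coeff_def prod.case
  proof (rule order_trans[OF sum_abs sum_mono])
    fix i assume "i \<in> {..<n}"
    then have "\<bar>\<xi> i \<omega>\<bar> \<le> C i" using C that by simp
    moreover have "0 \<le> \<bar>\<xi> i \<omega>\<bar>" by simp
    ultimately show "\<bar>\<xi> i \<omega> * of_bool (\<tau> i \<le> r \<and> r < \<tau> (Suc i))\<bar> \<le> C i"
      by (auto simp: of_bool_def simp del: abs_ge_zero)
  qed
  then show ?thesis by blast
qed

text \<open>The difference of the integrals is a single transform, and the quadratic sum of its
  coefficients is exactly the squared distance of the integrands. Since \<open>\<delta>\<close> is
  free, smallness of that distance in probability is enough to conclude.\<close>

lemma simple_integral_compare:
  assumes S: "simple_integrand F S" and S': "simple_integrand F S'" and "0 \<le> t" "0 \<le> h" "0 < \<epsilon>" "0 < \<delta>"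
  shows "prob {\<omega>\<in>space M. \<bar>(simple_integral B S (t + h) \<omega> - simple_integral B S t \<omega>)
      - (simple_integral B S' (t + h) \<omega> - simple_integral B S' t \<omega>)\<bar> > \<epsilon>}
    \<le> prob {\<omega>\<in>space M. (LINT s:{t..t+h}|lborel. (simple_value S s \<omega> - simple_value S' s \<omega>)\<^sup>2) > \<delta>} + \<delta> / \<epsilon>\<^sup>2"
proof -
  obtain n \<tau> \<xi> n' \<tau>' \<xi>' where SS: "S = (n, \<tau>, \<xi>)" "S' = (n', \<tau>', \<xi>')" by (cases S, cases S') auto
  define A where "A = {t, t + h} \<union> (\<lambda>i. clip t h (\<tau> i)) ` {..n} \<union> (\<lambda>i. clip t h (\<tau>' i)) ` {..n'}"
  have "finite A" "A \<subseteq> {t..t+h}" "t \<in> A" "t + h \<in> A"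
    using assms(4) by (auto simp: A_def clip_def)
  then obtain \<rho> :: "nat \<Rightarrow> real" and m where \<rho>: "mono \<rho>" "\<rho> 0 = t" "\<rho> m = t + h" and A: "A \<subseteq> \<rho> ` {..m}"
    by (rule ex_partition)
  have \<tau>: "mono \<tau>" "mono \<tau>'" "\<forall>i\<le>n. clip t h (\<tau> i) \<in> \<rho> ` {..m}" "\<forall>i\<le>n'. clip t h (\<tau>' i) \<in> \<rho> ` {..m}"
    using S S' A by (auto simp: SS simple_integrand_def A_def)
  define \<zeta> where "\<zeta> = (\<lambda>j \<omega>. simple_coeff S (\<rho> j) \<omega> - simple_coeff S' (\<rho> j) \<omega>)"
  have I: "(simple_integral B S (t + h) \<omega> - simple_integral B S t \<omega>) - (simple_integral B S' (t + h) \<omega> - simple_integral B S' t \<omega>)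
    = (\<Sum>j<m. \<zeta> j \<omega> * (B (\<rho> (Suc j)) \<omega> - B (\<rho> j) \<omega>))" for \<omega>
    unfolding SS simple_integral_increment[where n = n, OF \<rho> \<tau>(1,3) assms(4)] simple_integral_increment[where n = n', OF \<rho> \<tau>(2,4) assms(4)]
    by (simp add: \<zeta>_def SS sum_subtractf[symmetric] left_diff_distrib)
  have L: "(LINT s:{t..t+h}|lborel. (simple_value S s \<omega> - simple_value S' s \<omega>)\<^sup>2) = (\<Sum>j<m. (\<zeta> j \<omega>)\<^sup>2 * (\<rho> (Suc j) - \<rho> j))" for \<omega>
  proof -
    have "AE s in lborel. s \<noteq> t" by (rule AE_lborel_singleton)
    then have "AE s in lborel. indicator {t..t+h} s *\<^sub>R (simple_value S s \<omega> - simple_value S' s \<omega>)\<^sup>2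
      = indicator {t..t+h} s *\<^sub>R step \<rho> m (\<lambda>j. (\<zeta> j \<omega>)\<^sup>2) s"
    proof eventually_elim
      case (elim s)
      show ?case
      proof (cases "s \<in> {t..t+h}")
        case True
        then have s: "t < s" "s \<le> t + h" using elim by auto
        have "simple_value S s \<omega> - simple_value S' s \<omega> = step \<rho> m (\<lambda>j. \<zeta> j \<omega>) s"
          unfolding SS simple_value_step[where n = n, OF \<rho> \<tau>(1,3) s] simple_value_step[where n = n', OF \<rho> \<tau>(2,4) s]
          by (simp only: step_def \<zeta>_def SS sum_subtractf[symmetric] left_diff_distrib)
        then show ?thesis using step_comp[OF \<rho>(1), of "\<lambda>x. x\<^sup>2"] by simp
      qed simp
    qed
    moreover have "(\<lambda>s. indicator {t..t+h} s *\<^sub>R (simple_value S s \<omega> - simple_value S' s \<omega>)\<^sup>2) \<in> borel_measurable lborel"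
        "(\<lambda>s. indicator {t..t+h} s *\<^sub>R step \<rho> m (\<lambda>j. (\<zeta> j \<omega>)\<^sup>2) s) \<in> borel_measurable lborel"
      by measurable
    ultimately have "(LINT s:{t..t+h}|lborel. (simple_value S s \<omega> - simple_value S' s \<omega>)\<^sup>2)
      = (LINT s:{t..t+h}|lborel. step \<rho> m (\<lambda>j. (\<zeta> j \<omega>)\<^sup>2) s)"
      unfolding set_lebesgue_integral_def
      by (intro integral_cong_AE)
    then show ?thesis using step_set_integral[OF \<rho>(1), of m] \<rho>(2,3) by simp
  qed
  have bdd: "\<exists>C. \<forall>\<omega>\<in>space M. \<bar>\<zeta> j \<omega>\<bar> \<le> C" for j
  proof -
    obtain C C' where "\<forall>\<omega>\<in>space M. \<bar>simple_coeff S (\<rho> j) \<omega>\<bar> \<le> C" "\<forall>\<omega>\<in>space M. \<bar>simple_coeff S' (\<rho> j) \<omega>\<bar> \<le> C'"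
      using simple_coeff_bounded[OF S] simple_coeff_bounded[OF S'] by metis
    then show ?thesis unfolding \<zeta>_def by (intro exI[of _ "C + C'"]) fastforce
  qed
  have meas: "\<zeta> j \<in> borel_measurable (F (\<rho> j))" for j
    unfolding \<zeta>_def using simple_coeff_measurable[OF S] simple_coeff_measurable[OF S'] by simp
  show ?thesis
    unfolding I L using \<rho>(1,2) assms(3,5,6) meas bdd by (intro transform_prob_bound) auto
qed

end

subsection \<open>Approximation of the stochastic integral by grid sums\<close>

lemma set_integrable_bounded_Icc:
  fixes x :: "real \<Rightarrow> real"
  assumes "set_borel_measurable borel {a..b} x" "\<And>s. s \<in> {a..b} \<Longrightarrow> \<bar>x s\<bar> \<le> C"
  shows "set_integrable lborel {a..b} x"
proof (rule set_integrable_bound[OF set_integrable_const_Icc[of a b C]])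
  show "set_borel_measurable lborel {a..b} x"
    using assms(1) by (simp add: set_borel_measurable_def)
  show "AE s in lborel. s \<in> {a..b} \<longrightarrow> norm (x s) \<le> norm C"
    using assms(2) by (intro AE_I2) fastforce
qed

lemma simple_value_bounded: "\<exists>C. \<forall>s. \<bar>simple_value S s \<omega>\<bar> \<le> C"
proof -
  obtain n \<tau> \<xi> where S: "S = (n, \<tau>, \<xi>)" by (cases S)
  have "\<bar>simple_value S s \<omega>\<bar> \<le> (\<Sum>i<n. \<bar>\<xi> i \<omega>\<bar>)" for s
    unfolding S simple_value_def prod.case
    by (rule order_trans[OF sum_abs sum_mono]) (auto simp: indicator_def)
  then show ?thesis by blast
qed

context adapted_bm
begin

section \<open>Measurability in time and outcome\<close>

lemma simple_integral_measurable:
  assumes "simple_integrand F S" "0 \<le> t"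
  shows "simple_integral B S t \<in> borel_measurable M"
proof -
  obtain n \<tau> \<xi> where S: "S = (n, \<tau>, \<xi>)" by (cases S)
  have "0 \<le> \<tau> i" for i
    using assms(1) by (auto simp: S simple_integrand_def mono_def intro: order_trans[of _ "\<tau> 0"])
  then have "B (min (\<tau> i) t) \<in> borel_measurable M" for i
    using assms(2) by (intro B_measurable) auto
  moreover have "\<xi> i \<in> borel_measurable M" if "i < n" for i
    using assms(1) that by (intro measurable_F[of _ "\<tau> i"]) (auto simp: S simple_integrand_def)
  ultimately show ?thesis
    unfolding S simple_integral_def prod.case
    by (intro borel_measurable_sum borel_measurable_times borel_measurable_diff) auto
qed

lemma simple_value_jointly_measurable:
  assumes "simple_integrand F S"
  shows "(\<lambda>(\<omega>, s). simple_value S s \<omega>) \<in> borel_measurable (M \<Otimes>\<^sub>M lborel)"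
proof -
  obtain n \<tau> \<xi> where S: "S = (n, \<tau>, \<xi>)" by (cases S)
  have "\<xi> i \<in> borel_measurable M" if "i \<in> {..<n}" for i
    using assms that by (intro measurable_F[of _ "\<tau> i"]) (auto simp: S simple_integrand_def)
  then show ?thesis
    unfolding S simple_value_def prod.case case_prod_beta'
    by (intro borel_measurable_sum borel_measurable_times measurable_compose[OF measurable_fst]
        measurable_compose[OF measurable_snd]) auto
qed

lemma progressive_jointly_measurable:
  assumes "progressively_measurable F H" "0 \<le> T"
  shows "(\<lambda>(\<omega>, s). indicator {0..T} s * H s \<omega>) \<in> borel_measurable (M \<Otimes>\<^sub>M lborel)"
proof -
  have id: "(\<lambda>\<omega>. \<omega>) \<in> measurable M (F T)"
  proof (rule measurableI)
    fix A assume "A \<in> sets (F T)"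
    then have "A \<in> events" using subalgebra_F[of T] by (auto simp: subalgebra_def)
    then show "(\<lambda>\<omega>. \<omega>) -` A \<inter> space M \<in> events" by simp
  qed (simp add: space_F)
  \<comment> \<open>Progressive measurability speaks of times in \<open>{0..T}\<close> only, so the
    time is clamped to that interval; the indicator later removes the times where clamping has an
    effect.\<close>
  have "(\<lambda>x. (max 0 (min (snd x) T), fst x)) \<in> measurable (M \<Otimes>\<^sub>M lborel) (restrict_space borel {0..T} \<Otimes>\<^sub>M F T)"
    using assms(2) by (intro measurable_Pair measurable_restrict_space2 measurable_compose[OF measurable_fst id]) auto
  moreover have "(\<lambda>(s, \<omega>). H s \<omega>) \<in> borel_measurable (restrict_space borel {0..T} \<Otimes>\<^sub>M F T)"
    using assms by (auto simp: progressively_measurable_def)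
  ultimately have [measurable]: "(\<lambda>x. H (max 0 (min (snd x) T)) (fst x)) \<in> borel_measurable (M \<Otimes>\<^sub>M lborel)"
    by (auto dest: measurable_compose)
  have "(\<lambda>x. indicator {0..T} (snd x) * H (max 0 (min (snd x) T)) (fst x)) \<in> borel_measurable (M \<Otimes>\<^sub>M lborel)"
    by measurable
  also have "(\<lambda>x. indicator {0..T} (snd x) * H (max 0 (min (snd x) T)) (fst x)) = (\<lambda>(\<omega>, s). indicator {0..T} s * H s \<omega>)"
    by (auto simp: indicator_def fun_eq_iff)
  finally show ?thesis .
qed

lemma progressive_adapted:
  assumes "progressively_measurable F H" "0 \<le> T"
  shows "H T \<in> borel_measurable (F T)"
proof -
  have 1: "(\<lambda>\<omega>. (T, \<omega>)) \<in> measurable (F T) (restrict_space borel {0..T} \<Otimes>\<^sub>M F T)"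
    using assms(2) by (intro measurable_Pair measurable_const measurable_ident_sets) (auto simp: space_restrict_space)
  have 2: "(\<lambda>(s, \<omega>). H s \<omega>) \<in> borel_measurable (restrict_space borel {0..T} \<Otimes>\<^sub>M F T)"
    using assms by (auto simp: progressively_measurable_def)
  show ?thesis using measurable_compose[OF 1 2] by simp
qed

lemma progressive_path_measurable:
  assumes "progressively_measurable F H" "0 \<le> a" "\<omega> \<in> space M"
  shows "set_borel_measurable borel {a..b} (\<lambda>s. H s \<omega>)"
proof (cases "0 \<le> b")
  case True
  have "(\<lambda>s. (\<lambda>(\<omega>, s). indicator {0..b} s * H s \<omega>) (\<omega>, s)) \<in> borel_measurable lborel"
    using assms(3) by (intro measurable_compose[OF _ progressive_jointly_measurable[OF assms(1) True]]) simp
  then have "set_borel_measurable borel {0..b} (\<lambda>s. H s \<omega>)" by (simp add: set_borel_measurable_def)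
  then show ?thesis by (rule set_borel_measurable_subset) (use assms(2) in auto)
next
  case False
  then show ?thesis using assms(2) by (simp add: set_borel_measurable_def)
qed

text \<open>Joint measurability and Fubini. With the empty simple integrand this gives measurability
  of the integral of \<open>H\<^sup>2\<close>, with the zero process that of
  \<open>grid_variance\<close>.\<close>

lemma quadratic_error_measurable:
  assumes "simple_integrand F S" "progressively_measurable F H" "0 \<le> a" "a \<le> b"
  shows "(\<lambda>\<omega>. LINT s:{a..b}|lborel. (simple_value S s \<omega> - H s \<omega>)\<^sup>2) \<in> borel_measurable M"
proof -
  define K where "K = (\<lambda>x. indicator {0..b} (snd x) * H (snd x) (fst x))"
  have [measurable]: "K \<in> borel_measurable (M \<Otimes>\<^sub>M lborel)"
    using progressive_jointly_measurable[OF assms(2), of b] assms(3,4) by (simp add: K_def case_prod_beta')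
  have [measurable]: "(\<lambda>x. simple_value S (snd x) (fst x)) \<in> borel_measurable (M \<Otimes>\<^sub>M lborel)"
    using simple_value_jointly_measurable[OF assms(1)] by (simp add: case_prod_beta')
  have "(\<lambda>x. indicator {a..b} (snd x) * (simple_value S (snd x) (fst x) - K x)\<^sup>2) \<in> borel_measurable (M \<Otimes>\<^sub>M lborel)"
    by measurable
  then have "(\<lambda>(\<omega>, s). indicator {a..b} s * (simple_value S s \<omega> - indicator {0..b} s * H s \<omega>)\<^sup>2) \<in> borel_measurable (M \<Otimes>\<^sub>M lborel)"
    by (simp add: K_def case_prod_beta')
  then have "(\<lambda>\<omega>. LINT s|lborel. indicator {a..b} s * (simple_value S s \<omega> - indicator {0..b} s * H s \<omega>)\<^sup>2) \<in> borel_measurable M"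
    by (rule lborel.borel_measurable_lebesgue_integral)
  also have "(\<lambda>\<omega>. LINT s|lborel. indicator {a..b} s * (simple_value S s \<omega> - indicator {0..b} s * H s \<omega>)\<^sup>2)
     = (\<lambda>\<omega>. LINT s:{a..b}|lborel. (simple_value S s \<omega> - H s \<omega>)\<^sup>2)"
    unfolding set_lebesgue_integral_def using assms(3)
    by (intro ext Bochner_Integration.integral_cong) (auto simp: indicator_def)
  finally show ?thesis .
qed

text \<open>
  The integrands witnessing \<open>ito_integral\<close> may depend on the whole filtration and need not be
  independent of \<open>B\<close>. They are replaced by these, which are functions of the integrated process alone.
\<close>

definition grid_integrand :: "real \<Rightarrow> real \<Rightarrow> (real \<Rightarrow> 'a \<Rightarrow> real) \<Rightarrow> nat \<Rightarrow> 'a simple" where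
  "grid_integrand t h H k = (Suc k, grid t h (Suc k), \<lambda>i \<omega>. min \<bar>H (grid t h (Suc k) i) \<omega>\<bar> (real k))"

definition grid_sum :: "real \<Rightarrow> real \<Rightarrow> (real \<Rightarrow> 'a \<Rightarrow> real) \<Rightarrow> nat \<Rightarrow> 'a \<Rightarrow> real" where
  "grid_sum t h H k \<omega> = (\<Sum>i<Suc k. min \<bar>H (grid t h (Suc k) i) \<omega>\<bar> (real k)
     * (B (grid t h (Suc k) (Suc i)) \<omega> - B (grid t h (Suc k) i) \<omega>))"

lemma grid_integrand_simple:
  assumes "progressively_measurable F H" "0 \<le> t" "0 \<le> h"
  shows "simple_integrand F (grid_integrand t h H k)"
  unfolding grid_integrand_def simple_integrand_def prod.case
proof (intro conjI allI impI)
  fix i assume "i < Suc k"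
  then have "0 \<le> grid t h (Suc k) i" using grid_bounds[of h i "Suc k" t] assms by auto
  then show "(\<lambda>\<omega>. min \<bar>H (grid t h (Suc k) i) \<omega>\<bar> (real k)) \<in> borel_measurable (F (grid t h (Suc k) i))"
    using progressive_adapted[OF assms(1)] by simp
  show "\<exists>C. \<forall>\<omega>\<in>space (F (grid t h (Suc k) i)). \<bar>min \<bar>H (grid t h (Suc k) i) \<omega>\<bar> (real k)\<bar> \<le> C"
    by (intro exI[of _ "real k"]) auto
qed (use assms grid_mono in auto)

lemma grid_integrand_integral:
  assumes "0 \<le> h"
  shows "simple_integral B (grid_integrand t h H k) (t + h) \<omega> - simple_integral B (grid_integrand t h H k) t \<omega>
    = grid_sum t h H k \<omega>"
proof -
  have "min (grid t h (Suc k) i) (t + h) = grid t h (Suc k) i" "min (grid t h (Suc k) i) t = t" if "i \<le> Suc k" for i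
    using grid_bounds[of h i "Suc k" t] that assms by auto
  then show ?thesis
    unfolding grid_integrand_def simple_integral_def grid_sum_def prod.case sum_subtractf[symmetric]
    by (intro sum.cong) auto
qed

lemma grid_integrand_value:
  "simple_value (grid_integrand t h H k) s \<omega> = grid_step t h k (\<lambda>s. min \<bar>H s \<omega>\<bar> (real k)) s"
  by (simp only: grid_integrand_def simple_value_def prod.case step_def)

lemma grid_integrand_error_tendsto:
  assumes "progressively_measurable F H" "0 \<le> t" "0 < h" "\<omega> \<in> space M"
    and nonneg: "\<And>s. 0 \<le> s \<Longrightarrow> 0 \<le> H s \<omega>"
    and bdd: "\<And>s. s \<in> {t..t+h} \<Longrightarrow> \<bar>H s \<omega>\<bar> \<le> C"
    and D: "countable D" "\<And>s. s \<in> {t<..<t+h} - D \<Longrightarrow> isCont (\<lambda>s. H s \<omega>) s"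
    and G: "continuous_on UNIV (\<lambda>(u, v). G u v :: real)"
  shows "(\<lambda>k. LINT s:{t..t+h}|lborel. G (simple_value (grid_integrand t h H k) s \<omega>) (H s \<omega>))
    \<longlonglongrightarrow> (LINT s:{t..t+h}|lborel. G (H s \<omega>) (H s \<omega>))"
proof -
  have "(\<lambda>k. LINT s:{t..t+h}|lborel. G (grid_step t h k (\<lambda>s. H s \<omega>) s) (H s \<omega>))
    \<longlonglongrightarrow> (LINT s:{t..t+h}|lborel. G (H s \<omega>) (H s \<omega>))"
    by (rule grid_step_integral_tendsto[OF assms(3) progressive_path_measurable[OF assms(1,2,4)] bdd D G])
  moreover have "\<forall>\<^sub>F k in sequentially. (LINT s:{t..t+h}|lborel. G (grid_step t h k (\<lambda>s. H s \<omega>) s) (H s \<omega>))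
    = (LINT s:{t..t+h}|lborel. G (simple_value (grid_integrand t h H k) s \<omega>) (H s \<omega>))"
    \<comment> \<open>From this index on, neither the truncation nor the absolute value changes the
      samples of this path.\<close>
    using eventually_ge_at_top[of "nat \<lceil>C\<rceil>"]
  proof eventually_elim
    case (elim k)
    then have "C \<le> real k" by linarith
    then have "min \<bar>H (grid t h (Suc k) i) \<omega>\<bar> (real k) = H (grid t h (Suc k) i) \<omega>" if "i < Suc k" for i
      using bdd[of "grid t h (Suc k) i"] nonneg[of "grid t h (Suc k) i"] grid_bounds[of h i "Suc k" t] that assms(2,3)
      by auto
    then have "simple_value (grid_integrand t h H k) s \<omega> = grid_step t h k (\<lambda>s. H s \<omega>) s" for s
      unfolding grid_integrand_value step_def by (intro sum.cong) auto
    then show ?case by simp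
  qed
  ultimately show ?thesis by (rule Lim_transform_eventually)
qed

end

text \<open>What grid sampling asks of a path: local boundedness and continuity off a null set for
  dominated convergence, and nonnegativity so that the absolute value in
  \<open>grid_integrand\<close> is harmless.\<close>

definition regular_path :: "(real \<Rightarrow> real) \<Rightarrow> bool" where
  "regular_path x \<longleftrightarrow> (\<forall>s\<ge>0. 0 \<le> x s) \<and> (\<forall>T. \<exists>C. \<forall>s\<in>{0..T}. x s \<le> C)
     \<and> (\<exists>D. countable D \<and> (\<forall>s\<in>{0<..} - D. isCont x s))"

lemma continuous_pair_diff_square: "continuous_on UNIV (\<lambda>(u, v :: real). (u - v)\<^sup>2)"
  by (auto simp: case_prod_beta' intro!: continuous_intros)

context adapted_bm
begin

text \<open>Both the given integrands \<open>S k\<close> and the grid integrands \<open>R k\<close>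
  approach \<open>H\<close> in quadratic distance, hence approach each other. By
  \<open>simple_integral_compare\<close> their integrals do so as well, and the grid sums inherit
  the limit.\<close>

lemma grid_sum_tendsto:
  assumes ito: "ito_integral M F B H I" and t: "0 \<le> t" "0 < h"
    and regular: "AE \<omega> in M. regular_path (\<lambda>s. H s \<omega>)"
  shows "tendsto_in_probability M (grid_sum t h H) (\<lambda>\<omega>. I (t + h) \<omega> - I t \<omega>) sequentially"
proof -
  have H: "progressively_measurable F H" using ito by (auto simp: ito_integral_def)
  have I_meas: "I s \<in> borel_measurable M" if "0 \<le> s" for s
    using ito that by (auto simp: ito_integral_def stochastic_process_def)
  obtain S where S: "\<And>k. simple_integrand F (S k)"
    and S_lim: "\<And>T. 0 \<le> T \<Longrightarrow> tendsto_in_probability M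
           (\<lambda>k \<omega>. LINT s:{0..T}|lborel. (simple_value (S k) s \<omega> - H s \<omega>)\<^sup>2) (\<lambda>_. 0) sequentially"
    and S_int: "\<And>t. 0 \<le> t \<Longrightarrow> tendsto_in_probability M (\<lambda>k. simple_integral B (S k) t) (I t) sequentially"
    using ito unfolding ito_integral_def by blast
  define R where "R = grid_integrand t h H"
  have R: "simple_integrand F (R k)" for k
    unfolding R_def using t by (intro grid_integrand_simple H) auto
  note [measurable] = quadratic_error_measurable[OF S H] quadratic_error_measurable[OF R H]
  define eS eR e where "eS = (\<lambda>k \<omega>. LINT s:{0..t+h}|lborel. (simple_value (S k) s \<omega> - H s \<omega>)\<^sup>2)"
    and "eR = (\<lambda>k \<omega>. LINT s:{t..t+h}|lborel. (simple_value (R k) s \<omega> - H s \<omega>)\<^sup>2)"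
    and "e = (\<lambda>k \<omega>. LINT s:{t..t+h}|lborel. (simple_value (S k) s \<omega> - simple_value (R k) s \<omega>)\<^sup>2)"
  have e_meas: "eS k \<in> borel_measurable M" "eR k \<in> borel_measurable M" for k
    unfolding eS_def eR_def using t by (auto intro!: quadratic_error_measurable[OF S H] quadratic_error_measurable[OF R H])
  have eR_lim: "tendsto_in_probability M eR (\<lambda>_. 0) sequentially"
  proof (rule tendsto_in_probability_AE[OF e_meas(2)])
    show "AE \<omega> in M. (\<lambda>k. eR k \<omega>) \<longlonglongrightarrow> 0"
      using regular AE_space
    proof eventually_elim
      case (elim \<omega>)
      obtain C where C: "\<forall>s\<in>{0..t+h}. H s \<omega> \<le> C" using elim unfolding regular_path_def by blast
      obtain D where D: "countable D" "\<forall>s\<in>{0<..} - D. isCont (\<lambda>s. H s \<omega>) s" using elim unfolding regular_path_def by blast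
      have nonneg: "0 \<le> H s \<omega>" if "0 \<le> s" for s using elim that unfolding regular_path_def by blast
      have "(\<lambda>k. LINT s:{t..t+h}|lborel. (simple_value (grid_integrand t h H k) s \<omega> - H s \<omega>)\<^sup>2)
        \<longlonglongrightarrow> (LINT s:{t..t+h}|lborel. (H s \<omega> - H s \<omega>)\<^sup>2)"
      proof (rule grid_integrand_error_tendsto[OF H t elim(2) nonneg _ D(1) _ continuous_pair_diff_square])
        show "\<bar>H s \<omega>\<bar> \<le> C" if "s \<in> {t..t+h}" for s using C nonneg[of s] that t by auto
        show "isCont (\<lambda>s. H s \<omega>) s" if "s \<in> {t<..<t+h} - D" for s using D(2) that t by auto
      qed
      then show ?case by (simp add: eR_def R_def)
    qed
  qed simp
  have e_lim: "tendsto_in_probability M e (\<lambda>_. 0) sequentially"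
  proof (rule tendsto_in_probability_combine[of 2 eS "\<lambda>_. 0" eR "\<lambda>_. 0"])
    show "tendsto_in_probability M eS (\<lambda>_. 0) sequentially" unfolding eS_def using t by (intro S_lim) auto
    show "AE \<omega> in M. \<bar>e k \<omega> - 0\<bar> \<le> 2 * \<bar>eS k \<omega> - 0\<bar> + 2 * \<bar>eR k \<omega> - 0\<bar>" for k
      using regular AE_space
    proof eventually_elim
      case (elim \<omega>)
      obtain C where C: "\<forall>s\<in>{0..t+h}. H s \<omega> \<le> C" using elim unfolding regular_path_def by blast
      have nonneg: "0 \<le> H s \<omega>" if "0 \<le> s" for s using elim that unfolding regular_path_def by blast
      define x where "x = (\<lambda>s. indicator {0..t+h} s * H s \<omega>)"
      have [measurable]: "x \<in> borel_measurable borel"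
        using progressive_path_measurable[OF H order.refl elim(2), of "t+h"] by (simp add: x_def set_borel_measurable_def)
      have x: "\<bar>x s\<bar> \<le> max C 0" for s
        using bspec[OF C, of s] nonneg[of s] by (auto simp: x_def indicator_def)
      \<comment> \<open>Integrability has to be secured before integrals are compared: a
        non-integrable function has integral 0 by default, and monotonicity would be lost.\<close>
      have int: "set_integrable lborel {a..b} (\<lambda>s. (simple_value Q s \<omega> - x s)\<^sup>2)" for Q a b
      proof -
        obtain K where K: "\<And>s. \<bar>simple_value Q s \<omega>\<bar> \<le> K" using simple_value_bounded[of Q \<omega>] by blast
        have "set_borel_measurable borel {a..b} (\<lambda>s. (simple_value Q s \<omega> - x s)\<^sup>2)"
          unfolding set_borel_measurable_def by measurable
        moreover have "\<bar>(simple_value Q s \<omega> - x s)\<^sup>2\<bar> \<le> (K + max C 0)\<^sup>2" for s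
        proof -
          have "\<bar>simple_value Q s \<omega> - x s\<bar> \<le> K + max C 0" using K[of s] x[of s] by linarith
          then have "\<bar>simple_value Q s \<omega> - x s\<bar>\<^sup>2 \<le> (K + max C 0)\<^sup>2" by (intro power_mono) auto
          then show ?thesis by simp
        qed
        ultimately show ?thesis by (rule set_integrable_bounded_Icc)
      qed
      have eqs: "eS k \<omega> = (LINT s:{0..t+h}|lborel. (simple_value (S k) s \<omega> - x s)\<^sup>2)"
          "eR k \<omega> = (LINT s:{t..t+h}|lborel. (simple_value (R k) s \<omega> - x s)\<^sup>2)"
        unfolding eS_def eR_def x_def set_lebesgue_integral_def using t
        by (auto intro!: Bochner_Integration.integral_cong simp: indicator_def)
      have "e k \<omega> \<le> (LINT s:{t..t+h}|lborel. 2 * (simple_value (S k) s \<omega> - x s)\<^sup>2 + 2 * (simple_value (R k) s \<omega> - x s)\<^sup>2)"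
        unfolding e_def
      proof (rule set_integral_mono)
        obtain K K' where K: "\<And>s. \<bar>simple_value (S k) s \<omega>\<bar> \<le> K" "\<And>s. \<bar>simple_value (R k) s \<omega>\<bar> \<le> K'"
          using simple_value_bounded[of "S k" \<omega>] simple_value_bounded[of "R k" \<omega>] by blast
        have "\<bar>(simple_value (S k) s \<omega> - simple_value (R k) s \<omega>)\<^sup>2\<bar> \<le> (K + K')\<^sup>2" for s
        proof -
          have "\<bar>simple_value (S k) s \<omega> - simple_value (R k) s \<omega>\<bar> \<le> K + K'" using K[of s] by linarith
          then have "\<bar>simple_value (S k) s \<omega> - simple_value (R k) s \<omega>\<bar>\<^sup>2 \<le> (K + K')\<^sup>2" by (intro power_mono) auto
          then show ?thesis by simp
        qed
        moreover have "set_borel_measurable borel {t..t+h} (\<lambda>s. (simple_value (S k) s \<omega> - simple_value (R k) s \<omega>)\<^sup>2)"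
          unfolding set_borel_measurable_def by measurable
        ultimately show "set_integrable lborel {t..t+h} (\<lambda>s. (simple_value (S k) s \<omega> - simple_value (R k) s \<omega>)\<^sup>2)"
          by (intro set_integrable_bounded_Icc)
        show "set_integrable lborel {t..t+h} (\<lambda>s. 2 * (simple_value (S k) s \<omega> - x s)\<^sup>2 + 2 * (simple_value (R k) s \<omega> - x s)\<^sup>2)"
          by (intro set_integral_add(1) set_integrable_mult_right int)
        fix s
        have "(a - b)\<^sup>2 \<le> 2 * (a - c)\<^sup>2 + 2 * (b - c)\<^sup>2" for a b c :: real
          using zero_le_power2[of "a + b - 2 * c"] by (simp add: power2_eq_square algebra_simps)
        then show "(simple_value (S k) s \<omega> - simple_value (R k) s \<omega>)\<^sup>2
          \<le> 2 * (simple_value (S k) s \<omega> - x s)\<^sup>2 + 2 * (simple_value (R k) s \<omega> - x s)\<^sup>2" .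
      qed
      also have "\<dots> = 2 * (LINT s:{t..t+h}|lborel. (simple_value (S k) s \<omega> - x s)\<^sup>2) + 2 * eR k \<omega>"
        unfolding eqs by (subst set_integral_add(2)) (auto intro!: set_integrable_mult_right int)
      \<comment> \<open>The approximation by \<open>S k\<close> is given on intervals starting at 0,
        so the domain is enlarged.\<close>
      also have "(LINT s:{t..t+h}|lborel. (simple_value (S k) s \<omega> - x s)\<^sup>2) \<le> eS k \<omega>"
        unfolding eqs using t int[of 0 "t+h" "S k"] int[of t "t+h" "S k"]
        unfolding set_lebesgue_integral_def set_integrable_def by (intro integral_mono) (auto simp: indicator_def)
      finally have "e k \<omega> \<le> 2 * eS k \<omega> + 2 * eR k \<omega>" by simp
      moreover have "0 \<le> e k \<omega>" "0 \<le> eS k \<omega>" "0 \<le> eR k \<omega>"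
        unfolding e_def eS_def eR_def set_lebesgue_integral_def by (auto intro!: integral_nonneg)
      ultimately show ?case by simp
    qed
  qed (use e_meas eR_lim in auto)
  define J where "J = (\<lambda>k \<omega>. simple_integral B (S k) (t + h) \<omega> - simple_integral B (S k) t \<omega>)"
  have J_meas: "J k \<in> borel_measurable M" for k
    unfolding J_def using simple_integral_measurable[OF S] t by auto
  have grid_sum_eq: "grid_sum t h H k \<omega> = simple_integral B (R k) (t + h) \<omega> - simple_integral B (R k) t \<omega>" for k \<omega>
    unfolding R_def using t by (intro grid_integrand_integral[symmetric]) auto
  have grid_sum_meas: "(\<lambda>\<omega>. grid_sum t h H k \<omega>) \<in> borel_measurable M" for k
    unfolding grid_sum_eq using simple_integral_measurable[OF R] t by auto
  have J_lim: "tendsto_in_probability M J (\<lambda>\<omega>. I (t + h) \<omega> - I t \<omega>) sequentially"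
    unfolding J_def
    by (rule tendsto_in_probability_combine[of 1 "\<lambda>k. simple_integral B (S k) (t + h)" "I (t + h)" "\<lambda>k. simple_integral B (S k) t" "I t"])
      (use t in \<open>auto intro!: AE_I2 S_int I_meas simple_integral_measurable[OF S]\<close>)
  have diff_lim: "tendsto_in_probability M (\<lambda>k \<omega>. J k \<omega> - grid_sum t h H k \<omega>) (\<lambda>_. 0) sequentially"
    unfolding tendsto_in_probability_def
  proof (intro allI impI LIMSEQ_I)
    fix \<epsilon> r :: real assume pos: "0 < \<epsilon>" "0 < r"
    \<comment> \<open>Half of \<open>r\<close> is left for the event that \<open>e k\<close> is
      large, the other half is the term \<open>\<delta> / \<epsilon>\<^sup>2\<close>.\<close>
    define \<delta> where "\<delta> = r / 2 * \<epsilon>\<^sup>2"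
    have \<delta>: "0 < \<delta>" "\<delta> / \<epsilon>\<^sup>2 = r / 2" using pos by (auto simp: \<delta>_def)
    have "(\<lambda>k. prob {\<omega>\<in>space M. \<bar>e k \<omega> - 0\<bar> > \<delta>}) \<longlonglongrightarrow> 0"
      using e_lim \<delta>(1) unfolding tendsto_in_probability_def by blast
    from LIMSEQ_D[OF this, of "r / 2"] pos
    obtain k0 where k0: "\<And>k. k0 \<le> k \<Longrightarrow> prob {\<omega>\<in>space M. \<bar>e k \<omega>\<bar> > \<delta>} < r / 2"
      by auto
    have "prob {\<omega>\<in>space M. \<bar>J k \<omega> - grid_sum t h H k \<omega>\<bar> > \<epsilon>} < r" if "k0 \<le> k" for k
    proof -
      have "prob {\<omega>\<in>space M. \<bar>J k \<omega> - grid_sum t h H k \<omega>\<bar> > \<epsilon>} \<le> prob {\<omega>\<in>space M. e k \<omega> > \<delta>} + r / 2"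
        using simple_integral_compare[OF S[of k] R[of k], of t h \<epsilon> \<delta>] t pos \<delta>
        by (simp add: J_def grid_sum_eq e_def)
      moreover have "\<bar>e k \<omega>\<bar> = e k \<omega>" for \<omega>
        unfolding e_def set_lebesgue_integral_def by (auto intro!: integral_nonneg)
      ultimately show ?thesis using k0[OF that] by simp
    qed
    then show "\<exists>k0. \<forall>k\<ge>k0. norm (prob {\<omega>\<in>space M. \<bar>(J k \<omega> - grid_sum t h H k \<omega>) - 0\<bar> > \<epsilon>} - 0) < r"
      by auto
  qed
  show ?thesis
    by (rule tendsto_in_probability_combine[OF _ _ _ _ _ J_lim diff_lim, of 1])
      (use J_meas grid_sum_meas I_meas t in auto)
qed

end

subsection \<open>Gaussian mixtures\<close>

abbreviation std_normal :: "real measure" where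
  "std_normal \<equiv> density lborel (\<lambda>x. ennreal (std_normal_density x))"

lemma prob_space_std_normal: "prob_space std_normal"
  by (rule prob_space_normal_density) simp

lemma (in prob_space) nn_integral_centered_normal:
  assumes "distributed M lborel Y (\<lambda>x. ennreal (normal_density 0 r x))" "0 < r" "g \<in> borel_measurable borel"
  shows "(\<integral>\<^sup>+\<omega>. g (Y \<omega>) \<partial>M) = (\<integral>\<^sup>+z. g (r * z) \<partial>std_normal)"
proof -
  interpret N: prob_space std_normal by (rule prob_space_std_normal)
  have "distributed std_normal lborel (\<lambda>z. z) std_normal_density"
    by (auto simp: distributed_def distr_id2)
  from N.normal_density_affine[OF this, of r 0] assms(2)
  have "distributed std_normal lborel (\<lambda>z. r * z) (normal_density 0 r)" by simp
  from distributed_nn_integral[OF this, of g] distributed_nn_integral[OF assms(1), of g] assms(3)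
  show ?thesis by simp
qed

text \<open>A normal law of variance 0 has no density, so terms with zero coefficient are dropped
  first. If none remains, both sides equal \<open>g 0\<close>.\<close>

lemma (in prob_space) nn_integral_normal_sum:
  fixes n :: nat
  assumes indep: "indep_vars (\<lambda>_. borel) \<Delta> {..<n}"
    and normal: "\<And>i. i < n \<Longrightarrow> distributed M lborel (\<Delta> i) (\<lambda>x. ennreal (normal_density 0 d x))"
    and "0 < d" and g: "g \<in> borel_measurable borel"
  shows "(\<integral>\<^sup>+\<omega>. g (\<Sum>i<n. c i * \<Delta> i \<omega>) \<partial>M) = (\<integral>\<^sup>+z. g (sqrt (\<Sum>i<n. (c i)\<^sup>2 * d\<^sup>2) * z) \<partial>std_normal)"
proof -
  define I where "I = {i\<in>{..<n}. c i \<noteq> 0}"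
  have I: "finite I" "I \<subseteq> {..<n}" unfolding I_def by (rule finite_subset[of _ "{..<n}"]) auto
  have sum_eq: "(\<Sum>i<n. c i * \<Delta> i \<omega>) = (\<Sum>i\<in>I. c i * \<Delta> i \<omega>)" for \<omega>
    by (intro sum.mono_neutral_right) (auto simp: I_def)
  have var_eq: "(\<Sum>i<n. (c i)\<^sup>2 * d\<^sup>2) = (\<Sum>i\<in>I. (\<bar>c i\<bar> * d)\<^sup>2)"
    by (intro sum.mono_neutral_cong_right) (auto simp: I_def power_mult_distrib)
  show ?thesis
  proof (cases "I = {}")
    case True
    interpret N: prob_space std_normal by (rule prob_space_std_normal)
    show ?thesis unfolding sum_eq var_eq by (simp add: True emeasure_space_1 N.emeasure_space_1[simplified])
  next
    case False
    have "distributed M lborel (\<lambda>\<omega>. \<Sum>i\<in>I. c i * \<Delta> i \<omega>) (normal_density (\<Sum>i\<in>I. 0) (sqrt (\<Sum>i\<in>I. (\<bar>c i\<bar> * d)\<^sup>2)))"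
    proof (rule sum_indep_normal[OF I(1) False])
      show "indep_vars (\<lambda>_. borel) (\<lambda>i \<omega>. c i * \<Delta> i \<omega>) I"
        by (rule indep_vars_compose2[OF indep_vars_subset[OF indep I(2)]]) simp
      fix i assume i: "i \<in> I"
      show "0 < \<bar>c i\<bar> * d" using i assms(3) by (simp add: I_def)
      show "distributed M lborel (\<lambda>\<omega>. c i * \<Delta> i \<omega>) (normal_density 0 (\<bar>c i\<bar> * d))"
        using normal_density_affine[OF normal, of i "c i" 0] i assms(3) by (simp add: I_def)
    qed
    moreover have "0 < (\<Sum>i\<in>I. (\<bar>c i\<bar> * d)\<^sup>2)"
      using False I(1) assms(3) by (intro sum_pos) (auto simp: I_def)
    ultimately show ?thesis
      unfolding sum_eq var_eq by (intro nn_integral_centered_normal g) auto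
  qed
qed

text \<open>Fubini takes the place of conditioning: the joint law of coefficients and increments is
  a product, and for frozen coefficients the sum is centered normal.\<close>

lemma (in prob_space) nn_integral_gaussian_mixture:
  fixes n :: nat
  assumes indep: "indep_var (PiM {..<n} (\<lambda>_. borel)) (\<lambda>\<omega>. \<lambda>i\<in>{..<n}. \<xi> i \<omega>) (PiM {..<n} (\<lambda>_. borel)) (\<lambda>\<omega>. \<lambda>i\<in>{..<n}. \<Delta> i \<omega>)"
    and \<Delta>: "indep_vars (\<lambda>_. borel) \<Delta> {..<n}"
    and normal: "\<And>i. i < n \<Longrightarrow> distributed M lborel (\<Delta> i) (\<lambda>x. ennreal (normal_density 0 d x))"
    and "0 < d" and g[measurable]: "g \<in> borel_measurable borel"
  shows "(\<integral>\<^sup>+\<omega>. g (\<Sum>i<n. \<xi> i \<omega> * \<Delta> i \<omega>) \<partial>M)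
    = (\<integral>\<^sup>+\<omega>. (\<integral>\<^sup>+z. g (sqrt (\<Sum>i<n. (\<xi> i \<omega>)\<^sup>2 * d\<^sup>2) * z) \<partial>std_normal) \<partial>M)"
proof -
  let ?P = "PiM {..<n} (\<lambda>_. borel) :: (nat \<Rightarrow> real) measure"
  let ?X = "\<lambda>\<omega>. \<lambda>i\<in>{..<n}. \<xi> i \<omega>" and ?Y = "\<lambda>\<omega>. \<lambda>i\<in>{..<n}. \<Delta> i \<omega>"
  have rv[measurable]: "?X \<in> measurable M ?P" "?Y \<in> measurable M ?P"
    and prod: "distr M ?P ?X \<Otimes>\<^sub>M distr M ?P ?Y = distr M (?P \<Otimes>\<^sub>M ?P) (\<lambda>\<omega>. (?X \<omega>, ?Y \<omega>))"
    using indep unfolding indep_var_distribution_eq by auto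
  interpret Y: prob_space "distr M ?P ?Y" by (rule prob_space_distr) simp
  let ?f = "\<lambda>(x, y). g (\<Sum>i<n. x i * y i)"
  have f[measurable]: "?f \<in> borel_measurable (?P \<Otimes>\<^sub>M ?P)"
    unfolding case_prod_beta'
    by (intro measurable_compose[OF _ g] borel_measurable_sum borel_measurable_times
        measurable_compose[OF measurable_fst] measurable_compose[OF measurable_snd] measurable_component_singleton) auto
  have "(\<integral>\<^sup>+\<omega>. g (\<Sum>i<n. \<xi> i \<omega> * \<Delta> i \<omega>) \<partial>M) = (\<integral>\<^sup>+\<omega>. ?f (?X \<omega>, ?Y \<omega>) \<partial>M)"
    by (intro nn_integral_cong) simp
  also have "\<dots> = (\<integral>\<^sup>+p. ?f p \<partial>(distr M ?P ?X \<Otimes>\<^sub>M distr M ?P ?Y))"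
    unfolding prod by (subst nn_integral_distr) auto
  also have "\<dots> = (\<integral>\<^sup>+x. \<integral>\<^sup>+y. ?f (x, y) \<partial>distr M ?P ?Y \<partial>distr M ?P ?X)"
    by (rule Y.nn_integral_fst[symmetric]) (simp add: f cong: measurable_cong_sets)
  also have "\<dots> = (\<integral>\<^sup>+\<omega>. \<integral>\<^sup>+y. ?f (?X \<omega>, y) \<partial>distr M ?P ?Y \<partial>M)"
    by (intro nn_integral_distr rv Y.borel_measurable_nn_integral) (simp add: f cong: measurable_cong_sets)
  also have "\<dots> = (\<integral>\<^sup>+\<omega>. \<integral>\<^sup>+\<omega>'. ?f (?X \<omega>, ?Y \<omega>') \<partial>M \<partial>M)"
    by (intro nn_integral_cong nn_integral_distr rv measurable_compose[OF _ f] measurable_Pair1') (auto simp: measurable_space[OF rv(1)])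
  also have "\<dots> = (\<integral>\<^sup>+\<omega>. \<integral>\<^sup>+\<omega>'. g (\<Sum>i<n. \<xi> i \<omega> * \<Delta> i \<omega>') \<partial>M \<partial>M)"
    by (intro nn_integral_cong) simp
  also have "\<dots> = (\<integral>\<^sup>+\<omega>. (\<integral>\<^sup>+z. g (sqrt (\<Sum>i<n. (\<xi> i \<omega>)\<^sup>2 * d\<^sup>2) * z) \<partial>std_normal) \<partial>M)"
    by (intro nn_integral_cong nn_integral_normal_sum \<Delta> normal assms(4) g)
  finally show ?thesis .
qed

lemma (in prob_space) tendsto_in_probability_expectation:
  fixes g :: "real \<Rightarrow> real"
  assumes [measurable]: "\<And>k. Y k \<in> borel_measurable M" "Z \<in> borel_measurable M"
    and lim: "tendsto_in_probability M Y Z sequentially"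
    and g: "uniformly_continuous_on UNIV g" "\<And>y. 0 \<le> g y" "\<And>y. g y \<le> K"
  shows "(\<lambda>k. expectation (\<lambda>\<omega>. g (Y k \<omega>))) \<longlonglongrightarrow> expectation (\<lambda>\<omega>. g (Z \<omega>))"
proof (rule LIMSEQ_I)
  fix r :: real assume r: "0 < r"
  have K: "0 \<le> K" using g(2,3)[of 0] by simp
  have [measurable]: "g \<in> borel_measurable borel"
    by (intro borel_measurable_continuous_onI uniformly_continuous_imp_continuous g)
  have int: "integrable M (\<lambda>\<omega>. g (W \<omega>))" if [measurable]: "W \<in> borel_measurable M" for W
    using g(2,3) by (intro integrable_const_bound[of _ K]) (auto intro!: AE_I2)
  obtain d where d: "0 < d" "\<And>y z. \<bar>y - z\<bar> < d \<Longrightarrow> \<bar>g y - g z\<bar> < r / 2"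
    using g(1) half_gt_zero[OF r] unfolding uniformly_continuous_on_def dist_real_def by (metis UNIV_I abs_minus_commute)
  \<comment> \<open>Off the event for the level \<open>d / 2\<close> the distance is at most
    \<open>d / 2\<close>, hence strictly below \<open>d\<close>.\<close>
  have "(\<lambda>k. prob {\<omega>\<in>space M. \<bar>Y k \<omega> - Z \<omega>\<bar> > d / 2}) \<longlonglongrightarrow> 0"
    using lim half_gt_zero[OF d(1)] unfolding tendsto_in_probability_def by blast
  \<comment> \<open>\<open>K + 1\<close> in place of \<open>K\<close> avoids a division by 0 when
    the bound is 0.\<close>
  from LIMSEQ_D[OF this, of "r / (2 * (K + 1))"] r K
  obtain k0 where k0: "\<And>k. k0 \<le> k \<Longrightarrow> prob {\<omega>\<in>space M. \<bar>Y k \<omega> - Z \<omega>\<bar> > d / 2} < r / (2 * (K + 1))"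
    by (auto simp: zero_less_mult_iff)
  have "\<bar>expectation (\<lambda>\<omega>. g (Y k \<omega>)) - expectation (\<lambda>\<omega>. g (Z \<omega>))\<bar> < r" if "k0 \<le> k" for k
  proof -
    let ?A = "{\<omega>\<in>space M. \<bar>Y k \<omega> - Z \<omega>\<bar> > d / 2}"
    have "\<bar>expectation (\<lambda>\<omega>. g (Y k \<omega>)) - expectation (\<lambda>\<omega>. g (Z \<omega>))\<bar> = \<bar>expectation (\<lambda>\<omega>. g (Y k \<omega>) - g (Z \<omega>))\<bar>"
      using int by simp
    also have "\<dots> \<le> expectation (\<lambda>\<omega>. \<bar>g (Y k \<omega>) - g (Z \<omega>)\<bar>)"
      by (rule integral_abs_bound)
    also have "\<dots> \<le> expectation (\<lambda>\<omega>. r / 2 + K * indicator ?A \<omega>)"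
    proof (rule integral_mono)
      show "integrable M (\<lambda>\<omega>. \<bar>g (Y k \<omega>) - g (Z \<omega>)\<bar>)" using int by auto
      show "integrable M (\<lambda>\<omega>. r / 2 + K * indicator ?A \<omega>)"
        by (auto intro!: integrable_mult_right integrable_real_indicator simp: less_top[symmetric])
      fix \<omega> assume \<omega>: "\<omega> \<in> space M"
      show "\<bar>g (Y k \<omega>) - g (Z \<omega>)\<bar> \<le> r / 2 + K * indicator ?A \<omega>"
      proof (cases "\<omega> \<in> ?A")
        case True
        then show ?thesis using g(2,3)[of "Y k \<omega>"] g(2,3)[of "Z \<omega>"] r by (auto simp: abs_if)
      next
        case False
        then have "\<bar>Y k \<omega> - Z \<omega>\<bar> < d" using \<omega> d(1) by auto
        then show ?thesis using d(2)[of "Y k \<omega>" "Z \<omega>"] False by auto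
      qed
    qed
    also have "\<dots> = r / 2 + K * prob ?A"
      by (subst Bochner_Integration.integral_add)
        (auto intro!: integrable_mult_right integrable_real_indicator simp: less_top[symmetric] prob_space)
    also have "\<dots> \<le> r / 2 + (K + 1) * prob ?A"
      by (intro add_left_mono mult_right_mono) auto
    also have "\<dots> < r / 2 + (K + 1) * (r / (2 * (K + 1)))"
      using k0[OF that] K by (intro add_strict_left_mono mult_strict_left_mono) auto
    also have "\<dots> = r" using K by (simp add: field_simps)
    finally show ?thesis .
  qed
  then show "\<exists>k0. \<forall>k\<ge>k0. norm (expectation (\<lambda>\<omega>. g (Y k \<omega>)) - expectation (\<lambda>\<omega>. g (Z \<omega>))) < r"
    by auto
qed

subsection \<open>Moments of the increments\<close>

lemma path_in_space: "path X \<omega> \<in> space path_space"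
  by (auto simp: path_def space_PiM)

lemma coordinate_measurable_path:
  assumes "0 \<le> s"
  shows "X s \<in> borel_measurable (vimage_algebra \<Omega> (path X) path_space)"
proof -
  have "(\<lambda>\<omega>. path X \<omega> s) \<in> borel_measurable (vimage_algebra \<Omega> (path X) path_space)"
    using assms by (intro measurable_compose[OF measurable_vimage_algebra1 measurable_component_singleton])
      (auto simp: path_in_space)
  then show ?thesis using assms by (simp add: path_def)
qed

text \<open>Convergence in probability passes to expectations of bounded uniformly continuous
  functions; the truncation provides them, and it increases to the full power.\<close>

definition truncated_power :: "nat \<Rightarrow> real \<Rightarrow> real \<Rightarrow> real" where
  "truncated_power n q y = min \<bar>y\<bar> (real n) powr q"

text \<open>Clamping does not increase distances, and the power is uniformly continuous on the
  compact interval \<open>{0..real n}\<close>.\<close>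

lemma truncated_power_uniformly_continuous:
  assumes "0 < q" shows "uniformly_continuous_on UNIV (truncated_power n q)"
proof -
  have unif: "uniformly_continuous_on {0..real n} (\<lambda>y. y powr q)"
    using assms by (intro compact_uniformly_continuous continuous_on_powr' continuous_intros) auto
  show ?thesis
    unfolding uniformly_continuous_on_def
  proof (intro allI impI)
    fix e :: real assume "0 < e"
    then obtain d where d: "0 < d"
      and close: "\<forall>y\<in>{0..real n}. \<forall>z\<in>{0..real n}. dist z y < d \<longrightarrow> dist (z powr q) (y powr q) < e"
      using unif unfolding uniformly_continuous_on_def by blast
    have "dist (truncated_power n q z) (truncated_power n q y) < e" if "dist z y < d" for z y
    proof -
      have "dist (min \<bar>z\<bar> (real n)) (min \<bar>y\<bar> (real n)) \<le> dist z y"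
        by (auto simp: dist_real_def min_def)
      with that have "dist (min \<bar>z\<bar> (real n)) (min \<bar>y\<bar> (real n)) < d" by simp
      then show ?thesis using close by (auto simp: truncated_power_def)
    qed
    then show "\<exists>d>0. \<forall>y\<in>UNIV. \<forall>z\<in>UNIV. dist z y < d \<longrightarrow> dist (truncated_power n q z) (truncated_power n q y) < e"
      using d by blast
  qed
qed

lemma truncated_power_bounds:
  assumes "0 < q" shows "0 \<le> truncated_power n q y" "truncated_power n q y \<le> real n powr q"
  using assms by (auto simp: truncated_power_def intro!: powr_mono2)

lemma truncated_power_LIMSEQ:
  assumes "0 < q"
  shows "(\<lambda>n. truncated_power n q y) \<longlonglongrightarrow> \<bar>y\<bar> powr q" "incseq (\<lambda>n. truncated_power n q y)"
proof -
  have "\<forall>\<^sub>F n in sequentially. \<bar>y\<bar> powr q = truncated_power n q y"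
    using eventually_ge_at_top[of "nat \<lceil>\<bar>y\<bar>\<rceil>"]
  proof eventually_elim
    case (elim n)
    then have "\<bar>y\<bar> \<le> real n" by linarith
    then show ?case by (simp add: truncated_power_def)
  qed
  then show "(\<lambda>n. truncated_power n q y) \<longlonglongrightarrow> \<bar>y\<bar> powr q"
    by (rule Lim_transform_eventually[OF tendsto_const])
  show "incseq (\<lambda>n. truncated_power n q y)"
    using assms by (auto simp: incseq_def truncated_power_def intro!: powr_mono2)
qed

text \<open>The algebra \<open>\<G>\<close> will be generated by the initial value and the
  subordinator. The null set in \<open>version\<close> may depend on \<open>s\<close>; this suffices
  because each grid involves countably many times.\<close>

locale conditionally_gaussian = adapted_bm M F B for M :: "'a measure" and F B +
  fixes \<G> :: "'a measure" and H :: "real \<Rightarrow> 'a \<Rightarrow> real"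
  assumes space_G: "space \<G> = space M"
    and indep_G: "indep_set (sets \<G>) (sets (vimage_algebra (space M) (path B) path_space))"
    and version: "\<And>s. 0 \<le> s \<Longrightarrow> \<exists>Y\<in>borel_measurable \<G>. AE \<omega> in M. H s \<omega> = Y \<omega>"
begin

definition grid_variance :: "real \<Rightarrow> real \<Rightarrow> nat \<Rightarrow> 'a \<Rightarrow> real" where
  "grid_variance t h k \<omega> = (LINT s:{t..t+h}|lborel. (simple_value (grid_integrand t h H k) s \<omega>)\<^sup>2)"

lemma grid_variance_eq:
  assumes "0 \<le> h"
  shows "grid_variance t h k \<omega> = (\<Sum>i<Suc k. (min \<bar>H (grid t h (Suc k) i) \<omega>\<bar> (real k))\<^sup>2 * (h / real (Suc k)))"
proof -
  have "(simple_value (grid_integrand t h H k) s \<omega>)\<^sup>2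
      = step (grid t h (Suc k)) (Suc k) (\<lambda>i. (min \<bar>H (grid t h (Suc k) i) \<omega>\<bar> (real k))\<^sup>2) s" for s
    unfolding grid_integrand_value using step_comp[OF grid_mono[OF assms], of "\<lambda>x. x\<^sup>2"] by simp
  then show ?thesis
    unfolding grid_variance_def
    using step_set_integral[OF grid_mono[OF assms], of t "Suc k" "Suc k" "\<lambda>i. (min \<bar>H (grid t h (Suc k) i) \<omega>\<bar> (real k))\<^sup>2"]
    by (simp only: grid_0 grid_end grid_Suc)
qed

lemma grid_sum_mixture:
  assumes t: "0 \<le> t" "0 < h" and g[measurable]: "g \<in> borel_measurable borel"
  shows "(\<integral>\<^sup>+\<omega>. g (grid_sum t h H k \<omega>) \<partial>M) = (\<integral>\<^sup>+\<omega>. (\<integral>\<^sup>+z. g (sqrt (grid_variance t h k \<omega>) * z) \<partial>std_normal) \<partial>M)"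
proof -
  define \<rho> where "\<rho> = grid t h (Suc k)"
  define d where "d = sqrt (h / real (Suc k))"
  have d: "0 < d" "d\<^sup>2 = h / real (Suc k)" "\<rho> (Suc i) - \<rho> i = d\<^sup>2" for i
    using t grid_Suc[of t h "Suc k" i] unfolding d_def \<rho>_def by auto
  have \<rho>: "0 \<le> \<rho> i" "\<rho> i < \<rho> (Suc i)" for i
    using t d(1) d(3)[of i] unfolding \<rho>_def by (auto simp: grid_def divide_simps)
  have \<rho>_mono: "mono \<rho>" unfolding \<rho>_def using t by (intro grid_mono) auto
  \<comment> \<open>At the grid points \<open>H\<close> is exchanged for
    \<open>\<G>\<close>-measurable versions. The increments are functions of the path of
    \<open>B\<close>, so the two vectors are independent.\<close>
  obtain Y where Y: "\<And>i. Y i \<in> borel_measurable \<G>" "\<And>i. AE \<omega> in M. H (\<rho> i) \<omega> = Y i \<omega>"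
    using version[OF \<rho>(1)] by metis
  have AE_Y: "AE \<omega> in M. \<forall>i. H (\<rho> i) \<omega> = Y i \<omega>"
    using Y(2) by (simp add: AE_all_countable)
  define \<xi> where "\<xi> = (\<lambda>i \<omega>. min \<bar>Y i \<omega>\<bar> (real k))"
  define \<Delta> where "\<Delta> = (\<lambda>i \<omega>. B (\<rho> (Suc i)) \<omega> - B (\<rho> i) \<omega>)"
  let ?P = "PiM {..<Suc k} (\<lambda>_. borel) :: (nat \<Rightarrow> real) measure"
  have indep: "indep_var ?P (\<lambda>\<omega>. \<lambda>i\<in>{..<Suc k}. \<xi> i \<omega>) ?P (\<lambda>\<omega>. \<lambda>i\<in>{..<Suc k}. \<Delta> i \<omega>)"
  proof (rule indep_var_of_indep_set[OF indep_G space_G])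
    show "(\<lambda>\<omega>. \<lambda>i\<in>{..<Suc k}. \<xi> i \<omega>) \<in> measurable \<G> ?P"
      unfolding \<xi>_def using Y(1) by (intro measurable_restrict) simp
    show "(\<lambda>\<omega>. \<lambda>i\<in>{..<Suc k}. \<Delta> i \<omega>) \<in> measurable (vimage_algebra (space M) (path B) path_space) ?P"
      unfolding \<Delta>_def by (intro measurable_restrict borel_measurable_diff coordinate_measurable_path \<rho>)
  qed simp
  have "independent_increments M B"
    using adapted by (auto simp: adapted_brownian_motion_def standard_brownian_motion_def)
  then have \<Delta>_indep: "indep_vars (\<lambda>_. borel) \<Delta> {..<Suc k}"
    unfolding independent_increments_def \<Delta>_def using \<rho>(1)[of 0] \<rho>_mono by blast
  have \<Delta>_normal: "distributed M lborel (\<Delta> i) (\<lambda>x. ennreal (normal_density 0 d x))" for i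
    using increment_normal[OF \<rho>(1)[of i] \<rho>(2)[of i]] d(1) unfolding d(3) \<Delta>_def by simp
  have "(\<integral>\<^sup>+\<omega>. g (grid_sum t h H k \<omega>) \<partial>M) = (\<integral>\<^sup>+\<omega>. g (\<Sum>i<Suc k. \<xi> i \<omega> * \<Delta> i \<omega>) \<partial>M)"
  proof (rule nn_integral_cong_AE)
    show "AE \<omega> in M. g (grid_sum t h H k \<omega>) = g (\<Sum>i<Suc k. \<xi> i \<omega> * \<Delta> i \<omega>)"
      using AE_Y by eventually_elim (simp only: grid_sum_def \<xi>_def \<Delta>_def \<rho>_def)
  qed
  also have "\<dots> = (\<integral>\<^sup>+\<omega>. (\<integral>\<^sup>+z. g (sqrt (\<Sum>i<Suc k. (\<xi> i \<omega>)\<^sup>2 * d\<^sup>2) * z) \<partial>std_normal) \<partial>M)"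
    by (rule nn_integral_gaussian_mixture[OF indep \<Delta>_indep \<Delta>_normal d(1) g])
  also have "\<dots> = (\<integral>\<^sup>+\<omega>. (\<integral>\<^sup>+z. g (sqrt (grid_variance t h k \<omega>) * z) \<partial>std_normal) \<partial>M)"
  proof (rule nn_integral_cong_AE)
    have h: "0 \<le> h" using t by simp
    show "AE \<omega> in M. (\<integral>\<^sup>+z. g (sqrt (\<Sum>i<Suc k. (\<xi> i \<omega>)\<^sup>2 * d\<^sup>2) * z) \<partial>std_normal)
      = (\<integral>\<^sup>+z. g (sqrt (grid_variance t h k \<omega>) * z) \<partial>std_normal)"
      using AE_Y by eventually_elim (simp only: grid_variance_eq[OF h] \<xi>_def d(2) \<rho>_def)
  qed
  finally show ?thesis .
qed

text \<open>The identity for grid sums is passed to the limit on both sides. The sums themselves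
  converge in probability; their variances converge almost surely, and the Gaussian average
  \<open>\<phi>\<close> is bounded and continuous.\<close>

lemma nn_integral_truncated_power_increment:
  assumes ito: "ito_integral M F B H I" and t: "0 \<le> t" "0 < h" and q: "0 < q"
    and regular: "AE \<omega> in M. regular_path (\<lambda>s. H s \<omega>)"
  shows "(\<integral>\<^sup>+\<omega>. ennreal (truncated_power n q (I (t + h) \<omega> - I t \<omega>)) \<partial>M)
    = (\<integral>\<^sup>+\<omega>. (\<integral>\<^sup>+z. ennreal (truncated_power n q (sqrt (LINT s:{t..t+h}|lborel. (H s \<omega>)\<^sup>2) * z)) \<partial>std_normal) \<partial>M)"
proof -
  define R where "R = (\<lambda>\<omega>. LINT s:{t..t+h}|lborel. (H s \<omega>)\<^sup>2)"
  define g where "g = truncated_power n q"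
  define K where "K = real n powr q"
  note g = truncated_power_bounds[OF q, of n, folded g_def K_def] truncated_power_uniformly_continuous[OF q, of n, folded g_def]
  have g_cont: "isCont g y" for y
    using uniformly_continuous_imp_continuous[OF g(3)] by (simp add: continuous_on_eq_continuous_at)
  have g_meas[measurable]: "g \<in> borel_measurable borel"
    by (intro borel_measurable_continuous_onI uniformly_continuous_imp_continuous g)
  interpret N: prob_space std_normal by (rule prob_space_std_normal)
  define \<phi> where "\<phi> = (\<lambda>v. \<integral>\<^sup>+z. ennreal (g (sqrt v * z)) \<partial>std_normal)"
  have \<phi>_le: "\<phi> v \<le> ennreal K" for v
  proof -
    have "\<phi> v \<le> (\<integral>\<^sup>+z. ennreal K \<partial>std_normal)"
      unfolding \<phi>_def using g(2) by (intro nn_integral_mono ennreal_leI)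
    then show ?thesis using N.emeasure_space_1 by simp
  qed
  have \<phi>_cont: "(\<lambda>k. \<phi> (w k)) \<longlonglongrightarrow> \<phi> v" if "w \<longlonglongrightarrow> v" for w v
    unfolding \<phi>_def
  proof (rule nn_integral_dominated_convergence[where w="\<lambda>_. ennreal K"])
    show "AE z in std_normal. (\<lambda>k. ennreal (g (sqrt (w k) * z))) \<longlonglongrightarrow> ennreal (g (sqrt v * z))"
      using that by (intro AE_I2 tendsto_ennrealI isCont_tendsto_compose[OF g_cont] tendsto_intros)
    show "(\<integral>\<^sup>+z. ennreal K \<partial>std_normal) < \<infinity>" using N.emeasure_space_1 by simp
  qed (use g in \<open>auto intro!: AE_I2 ennreal_leI\<close>)
  have \<phi>_meas[measurable]: "\<phi> \<in> borel_measurable borel"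
    unfolding \<phi>_def by (rule N.borel_measurable_nn_integral) measurable
  have H: "progressively_measurable F H" using ito by (auto simp: ito_integral_def)
  have I_meas: "I s \<in> borel_measurable M" if "0 \<le> s" for s
    using ito that by (auto simp: ito_integral_def stochastic_process_def)
  have [measurable]: "(\<lambda>\<omega>. I (t + h) \<omega> - I t \<omega>) \<in> borel_measurable M"
    using t by (intro borel_measurable_diff I_meas) auto
  have grid_simple: "simple_integrand F (grid_integrand t h H k)" for k
    using t by (intro grid_integrand_simple H) auto
  have grid_sum_meas[measurable]: "grid_sum t h H k \<in> borel_measurable M" for k
  proof -
    have "grid_sum t h H k = (\<lambda>\<omega>. simple_integral B (grid_integrand t h H k) (t + h) \<omega> - simple_integral B (grid_integrand t h H k) t \<omega>)"
      using t by (auto simp: grid_integrand_integral)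
    then show ?thesis using simple_integral_measurable[OF grid_simple] t by auto
  qed
  have zero_simple: "simple_integrand F (0, \<lambda>_. 0, \<lambda>_ _. 0)" by (simp add: simple_integrand_def mono_def)
  have R_meas[measurable]: "R \<in> borel_measurable M"
    using quadratic_error_measurable[OF zero_simple H t(1), of "t + h"] t by (simp add: simple_value_def R_def)
  have zero_prog: "progressively_measurable F (\<lambda>_ _. 0)" by (simp add: progressively_measurable_def)
  have var_meas[measurable]: "grid_variance t h k \<in> borel_measurable M" for k
    using quadratic_error_measurable[OF grid_simple zero_prog t(1), of "t + h" k] t by (simp add: grid_variance_def[abs_def])
  have var_lim: "AE \<omega> in M. (\<lambda>k. grid_variance t h k \<omega>) \<longlonglongrightarrow> R \<omega>"
    using regular AE_space
  proof eventually_elim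
    case (elim \<omega>)
    obtain C where C: "\<forall>s\<in>{0..t+h}. H s \<omega> \<le> C" using elim unfolding regular_path_def by blast
    obtain D where D: "countable D" "\<forall>s\<in>{0<..} - D. isCont (\<lambda>s. H s \<omega>) s" using elim unfolding regular_path_def by blast
    have nonneg: "0 \<le> H s \<omega>" if "0 \<le> s" for s using elim that unfolding regular_path_def by blast
    show ?case
      unfolding grid_variance_def R_def
    proof (rule grid_integrand_error_tendsto[where G = "\<lambda>u _. u\<^sup>2", OF H t elim(2) nonneg _ D(1)])
      show "\<bar>H s \<omega>\<bar> \<le> C" if "s \<in> {t..t+h}" for s using C nonneg[of s] that t by auto
      show "isCont (\<lambda>s. H s \<omega>) s" if "s \<in> {t<..<t+h} - D" for s using D(2) that t by auto
      show "continuous_on UNIV (\<lambda>(u, _ :: real). u\<^sup>2 :: real)"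
        by (auto simp: case_prod_beta' intro!: continuous_intros)
    qed
  qed
  have lim1: "(\<lambda>k. \<integral>\<^sup>+\<omega>. \<phi> (grid_variance t h k \<omega>) \<partial>M) \<longlonglongrightarrow> (\<integral>\<^sup>+\<omega>. \<phi> (R \<omega>) \<partial>M)"
  proof (rule nn_integral_dominated_convergence[where w="\<lambda>_. ennreal K"])
    show "AE \<omega> in M. (\<lambda>k. \<phi> (grid_variance t h k \<omega>)) \<longlonglongrightarrow> \<phi> (R \<omega>)"
      using var_lim by eventually_elim (rule \<phi>_cont)
    show "(\<integral>\<^sup>+\<omega>. ennreal K \<partial>M) < \<infinity>" using emeasure_space_1 by simp
  qed (use \<phi>_le in auto)
  have eq1: "(\<integral>\<^sup>+\<omega>. \<phi> (grid_variance t h k \<omega>) \<partial>M) = ennreal (expectation (\<lambda>\<omega>. g (grid_sum t h H k \<omega>)))" for k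
  proof -
    have "(\<integral>\<^sup>+\<omega>. \<phi> (grid_variance t h k \<omega>) \<partial>M) = (\<integral>\<^sup>+\<omega>. ennreal (g (grid_sum t h H k \<omega>)) \<partial>M)"
      unfolding \<phi>_def using grid_sum_mixture[OF t, of "\<lambda>y. ennreal (g y)"] by simp
    also have "\<dots> = ennreal (expectation (\<lambda>\<omega>. g (grid_sum t h H k \<omega>)))"
      using g by (intro nn_integral_eq_integral integrable_const_bound[of _ K]) auto
    finally show ?thesis .
  qed
  have lim2: "(\<lambda>k. ennreal (expectation (\<lambda>\<omega>. g (grid_sum t h H k \<omega>))))
      \<longlonglongrightarrow> ennreal (expectation (\<lambda>\<omega>. g (I (t + h) \<omega> - I t \<omega>)))"
    by (intro tendsto_ennrealI tendsto_in_probability_expectation[OF grid_sum_meas _ grid_sum_tendsto[OF ito t regular] g(3) g(1) g(2)]) measurable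
  have eq2: "ennreal (expectation (\<lambda>\<omega>. g (I (t + h) \<omega> - I t \<omega>))) = (\<integral>\<^sup>+\<omega>. ennreal (g (I (t + h) \<omega> - I t \<omega>)) \<partial>M)"
    using g by (intro nn_integral_eq_integral[symmetric] integrable_const_bound[of _ K]) auto
  show ?thesis
    using LIMSEQ_unique[OF lim2 lim1[unfolded eq1]] unfolding eq2 unfolding g_def \<phi>_def R_def .
qed

text \<open>Monotone convergence removes the truncation, so the identity also covers infinite
  moments. The Gaussian moment factors out because powers are homogeneous.\<close>

theorem abs_moment_increment:
  assumes ito: "ito_integral M F B H I" and t: "0 \<le> t" "0 < h" and q: "0 < q"
    and regular: "AE \<omega> in M. regular_path (\<lambda>s. H s \<omega>)"
  shows "abs_moment M q (\<lambda>\<omega>. I (t + h) \<omega> - I t \<omega>)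
    = abs_moment std_normal q (\<lambda>z. z) * (\<integral>\<^sup>+\<omega>. ennreal ((LINT s:{t..t+h}|lborel. (H s \<omega>)\<^sup>2) powr (q / 2)) \<partial>M)"
proof -
  define R where "R = (\<lambda>\<omega>. LINT s:{t..t+h}|lborel. (H s \<omega>)\<^sup>2)"
  have R_nonneg: "0 \<le> R \<omega>" for \<omega>
    unfolding R_def set_lebesgue_integral_def by (auto intro!: integral_nonneg)
  have H: "progressively_measurable F H" using ito by (auto simp: ito_integral_def)
  have I_meas: "I s \<in> borel_measurable M" if "0 \<le> s" for s
    using ito that by (auto simp: ito_integral_def stochastic_process_def)
  have [measurable]: "(\<lambda>\<omega>. I (t + h) \<omega> - I t \<omega>) \<in> borel_measurable M"
    using t by (intro borel_measurable_diff I_meas) auto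
  have zero_simple: "simple_integrand F (0, \<lambda>_. 0, \<lambda>_ _. 0)" by (simp add: simple_integrand_def mono_def)
  have R_meas[measurable]: "R \<in> borel_measurable M"
    using quadratic_error_measurable[OF zero_simple H t(1), of "t + h"] t by (simp add: simple_value_def R_def)
  interpret N: prob_space std_normal by (rule prob_space_std_normal)
  have g_meas[measurable]: "truncated_power n q \<in> borel_measurable borel" for n
    by (intro borel_measurable_continuous_onI uniformly_continuous_imp_continuous truncated_power_uniformly_continuous q)
  have incseq: "incseq (\<lambda>n. ennreal (truncated_power n q y))" for y
    using truncated_power_LIMSEQ(2)[OF q, of y] by (auto simp: incseq_def intro!: ennreal_leI)
  have lim: "(\<lambda>n. ennreal (truncated_power n q y)) \<longlonglongrightarrow> ennreal (\<bar>y\<bar> powr q)" for y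
    by (intro tendsto_ennrealI truncated_power_LIMSEQ q)
  have inner_lim: "(\<lambda>n. \<integral>\<^sup>+z. ennreal (truncated_power n q (sqrt v * z)) \<partial>std_normal)
      \<longlonglongrightarrow> (\<integral>\<^sup>+z. ennreal (\<bar>sqrt v * z\<bar> powr q) \<partial>std_normal)" for v
    using incseq lim by (intro nn_integral_LIMSEQ) (auto simp: incseq_def le_fun_def)
  have "(\<lambda>n. \<integral>\<^sup>+\<omega>. ennreal (truncated_power n q (I (t + h) \<omega> - I t \<omega>)) \<partial>M)
      \<longlonglongrightarrow> (\<integral>\<^sup>+\<omega>. ennreal (\<bar>I (t + h) \<omega> - I t \<omega>\<bar> powr q) \<partial>M)"
    using incseq lim by (intro nn_integral_LIMSEQ) (auto simp: incseq_def le_fun_def)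
  moreover have "(\<lambda>n. \<integral>\<^sup>+\<omega>. (\<integral>\<^sup>+z. ennreal (truncated_power n q (sqrt (R \<omega>) * z)) \<partial>std_normal) \<partial>M)
      \<longlonglongrightarrow> (\<integral>\<^sup>+\<omega>. (\<integral>\<^sup>+z. ennreal (\<bar>sqrt (R \<omega>) * z\<bar> powr q) \<partial>std_normal) \<partial>M)"
  proof (rule nn_integral_LIMSEQ)
    show "incseq (\<lambda>n \<omega>. \<integral>\<^sup>+z. ennreal (truncated_power n q (sqrt (R \<omega>) * z)) \<partial>std_normal)"
      using incseq by (auto simp: incseq_def le_fun_def intro!: nn_integral_mono)
    show "(\<lambda>\<omega>. \<integral>\<^sup>+z. ennreal (truncated_power n q (sqrt (R \<omega>) * z)) \<partial>std_normal) \<in> borel_measurable M" for n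
      by (rule N.borel_measurable_nn_integral) measurable
  qed (rule inner_lim)
  ultimately have "(\<integral>\<^sup>+\<omega>. ennreal (\<bar>I (t + h) \<omega> - I t \<omega>\<bar> powr q) \<partial>M)
    = (\<integral>\<^sup>+\<omega>. (\<integral>\<^sup>+z. ennreal (\<bar>sqrt (R \<omega>) * z\<bar> powr q) \<partial>std_normal) \<partial>M)"
    unfolding nn_integral_truncated_power_increment[OF ito t q regular] unfolding R_def by (rule LIMSEQ_unique)
  also have "\<dots> = (\<integral>\<^sup>+\<omega>. ennreal (R \<omega> powr (q / 2)) * (\<integral>\<^sup>+z. ennreal (\<bar>z\<bar> powr q) \<partial>std_normal) \<partial>M)"
  proof (rule nn_integral_cong)
    fix \<omega>
    have "sqrt (R \<omega>) powr q = R \<omega> powr (q / 2)"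
      using R_nonneg[of \<omega>] by (simp add: powr_half_sqrt[symmetric] powr_powr)
    then have "ennreal (\<bar>sqrt (R \<omega>) * z\<bar> powr q) = ennreal (R \<omega> powr (q / 2)) * ennreal (\<bar>z\<bar> powr q)" for z
      using R_nonneg[of \<omega>] by (simp add: abs_mult powr_mult ennreal_mult)
    then show "(\<integral>\<^sup>+z. ennreal (\<bar>sqrt (R \<omega>) * z\<bar> powr q) \<partial>std_normal)
      = ennreal (R \<omega> powr (q / 2)) * (\<integral>\<^sup>+z. ennreal (\<bar>z\<bar> powr q) \<partial>std_normal)"
      by (simp add: nn_integral_cmult)
  qed
  also have "\<dots> = (\<integral>\<^sup>+\<omega>. ennreal (R \<omega> powr (q / 2)) \<partial>M) * (\<integral>\<^sup>+z. ennreal (\<bar>z\<bar> powr q) \<partial>std_normal)"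
    by (rule nn_integral_multc) measurable
  finally show ?thesis
    by (simp add: abs_moment_def R_def mult.commute)
qed

end

subsection \<open>Independence of volatility and Brownian motion\<close>

lemma space_sigma_events: "A \<in> sets (vimage_algebra \<Omega> X N) \<Longrightarrow> A \<subseteq> \<Omega>"
  by (metis sets.sets_into_space space_vimage_algebra)

text \<open>
  The \<open>\<sigma>\<close>-algebra generated by \<open>Z\<close> and the path of \<open>L\<close>; the generator is chosen stable under
  intersections.
\<close>

definition initial_path_algebra :: "'a measure \<Rightarrow> ('a \<Rightarrow> real) \<Rightarrow> (real \<Rightarrow> 'a \<Rightarrow> real) \<Rightarrow> 'a measure" where
  "initial_path_algebra M Z L = sigma (space M)
     {A \<inter> C | A C. A \<in> sets (vimage_algebra (space M) Z borel) \<and> C \<in> sets (vimage_algebra (space M) (path L) path_space)}"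

lemma initial_path_algebra_space [simp]: "space (initial_path_algebra M Z L) = space M"
  unfolding initial_path_algebra_def by (intro space_measure_of) (auto dest: space_sigma_events)

lemma sets_initial_path_algebra:
  "sets (initial_path_algebra M Z L) = sigma_sets (space M)
     {A \<inter> C | A C. A \<in> sets (vimage_algebra (space M) Z borel) \<and> C \<in> sets (vimage_algebra (space M) (path L) path_space)}"
  unfolding initial_path_algebra_def by (intro sets_measure_of) (auto dest: space_sigma_events)

lemma initial_measurable: "Z \<in> borel_measurable (initial_path_algebra M Z L)"
proof (rule measurable_from_subalg)
  show "Z \<in> borel_measurable (vimage_algebra (space M) Z borel)"
    by (rule measurable_vimage_algebra1) simp
  have "A \<in> sets (initial_path_algebra M Z L)" if A: "A \<in> sets (vimage_algebra (space M) Z borel)" for A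
  proof -
    have "A = A \<inter> space M" using space_sigma_events[OF A] by auto
    moreover have "space M \<in> sets (vimage_algebra (space M) (path L) path_space)"
      by (metis sets.top space_vimage_algebra)
    ultimately show ?thesis unfolding sets_initial_path_algebra using A by (intro sigma_sets.Basic) blast
  qed
  then show "subalgebra (initial_path_algebra M Z L) (vimage_algebra (space M) Z borel)"
    by (auto simp: subalgebra_def)
qed

lemma path_coordinate_measurable:
  assumes "0 \<le> t" shows "L t \<in> borel_measurable (initial_path_algebra M Z L)"
proof (rule measurable_from_subalg)
  show "L t \<in> borel_measurable (vimage_algebra (space M) (path L) path_space)"
    by (rule coordinate_measurable_path[OF assms])
  have "C \<in> sets (initial_path_algebra M Z L)" if C: "C \<in> sets (vimage_algebra (space M) (path L) path_space)" for C
  proof -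
    have "C = space M \<inter> C" using space_sigma_events[OF C] by auto
    moreover have "space M \<in> sets (vimage_algebra (space M) Z borel)"
      by (metis sets.top space_vimage_algebra)
    ultimately show ?thesis unfolding sets_initial_path_algebra using C by (intro sigma_sets.Basic) blast
  qed
  then show "subalgebra (initial_path_algebra M Z L) (vimage_algebra (space M) (path L) path_space)"
    by (auto simp: subalgebra_def)
qed

text \<open>Independence of \<open>Z\<close> from the pair, together with independence of
  \<open>B\<close> and \<open>L\<close>, makes probabilities of triple intersections factorize. This
  is independence on a generator stable under intersections, which extends to the generated
  algebra.\<close>

lemma (in prob_space) initial_path_algebra_indep:
  assumes BL: "independent_processes M B L" and Z: "independent_of_pair M Z B L"
  shows "indep_set (sets (initial_path_algebra M Z L)) (sets (vimage_algebra (space M) (path B) path_space))"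
proof -
  let ?\<Z> = "sets (vimage_algebra (space M) Z borel)"
  let ?\<L> = "sets (vimage_algebra (space M) (path L) path_space)"
  let ?\<B> = "sets (vimage_algebra (space M) (path B) path_space)"
  let ?P = "sets (vimage_algebra (space M) (\<lambda>\<omega>. (path B \<omega>, path L \<omega>)) (path_space \<Otimes>\<^sub>M path_space))"
  let ?\<C> = "{A \<inter> C | A C. A \<in> ?\<Z> \<and> C \<in> ?\<L>}"
  have rv: "random_variable path_space (path B)" "random_variable path_space (path L)"
    and BL': "indep_set (sigma_sets (space M) {path B -` A \<inter> space M |A. A \<in> sets path_space})
      (sigma_sets (space M) {path L -` A \<inter> space M |A. A \<in> sets path_space})"
    using BL unfolding independent_processes_def indep_var_eq by auto
  have L_eq: "?\<L> = {path L -` A \<inter> space M |A. A \<in> sets path_space}"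
    and B_eq: "?\<B> = {path B -` A \<inter> space M |A. A \<in> sets path_space}"
    by (auto intro!: sets_vimage_algebra2 simp: path_in_space)
  have indep_ZP: "indep_set ?\<Z> ?P" using Z by (simp add: independent_of_pair_def)
  have ev: "?\<Z> \<subseteq> events" "?P \<subseteq> events" using indep_ZP by (auto simp: indep_set_def indep_sets_def UNIV_bool)
  have LB_ev: "?\<L> \<subseteq> events" "?\<B> \<subseteq> events"
    unfolding L_eq B_eq using measurable_sets[OF rv(1)] measurable_sets[OF rv(2)] by auto
  have P_in: "D \<inter> C \<in> ?P" if "C \<in> ?\<L>" "D \<in> ?\<B>" for C D
  proof -
    obtain C' D' where CD: "C = path L -` C' \<inter> space M" "D = path B -` D' \<inter> space M" "C' \<in> sets path_space" "D' \<in> sets path_space"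
      using \<open>C \<in> ?\<L>\<close> \<open>D \<in> ?\<B>\<close> unfolding L_eq B_eq by blast
    have "D \<inter> C = (\<lambda>\<omega>. (path B \<omega>, path L \<omega>)) -` (D' \<times> C') \<inter> space M" using CD by auto
    moreover have "D' \<times> C' \<in> sets (path_space \<Otimes>\<^sub>M path_space)" using CD by (intro pair_measureI)
    ultimately show ?thesis using in_vimage_algebra by simp
  qed
  have space_B: "space M \<in> ?\<B>" by (metis sets.top space_vimage_algebra)
  have BL_prob: "prob (D \<inter> C) = prob D * prob C" if "C \<in> ?\<L>" "D \<in> ?\<B>" for C D
    using that unfolding L_eq B_eq by (intro indep_setD[OF BL'] sigma_sets.Basic)
  have "indep_set ?\<C> ?\<B>"
  proof (rule indep_setI)
    show "?\<C> \<subseteq> events" "?\<B> \<subseteq> events" using ev LB_ev by auto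
    fix E D assume "E \<in> ?\<C>" and D: "D \<in> ?\<B>"
    then obtain A C where E: "E = A \<inter> C" "A \<in> ?\<Z>" "C \<in> ?\<L>" by blast
    \<comment> \<open>An event of \<open>L\<close> alone is an event of the pair, with the sure
      event in the place of \<open>B\<close>.\<close>
    have "C = space M \<inter> C" using space_sigma_events[OF E(3)] by auto
    then have "C \<in> ?P" using P_in[OF E(3) space_B] by simp
    then have "prob E = prob A * prob C" unfolding E(1) by (rule indep_setD[OF indep_ZP E(2)])
    moreover have "prob (E \<inter> D) = prob A * prob (D \<inter> C)"
      using indep_setD[OF indep_ZP E(2) P_in[OF E(3) D]] unfolding E(1) by (simp add: ac_simps)
    ultimately show "prob (E \<inter> D) = prob E * prob D" using BL_prob[OF E(3) D] by simp
  qed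
  moreover have "Int_stable ?\<C>"
  proof (rule Int_stableI)
    fix E E' assume "E \<in> ?\<C>" "E' \<in> ?\<C>"
    then obtain A C A' C' where "E = A \<inter> C" "E' = A' \<inter> C'" "A \<in> ?\<Z>" "C \<in> ?\<L>" "A' \<in> ?\<Z>" "C' \<in> ?\<L>" by blast
    then show "E \<inter> E' \<in> ?\<C>"
      by (intro CollectI exI[of _ "A \<inter> A'"] exI[of _ "C \<inter> C'"]) auto
  qed
  ultimately have "indep_set (sigma_sets (space M) ?\<C>) (sigma_sets (space M) ?\<B>)"
    by (rule indep_set_sigma_sets) (auto intro!: Int_stableI)
  moreover have "sigma_sets (space M) ?\<B> = ?\<B>"
    using sets.sigma_sets_eq[of "vimage_algebra (space M) (path B) path_space"] by simp
  ultimately show ?thesis by (simp add: sets_initial_path_algebra)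
qed

context volatility_path
begin

lemma regular_path_sqrt:
  assumes "\<And>s. 0 \<le> s \<Longrightarrow> x s = sqrt (v s)"
  shows "regular_path x"
  unfolding regular_path_def
proof (intro conjI allI impI)
  show "0 \<le> x s" if "0 \<le> s" for s using assms[OF that] v_nonneg[OF that] by simp
  show "\<exists>C. \<forall>s\<in>{0..T}. x s \<le> C" for T
  proof (intro exI ballI)
    fix s assume s: "s \<in> {0..T}"
    then show "x s \<le> sqrt (v 0 + l T)" using assms[of s] v_bounded[of s 0 T] by auto
  qed
  obtain D where D: "countable D" "\<And>s. s \<in> {0<..} - D \<Longrightarrow> isCont v s" using v_continuous by auto
  have "isCont x s" if "s \<in> {0<..} - D" for s
  proof -
    have "isCont (\<lambda>u. sqrt (v u)) s" using D(2)[OF that] by (intro continuous_intros)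
    moreover have "\<forall>\<^sub>F u in nhds s. sqrt (v u) = x u"
      using eventually_nhds_in_open[of "{0<..}" s] that
      by (auto elim!: eventually_mono simp: assms[symmetric])
    ultimately show ?thesis using isCont_cong[of "\<lambda>u. sqrt (v u)" x s] by blast
  qed
  then show "\<exists>D. countable D \<and> (\<forall>s\<in>{0<..} - D. isCont x s)" using D(1) by blast
qed

end

lemma euler_measurable:
  fixes f :: "real \<Rightarrow> real"
  assumes f: "(\<lambda>x. f (max 0 x)) \<in> borel_measurable borel"
    and "R \<in> borel_measurable N" "x \<in> borel_measurable N" "\<And>i. (\<lambda>\<omega>. d \<omega> i) \<in> borel_measurable N"
  shows "(\<lambda>\<omega>. euler f (R \<omega>) \<delta> (x \<omega>) (d \<omega>) i) \<in> borel_measurable N"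
proof (induction i)
  case (Suc i)
  have "(\<lambda>\<omega>. f (max 0 (min (euler f (R \<omega>) \<delta> (x \<omega>) (d \<omega>) i) (R \<omega>)))) \<in> borel_measurable N"
    using Suc assms(2) by (intro measurable_compose[OF _ f]) simp
  then show ?case using Suc assms(4) by simp
qed (use assms in simp)

text \<open>Each Euler approximation is a function of \<open>V 0\<close> and finitely many values of
  \<open>L\<close>, and this property survives the limit. Time 0 is separate because the scheme
  needs an interval of positive length.\<close>

lemma volatility_version:
  fixes V L :: "real \<Rightarrow> 'a \<Rightarrow> real" and f :: "real \<Rightarrow> real"
  assumes f: "(\<lambda>x. f (max 0 x)) \<in> borel_measurable borel"
    and path: "AE \<omega> in M. volatility_path f a b (\<lambda>t. V t \<omega>) (\<lambda>t. L t \<omega>)"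
    and s: "0 \<le> s"
  shows "\<exists>Y\<in>borel_measurable (initial_path_algebra M (V 0) L). AE \<omega> in M. V s \<omega> = Y \<omega>"
proof (cases "s = 0")
  case True
  then show ?thesis using initial_measurable by blast
next
  case False
  then have s: "0 < s" using s by simp
  define E where "E = (\<lambda>k \<omega>. euler f (V 0 \<omega> + L s \<omega>) (s / real (Suc k)) (V 0 \<omega>)
      (\<lambda>i. L (grid 0 s (Suc k) (Suc i)) \<omega> - L (grid 0 s (Suc k) i) \<omega>) (Suc k))"
  have grid: "0 \<le> grid 0 s (Suc k) i" for k i
    using s by (simp add: grid_def)
  have "E k \<in> borel_measurable (initial_path_algebra M (V 0) L)" for k
    unfolding E_def using s
    by (intro euler_measurable f borel_measurable_add borel_measurable_diff initial_measurable path_coordinate_measurable grid) auto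
  \<comment> \<open>Outside the almost sure event on which the scheme converges, the value of
    \<open>lim\<close> is arbitrary and does not matter.\<close>
  then have "(\<lambda>\<omega>. lim (\<lambda>k. E k \<omega>)) \<in> borel_measurable (initial_path_algebra M (V 0) L)"
    by (rule borel_measurable_lim_metric)
  moreover have "AE \<omega> in M. V s \<omega> = lim (\<lambda>k. E k \<omega>)"
    using path
  proof eventually_elim
    case (elim \<omega>)
    then show ?case
      unfolding E_def using volatility_path.euler_tendsto[OF elim s] by (intro limI[symmetric])
  qed
  ultimately show ?thesis by (intro bexI[of _ "\<lambda>\<omega>. lim (\<lambda>k. E k \<omega>)"])
qed

subsection \<open>Scaling of the moments\<close>

lemma powr_add_le:
  fixes x y p :: real
  assumes "0 \<le> x" "0 \<le> y" "0 < p"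
  shows "(x + y) powr p \<le> 2 powr p * (x powr p + y powr p)"
proof -
  have "(x + y) powr p \<le> (2 * max x y) powr p"
    using assms by (intro powr_mono2) auto
  also have "\<dots> = 2 powr p * max x y powr p" using assms by (simp add: powr_mult)
  also have "max x y powr p \<le> x powr p + y powr p" by (auto simp: max_def)
  finally show ?thesis by simp
qed

section \<open>Absolute moments of the standard normal law\<close>

lemma std_normal_moment_pos: "0 < abs_moment std_normal q (\<lambda>z. z)"
proof (rule ccontr)
  assume "\<not> 0 < abs_moment std_normal q (\<lambda>z. z)"
  then have "(\<integral>\<^sup>+z. ennreal (\<bar>z\<bar> powr q) \<partial>std_normal) = 0" by (simp add: abs_moment_def)
  then have "AE z in std_normal. z = 0"
    by (subst (asm) nn_integral_0_iff_AE) (auto simp: powr_def)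
  moreover have "AE z in std_normal. z \<noteq> 0"
    using AE_lborel_singleton[of "0 :: real"] by (subst AE_density) auto
  ultimately have "AE z in std_normal. False" by eventually_elim simp
  then show False using prob_space.AE_const[OF prob_space_std_normal] by blast
qed

lemma std_normal_moment_finite:
  assumes "0 \<le> q" shows "abs_moment std_normal q (\<lambda>z. z) < \<infinity>"
proof -
  interpret N: prob_space std_normal by (rule prob_space_std_normal)
  define m where "m = nat \<lceil>q\<rceil>"
  have m: "q \<le> real m" unfolding m_def by linarith
  have le: "\<bar>z\<bar> powr q \<le> 1 + \<bar>z\<bar> ^ m" for z :: real
  proof (cases "\<bar>z\<bar> \<le> 1")
    case True
    then have "\<bar>z\<bar> powr q \<le> 1" using assms by (intro powr_le1) auto
    moreover have "0 \<le> \<bar>z\<bar> ^ m" by simp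
    ultimately show ?thesis by linarith
  next
    case False
    then have "\<bar>z\<bar> powr q \<le> \<bar>z\<bar> powr real m" using m by (intro powr_mono) auto
    then show ?thesis using False by (simp add: powr_realpow)
  qed
  have "integrable std_normal (\<lambda>z. 1 + \<bar>z\<bar> ^ m)"
    using integrable_std_normal_moment_abs[of m]
    by (intro Bochner_Integration.integrable_add) (auto simp: integrable_real_density)
  then have "integrable std_normal (\<lambda>z. \<bar>z\<bar> powr q)"
    by (rule Bochner_Integration.integrable_bound) (use le in \<open>auto intro!: AE_I2\<close>)
  then show ?thesis
    unfolding abs_moment_def by (subst nn_integral_eq_integral) auto
qed

text \<open>For \<open>h < 1\<close> the logarithm of \<open>h\<close> is negative, so an infinite
  moment turns the quotient into -\<infinity>.\<close>

lemma scaling_function_infinite: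
  assumes "\<forall>\<^sub>F h in at_right 0. abs_moment M q (\<lambda>\<omega>. X (t + h) \<omega> - X t \<omega>) = \<infinity>"
  shows "scaling_function M X t q = - \<infinity>"
proof -
  have "\<forall>\<^sub>F h in at_right 0. log_ennreal (abs_moment M q (\<lambda>\<omega>. X (t + h) \<omega> - X t \<omega>)) / ereal (ln h) = - \<infinity>"
    using assms eventually_at_right_real[of 0 "1::real", OF zero_less_one]
  proof eventually_elim
    case (elim h)
    then have "ln h < 0" by simp
    then show ?case using elim(1) by (simp add: log_ennreal_def divide_ereal_def)
  qed
  then have "scaling_function M X t q = Limsup (at_right (0::real)) (\<lambda>_. - \<infinity>)"
    unfolding scaling_function_def by (rule Limsup_eq)
  then show ?thesis by (simp add: Limsup_const)
qed

text \<open>Division by the negative \<open>ln h\<close> reverses inequalities, so an upper bound on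
  moments is a lower bound on the exponent. The constant contributes \<open>ln C / ln h\<close>,
  which tends to 0.\<close>

lemma scaling_function_ge:
  assumes C: "0 < C" and bound: "\<forall>\<^sub>F h in at_right 0. abs_moment M q (\<lambda>\<omega>. X (t + h) \<omega> - X t \<omega>) \<le> ennreal (C * h powr p)"
  shows "ereal p \<le> scaling_function M X t q"
proof -
  have "((\<lambda>h. inverse (ln h)) \<longlongrightarrow> 0) (at_right (0::real))"
    by (rule tendsto_inverse_0[THEN filterlim_compose, OF filterlim_mono[OF ln_at_0 at_bot_le_at_infinity order.refl]])
  then have "((\<lambda>h. ln C * inverse (ln h) + p) \<longlongrightarrow> ln C * 0 + p) (at_right (0::real))"
    by (intro tendsto_intros)
  then have "((\<lambda>h. ereal (ln C * inverse (ln h) + p)) \<longlongrightarrow> ereal p) (at_right (0::real))" by simp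
  then have "ereal p = Limsup (at_right 0) (\<lambda>h. ereal (ln C * inverse (ln h) + p))"
    by (intro lim_imp_Limsup[symmetric]) auto
  also have "\<dots> \<le> scaling_function M X t q"
    unfolding scaling_function_def
  proof (rule Limsup_mono)
    show "\<forall>\<^sub>F h in at_right 0. ereal (ln C * inverse (ln h) + p)
      \<le> log_ennreal (abs_moment M q (\<lambda>\<omega>. X (t + h) \<omega> - X t \<omega>)) / ereal (ln h)"
      using bound eventually_at_right_real[of 0 "1::real", OF zero_less_one]
    proof eventually_elim
      case (elim h)
      then have h: "0 < h" "ln h < 0" by auto
      define m where "m = abs_moment M q (\<lambda>\<omega>. X (t + h) \<omega> - X t \<omega>)"
      have m: "m \<le> ennreal (C * h powr p)" using elim(1) by (simp add: m_def)
      then have fin: "m \<noteq> \<infinity>" by (auto simp: top_unique)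
      show ?case
      proof (cases "m = 0")
        \<comment> \<open>A vanishing moment has logarithm -\<infinity>, and the quotient by a
          negative number is \<infinity>.\<close>
        case True
        then show ?thesis using h by (simp add: m_def[symmetric] log_ennreal_def divide_ereal_def)
      next
        case False
        then have pos: "0 < enn2real m" using fin by (simp add: enn2real_positive_iff less_top[symmetric] zero_less_iff_neq_zero)
        have "enn2real m \<le> C * h powr p"
          using m C by (intro enn2real_leI) auto
        then have "ln (enn2real m) \<le> ln (C * h powr p)" using pos C h by simp
        also have "\<dots> = ln C + p * ln h" using C h by (simp add: ln_mult ln_powr)
        finally have "(ln C + p * ln h) / ln h \<le> ln (enn2real m) / ln h"
          using h by (intro divide_right_mono_neg) auto
        moreover have "(ln C + p * ln h) / ln h = ln C * inverse (ln h) + p"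
          using h(2) by (subst add_divide_distrib) (simp add: divide_inverse mult.assoc)
        ultimately have "ereal (ln C * inverse (ln h) + p) \<le> log_ennreal m / ereal (ln h)"
          using False fin h(2) by (simp add: log_ennreal_def)
        then show ?thesis by (simp only: m_def)
      qed
    qed
  qed
  finally show ?thesis .
qed

lemma stationary_nn_integral:
  assumes V: "stochastic_process M V" and stat: "stationary_process M V"
    and t: "0 \<le> t" and g[measurable]: "g \<in> borel_measurable borel"
  shows "(\<integral>\<^sup>+\<omega>. g (V t \<omega>) \<partial>M) = (\<integral>\<^sup>+\<omega>. g (V 0 \<omega>) \<partial>M)"
proof -
  have path: "path (\<lambda>s. V (s + u)) \<in> measurable M path_space" if "0 \<le> u" for u
    unfolding path_def using V that by (intro measurable_restrict) (auto simp: stochastic_process_def)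
  have coord: "(\<lambda>x. g (x 0)) \<in> borel_measurable path_space"
    by (rule measurable_compose[OF _ g], rule measurable_component_singleton) simp
  have "(\<integral>\<^sup>+\<omega>. g (V (0 + u) \<omega>) \<partial>M) = (\<integral>\<^sup>+x. g (x 0) \<partial>distr M path_space (path (\<lambda>s. V (s + u))))" if "0 \<le> u" for u
    by (subst nn_integral_distr[OF path[OF that]]) (use coord in \<open>simp_all add: path_def\<close>)
  from this[of t] this[of 0] show ?thesis
    using stat t unfolding stationary_process_def by simp
qed

text \<open>Transfers finite moments backwards through the two pathwise lower bounds: from the
  integrated variance to \<open>V t\<close>, and from the later volatility to
  \<open>U\<close>.\<close>

lemma (in prob_space) moment_affine_bound:
  assumes [measurable]: "W \<in> borel_measurable M" "J \<in> borel_measurable M"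
    and c: "0 \<le> c" "0 \<le> d" "0 < p"
    and bound: "AE \<omega> in M. 0 \<le> W \<omega> \<and> 0 \<le> J \<omega> \<and> W \<omega> \<le> c * J \<omega> + d"
    and fin: "(\<integral>\<^sup>+\<omega>. ennreal (J \<omega> powr p) \<partial>M) < \<infinity>"
  shows "(\<integral>\<^sup>+\<omega>. ennreal (W \<omega> powr p) \<partial>M) < \<infinity>"
proof -
  define c' where "c' = 2 powr p * c powr p"
  define d' where "d' = 2 powr p * d powr p"
  have "AE \<omega> in M. ennreal (W \<omega> powr p) \<le> ennreal c' * ennreal (J \<omega> powr p) + ennreal d'"
    using bound
  proof eventually_elim
    case (elim \<omega>)
    then have "W \<omega> powr p \<le> (c * J \<omega> + d) powr p"
      using c by (intro powr_mono2) auto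
    also have "\<dots> \<le> 2 powr p * ((c * J \<omega>) powr p + d powr p)"
      using c elim by (intro powr_add_le) auto
    also have "\<dots> = c' * J \<omega> powr p + d'"
      using c elim by (simp add: c'_def d'_def powr_mult algebra_simps)
    finally have "ennreal (W \<omega> powr p) \<le> ennreal (c' * J \<omega> powr p + d')" by (rule ennreal_leI)
    also have "\<dots> = ennreal c' * ennreal (J \<omega> powr p) + ennreal d'"
      by (simp add: c'_def d'_def ennreal_mult)
    finally show ?case .
  qed
  then have "(\<integral>\<^sup>+\<omega>. ennreal (W \<omega> powr p) \<partial>M) \<le> (\<integral>\<^sup>+\<omega>. ennreal c' * ennreal (J \<omega> powr p) + ennreal d' \<partial>M)"
    by (rule nn_integral_mono_AE)
  also have "\<dots> = ennreal c' * (\<integral>\<^sup>+\<omega>. ennreal (J \<omega> powr p) \<partial>M) + ennreal d'"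
    by (subst nn_integral_add) (auto simp: nn_integral_cmult emeasure_space_1)
  also have "\<dots> < \<infinity>" using fin by (simp add: ennreal_mult_less_top)
  finally show ?thesis .
qed

lemma volatility_pathI:
  assumes f: "f \<in> {0..} \<rightarrow> {0..}" "local_lipschitz (UNIV :: real set) {0..} (\<lambda>_. f)" "f 0 = 0"
    and ab: "0 < a" "0 < b" and growth: "\<And>v. 0 < v \<Longrightarrow> \<bar>f v\<bar> \<le> a * v + b"
    and v: "\<And>t. 0 \<le> t \<Longrightarrow> 0 \<le> v t" "\<And>t. 0 \<le> t \<Longrightarrow> set_integrable lborel {0..t} (\<lambda>s. f (v s))"
      "\<And>t. 0 \<le> t \<Longrightarrow> v t = v 0 - (LINT s:{0..t}|lborel. f (v s)) + l t"
    and l: "mono_on {0..} l" "l 0 = 0"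
  shows "volatility_path f a b v l"
proof
  show "0 \<le> f x" if "0 \<le> x" for x using f(1) that by auto
  show "f x \<le> a * x + b" if "0 \<le> x" for x
    \<comment> \<open>The growth bound is given for positive arguments; at 0 it follows from
      \<open>f 0 = 0\<close>.\<close>
    using growth[of x] f(3) ab that by (cases "x = 0") auto
  show "\<exists>K\<ge>0. \<forall>x\<in>{0..R}. \<forall>y\<in>{0..R}. \<bar>f x - f y\<bar> \<le> K * \<bar>x - y\<bar>" for R
  proof -
    \<comment> \<open>The time parameter is a dummy. Restricting it to one point makes both sets
      compact, so that a global Lipschitz constant exists.\<close>
    have "local_lipschitz {0 :: real} {0..R} (\<lambda>_. f)"
      by (rule local_lipschitz_subset[OF f(2)]) auto
    then obtain K where "K-lipschitz_on {0..R} f"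
      by (rule local_lipschitz_compact_implies_lipschitz) auto
    then show ?thesis by (auto simp: lipschitz_on_def dist_real_def)
  qed
qed (rule ab v l; assumption)+

text \<open>Below 0 nothing is known about \<open>f\<close>, hence the composition with
  \<open>max 0\<close>.\<close>

lemma local_lipschitz_measurable:
  assumes "local_lipschitz (UNIV :: real set) {0..} (\<lambda>_. f :: real \<Rightarrow> real)"
  shows "(\<lambda>x. f (max 0 x)) \<in> borel_measurable borel"
proof -
  have "continuous_on {0..} f"
    by (rule local_lipschitz_continuous_on[OF assms, of 0]) simp
  then have "continuous_on UNIV (\<lambda>x. f (max 0 x))"
    by (rule continuous_on_compose2) (auto intro!: continuous_intros)
  then show ?thesis by (rule borel_measurable_continuous_onI)
qed

section \<open>The dichotomy for the scaling function\<close>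

theorem proposition7:
  fixes M :: "'a measure" and F :: "real \<Rightarrow> 'a measure"
    and B L X V \<sigma> :: "real \<Rightarrow> 'a \<Rightarrow> real"
    and f :: "real \<Rightarrow> real" and a b :: real
  assumes "prob_space M"
    and "standard_brownian_motion M B"
    and "levy_subordinator M L"
    and "independent_processes M B L"
    and "f \<in> {0..} \<rightarrow> {0..}"
    and "local_lipschitz (UNIV :: real set) {0..} (\<lambda>_. f)"
    and "f 0 = 0"
    and "a > 0" and "b > 0"
    and "\<And>v. v > 0 \<Longrightarrow> \<bar>f v\<bar> \<le> a * v + b"
    and "solves_system M F f B L X V \<sigma>"
    and "independent_of_pair M (V 0) B L"
    and "stationary_process M V"
    and "AE \<omega> in M. \<forall>t\<ge>0. 0 \<le> V t \<omega>"
    and "\<And>t. t \<ge> 0 \<Longrightarrow> integrable M (V t)"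
    and assumption_A: "tendsto_in_probability M
           (\<lambda>h \<omega>. 1 / h * (LINT s:{0..h}|lborel. (\<sigma> s \<omega> - \<sigma> 0 \<omega>)\<^sup>2)) (\<lambda>_. 0) (at_right 0)"
    and assumption_B: "integrable M (\<lambda>\<omega>. (\<sigma> 0 \<omega>)\<^sup>2)"
  shows "\<forall>t\<ge>0. \<not> multi_scaling M X t"
proof (intro allI impI)
  fix t :: real assume t: "0 \<le> t"
  have ito: "ito_integral M F B \<sigma> (\<lambda>t \<omega>. X t \<omega> - X 0 \<omega>)" and V_proc: "stochastic_process M V"
    and V_eq: "AE \<omega> in M. \<forall>t\<ge>0. set_integrable lborel {0..t} (\<lambda>s. f (V s \<omega>)) \<and>
        V t \<omega> = V 0 \<omega> - (LINT s:{0..t}|lborel. f (V s \<omega>)) + L t \<omega>"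
    and sigma: "AE \<omega> in M. \<forall>t\<ge>0. 0 \<le> \<sigma> t \<omega> \<and> V t \<omega> = (\<sigma> t \<omega>)\<^sup>2"
    using \<open>solves_system M F f B L X V \<sigma>\<close> by (auto simp: solves_system_def)
  have L_proc: "stochastic_process M L" and L_mono: "AE \<omega> in M. mono_on {0..} (\<lambda>t. L t \<omega>)" and L_0: "AE \<omega> in M. L 0 \<omega> = 0"
    using \<open>levy_subordinator M L\<close> by (auto simp: levy_subordinator_def levy_process_def)
  have V_meas [measurable]: "V s \<in> borel_measurable M" and L_meas [measurable]: "L s \<in> borel_measurable M" if "0 \<le> s" for s
    using V_proc L_proc that by (auto simp: stochastic_process_def)
  interpret prob_space M by fact
  have path: "AE \<omega> in M. volatility_path f a b (\<lambda>s. V s \<omega>) (\<lambda>s. L s \<omega>)"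
    using V_eq L_mono L_0 \<open>AE \<omega> in M. \<forall>t\<ge>0. 0 \<le> V t \<omega>\<close>
  proof eventually_elim
    case (elim \<omega>)
    show ?case
      by (rule volatility_pathI) (use assms(5-10) elim in blast)+
  qed
  have prog: "progressively_measurable F \<sigma>" and bm: "adapted_brownian_motion M F B"
    using ito by (auto simp: ito_integral_def)
  have regular: "AE \<omega> in M. regular_path (\<lambda>s. \<sigma> s \<omega>)"
    using path sigma
  proof eventually_elim
    case (elim \<omega>)
    show ?case
      by (rule volatility_path.regular_path_sqrt[OF elim(1)]) (use elim(2) in simp)
  qed
  interpret conditionally_gaussian M F B "initial_path_algebra M (V 0) L" \<sigma>
  proof
    show "adapted_brownian_motion M F B" by fact
    show "space (initial_path_algebra M (V 0) L) = space M" by simp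
    show "indep_set (sets (initial_path_algebra M (V 0) L)) (sets (vimage_algebra (space M) (path B) path_space))"
      by (rule initial_path_algebra_indep) fact+
    fix s :: real assume s: "0 \<le> s"
    obtain Y where Y: "Y \<in> borel_measurable (initial_path_algebra M (V 0) L)" "AE \<omega> in M. V s \<omega> = Y \<omega>"
      using volatility_version[OF local_lipschitz_measurable[OF assms(6)] path s] by blast
    have "AE \<omega> in M. \<sigma> s \<omega> = sqrt (Y \<omega>)"
      using sigma Y(2)
    proof eventually_elim
      case (elim \<omega>)
      then have "0 \<le> \<sigma> s \<omega>" "Y \<omega> = (\<sigma> s \<omega>)\<^sup>2" using s by auto
      then show ?case by simp
    qed
    moreover have "(\<lambda>\<omega>. sqrt (Y \<omega>)) \<in> borel_measurable (initial_path_algebra M (V 0) L)"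
      using Y(1) by simp
    ultimately show "\<exists>Y\<in>borel_measurable (initial_path_algebra M (V 0) L). AE \<omega> in M. \<sigma> s \<omega> = Y \<omega>"
      by (intro bexI[of _ "\<lambda>\<omega>. sqrt (Y \<omega>)"])
  qed
  \<comment> \<open>The two bounds are the smallness conditions of \<open>v_ge\<close>: length at
    most 1, and at most one half after multiplication by \<open>a\<close>.\<close>
  define h0 where "h0 = min 1 (1 / (2 * a))"
  have h0: "0 < h0" "h0 \<le> 1" "a * h0 \<le> 1 / 2"
    using \<open>a > 0\<close> by (auto simp: h0_def min_def field_simps)
  have small: "\<forall>\<^sub>F h in at_right 0. h \<in> {0<..<h0}"
    using eventually_at_right_real[OF h0(1)] .
  define R where "R = (\<lambda>h \<omega>. LINT s:{t..t+h}|lborel. (\<sigma> s \<omega>)\<^sup>2)"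
  have zero_simple: "simple_integrand F (0, \<lambda>_. 0, \<lambda>_ _. 0)" by (simp add: simple_integrand_def mono_def)
  have R_meas: "R h \<in> borel_measurable M" if "0 < h" for h
    using quadratic_error_measurable[OF zero_simple prog t, of "t + h"] that by (simp add: simple_value_def R_def)
  have R_eq: "AE \<omega> in M. \<forall>h. R h \<omega> = (LINT s:{t..t+h}|lborel. V s \<omega>)"
    using sigma
  proof eventually_elim
    case (elim \<omega>)
    show ?case
      unfolding R_def set_lebesgue_integral_def
      by (intro allI Bochner_Integration.integral_cong refl) (use elim t in \<open>auto simp: indicator_def\<close>)
  qed
  have R_nonneg: "0 \<le> R h \<omega>" for h \<omega>
    unfolding R_def set_lebesgue_integral_def by (auto intro!: integral_nonneg)
  have dichotomy: "scaling_function M X t q = - \<infinity> \<or> ereal (q / 2) \<le> scaling_function M X t q" if q: "1 \<le> q" for q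
  proof -
    define p where "p = q / 2"
    have p: "0 < p" using q by (simp add: p_def)
    define c where "c = abs_moment std_normal q (\<lambda>z. z)"
    have c: "0 < c" "c < \<infinity>" using std_normal_moment_pos std_normal_moment_finite[of q] q by (auto simp: c_def)
    have moment: "abs_moment M q (\<lambda>\<omega>. X (t + h) \<omega> - X t \<omega>) = c * (\<integral>\<^sup>+\<omega>. ennreal (R h \<omega> powr p) \<partial>M)" if "0 < h" for h
      using abs_moment_increment[OF ito t that _ regular, of q] q by (simp add: c_def R_def p_def)
    show ?thesis
    proof (cases "(\<integral>\<^sup>+\<omega>. ennreal (V t \<omega> powr p) \<partial>M) = \<infinity>")
      case True
      have "\<forall>\<^sub>F h in at_right 0. abs_moment M q (\<lambda>\<omega>. X (t + h) \<omega> - X t \<omega>) = \<infinity>"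
        using small
      proof eventually_elim
        case (elim h)
        then have "a * h \<le> a * h0" using \<open>a > 0\<close> by (intro mult_left_mono) auto
        then have h: "0 < h" "h \<le> 1" "a * h \<le> 1 / 2" using h0 elim by auto
        have "(\<integral>\<^sup>+\<omega>. ennreal (R h \<omega> powr p) \<partial>M) = \<infinity>"
        proof (rule ccontr)
          assume "(\<integral>\<^sup>+\<omega>. ennreal (R h \<omega> powr p) \<partial>M) \<noteq> \<infinity>"
          then have fin: "(\<integral>\<^sup>+\<omega>. ennreal (R h \<omega> powr p) \<partial>M) < \<infinity>" by (simp add: less_top)
          \<comment> \<open>The lower bound on the integral is solved for \<open>V t\<close>. The
            factor \<open>2 / h\<close> blows up as \<open>h\<close> decreases, but only finiteness
            at a fixed \<open>h\<close> is at stake.\<close>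
          have "AE \<omega> in M. 0 \<le> V t \<omega> \<and> 0 \<le> R h \<omega> \<and> V t \<omega> \<le> 2 / h * R h \<omega> + 2 * b"
            using path R_eq
          proof eventually_elim
            case (elim \<omega>)
            have "h * (V t \<omega> / 2 - b) \<le> R h \<omega>"
              using volatility_path.v_integral_ge[OF elim(1) t _ h(2,3)] elim(2) h(1) by simp
            then show ?case
              using volatility_path.v_nonneg[OF elim(1) t] R_nonneg h(1) by (simp add: field_simps)
          qed
          then have "(\<integral>\<^sup>+\<omega>. ennreal (V t \<omega> powr p) \<partial>M) < \<infinity>"
            using fin h(1) \<open>b > 0\<close> p t by (intro moment_affine_bound[of "V t" "R h" "2 / h" "2 * b" p] R_meas V_meas) auto
          then show False using True by simp
        qed
        then show ?case using moment[OF h(1)] c by (simp add: ennreal_mult_eq_top_iff)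
      qed
      then show ?thesis by (intro disjI1 scaling_function_infinite)
    next
      case False
      \<comment> \<open>The increment of \<open>L\<close> is taken over the fixed length
        \<open>h0\<close>, so that one variable dominates \<open>R h / h\<close> for all smaller
        \<open>h\<close> and the constant \<open>C\<close> does not depend on
        \<open>h\<close>.\<close>
      define U where "U = (\<lambda>\<omega>. V t \<omega> + (L (t + h0) \<omega> - L t \<omega>))"
      have U_meas: "U \<in> borel_measurable M"
        unfolding U_def using t h0(1) by (intro borel_measurable_add borel_measurable_diff V_meas L_meas) auto
      have same_law: "(\<integral>\<^sup>+\<omega>. ennreal (V s \<omega> powr p) \<partial>M) = (\<integral>\<^sup>+\<omega>. ennreal (V 0 \<omega> powr p) \<partial>M)" if "0 \<le> s" for s
        by (rule stationary_nn_integral[OF V_proc \<open>stationary_process M V\<close> that]) simp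
      \<comment> \<open>Stationarity moves the finite moment to time \<open>t + h0\<close>, where
        the volatility has already absorbed the increment of \<open>L\<close> contained in
        \<open>U\<close>.\<close>
      have fin: "(\<integral>\<^sup>+\<omega>. ennreal (V (t + h0) \<omega> powr p) \<partial>M) < \<infinity>"
        using False same_law[of t] same_law[of "t + h0"] t h0(1) by (simp add: less_top)
      have "AE \<omega> in M. 0 \<le> U \<omega> \<and> 0 \<le> V (t + h0) \<omega> \<and> U \<omega> \<le> 2 * V (t + h0) \<omega> + 2 * b"
        using path
      proof eventually_elim
        case (elim \<omega>)
        have "U \<omega> / 2 - b \<le> V (t + h0) \<omega>"
          using volatility_path.v_ge[OF elim t, of "t + h0"] t h0 by (simp add: U_def)
        moreover have "0 \<le> U \<omega>"
          using volatility_path.v_nonneg[OF elim t] volatility_path.l_le[OF elim t, of "t + h0"] h0(1) by (simp add: U_def)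
        ultimately show ?case
          using volatility_path.v_nonneg[OF elim, of "t + h0"] t h0(1) by simp
      qed
      then have U_fin: "(\<integral>\<^sup>+\<omega>. ennreal (U \<omega> powr p) \<partial>M) < \<infinity>"
        using fin \<open>b > 0\<close> p t h0(1) by (intro moment_affine_bound[of U "V (t + h0)" 2 "2 * b" p] U_meas V_meas) auto
      \<comment> \<open>Adding 1 keeps the constant positive, so that its logarithm can be used,
        even when the moment of \<open>U\<close> is 0.\<close>
      define C where "C = enn2real (c * (\<integral>\<^sup>+\<omega>. ennreal (U \<omega> powr p) \<partial>M)) + 1"
      have C: "0 < C" "c * (\<integral>\<^sup>+\<omega>. ennreal (U \<omega> powr p) \<partial>M) \<le> ennreal C"
      proof -
        have "c * (\<integral>\<^sup>+\<omega>. ennreal (U \<omega> powr p) \<partial>M) < \<infinity>" using c U_fin by (simp add: ennreal_mult_less_top)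
        then have "c * (\<integral>\<^sup>+\<omega>. ennreal (U \<omega> powr p) \<partial>M) = ennreal (enn2real (c * (\<integral>\<^sup>+\<omega>. ennreal (U \<omega> powr p) \<partial>M)))"
          by simp
        also have "\<dots> \<le> ennreal C" unfolding C_def by (intro ennreal_leI) simp
        finally show "c * (\<integral>\<^sup>+\<omega>. ennreal (U \<omega> powr p) \<partial>M) \<le> ennreal C" .
        show "0 < C" unfolding C_def using enn2real_nonneg by (intro add_nonneg_pos) auto
      qed
      have "\<forall>\<^sub>F h in at_right 0. abs_moment M q (\<lambda>\<omega>. X (t + h) \<omega> - X t \<omega>) \<le> ennreal (C * h powr p)"
        using small
      proof eventually_elim
        case (elim h)
        then have h: "0 < h" "h < h0" by auto
        have "AE \<omega> in M. ennreal (R h \<omega> powr p) \<le> ennreal (h powr p) * ennreal (U \<omega> powr p)"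
          using path R_eq
        proof eventually_elim
          case (elim \<omega>)
          have L_le: "L t \<omega> \<le> L (t + h) \<omega>" "L (t + h) \<omega> \<le> L (t + h0) \<omega>"
            using volatility_path.l_le[OF elim(1)] t h by auto
          have "R h \<omega> \<le> h * (V t \<omega> + (L (t + h) \<omega> - L t \<omega>))"
            using volatility_path.v_integral_le[OF elim(1) t, of h] elim(2) h by simp
          also have "\<dots> \<le> h * U \<omega>"
            using L_le h by (intro mult_left_mono) (auto simp: U_def)
          finally have "R h \<omega> powr p \<le> (h * U \<omega>) powr p"
            using R_nonneg p by (intro powr_mono2) auto
          also have "\<dots> = h powr p * U \<omega> powr p"
            by (rule powr_mult)
          finally show ?case by (simp add: ennreal_mult[symmetric] ennreal_leI)
        qed
        then have "(\<integral>\<^sup>+\<omega>. ennreal (R h \<omega> powr p) \<partial>M) \<le> (\<integral>\<^sup>+\<omega>. ennreal (h powr p) * ennreal (U \<omega> powr p) \<partial>M)"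
          by (rule nn_integral_mono_AE)
        also have "\<dots> = ennreal (h powr p) * (\<integral>\<^sup>+\<omega>. ennreal (U \<omega> powr p) \<partial>M)"
          using U_meas by (intro nn_integral_cmult) simp
        finally have "abs_moment M q (\<lambda>\<omega>. X (t + h) \<omega> - X t \<omega>)
          \<le> c * (ennreal (h powr p) * (\<integral>\<^sup>+\<omega>. ennreal (U \<omega> powr p) \<partial>M))"
          unfolding moment[OF h(1)] by (intro mult_left_mono) auto
        also have "\<dots> = (c * (\<integral>\<^sup>+\<omega>. ennreal (U \<omega> powr p) \<partial>M)) * ennreal (h powr p)" by (simp add: ac_simps)
        also have "\<dots> \<le> ennreal C * ennreal (h powr p)" by (intro mult_right_mono C) auto
        also have "\<dots> = ennreal (C * h powr p)" using C(1) by (simp add: ennreal_mult)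
        finally show ?case .
      qed
      then have "ereal p \<le> scaling_function M X t q" by (rule scaling_function_ge[OF C(1)])
      then show ?thesis by (simp add: p_def)
    qed
  qed
  \<comment> \<open>The dichotomy leaves no value strictly between -\<infinity> and
    \<open>q / 2\<close>.\<close>
  have "{q. 1 \<le> q \<and> - \<infinity> < scaling_function M X t q \<and> scaling_function M X t q < ereal (q / 2)} = {}"
    using dichotomy by (fastforce simp: not_le[symmetric])
  then show "\<not> multi_scaling M X t"
    unfolding multi_scaling_def by (simp only: interior_empty simp_thms)
qed

end
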